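(* Let $K$ be a subfield of $\mathbb{C}$ and let $A$ be a generic commutative nonassociative algebra over $K$, $\dim_K A=n$. Then $$\sum_{c\in \mathrm{Idm}_0(A)}\frac{\chi_c(t)}{\chi_c(\frac12)}=2^n\qquad\text{for all } t\in\mathbb{R}.$$ In particular, $$\sum_{c\in \mathrm{Idm}_0(A)}\frac{\chi^{(k)}_c(\frac12)}{\chi_c(\frac12)}=0,\qquad k=1,2,\ldots,n,$$ where $\chi_c^{(k)}$ denotes the $k$-th derivative of $\chi_c$.
   Context: "Nonassociative" means not necessarily associative; all algebras are finite-dimensional. An element $c$ is an idempotent if $c^2=c$. $\mathrm{Idm}_0(A)=\{c\in A: c^2=c\}$ is the set of all idempotents of $A$, including $0$. An algebra $A$ over $K\subset\mathbb{C}$ with $n=\dim_K A$ is called generic if its complexification $A_{\mathbb{C}}=A\otimes_K\mathbb{C}$ contains exactly $2^n$ distinct idempotents (the zero element included). For $c\in\mathrm{Idm}_0(A)$, $L_c:A\to A$ is the multiplication operator $L_c y=cy$ and $\chi_c(t)=\det(L_c-tI)$ is its characteristic polynomial. (For generic $A$ one has $\chi_c(\frac12)\ne0$ for every idempotent $c$ of $A$.)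
   Formalization: As printed this fails (K=ℝ, A=ℂ: generic, but Idm₀(A)={0,1} and the sum at t=1/2 is 2, not 4). Proved instead: both identities summed over all 2^n idempotents of A_ℂ for every generic A, and summed over Idm₀(A) when Idm₀(A) has 2^n elements. *)

theory Defs
  imports "Jordan_Normal_Form.Char_Poly"
begin

text \<open>
  A subfield of the complex numbers is given as a field \<open>'k\<close> together with an embedding
  \<open>\<iota> :: 'k \<Rightarrow> complex\<close>. The algebra is the whole type \<open>'a\<close>, a vector space over \<open>'k\<close>
  with an arbitrary bilinear product \<open>amul\<close>; finite dimensionality is witnessed by an ordered
  basis \<open>es\<close>, which is also the basis in which operators are written as matrices.
  The zero algebra (\<open>es = []\<close>) is included.
\<close>

locale fd_nonassoc_algebra =
  emb: field_hom \<iota> + vector_space scale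
  for \<iota> :: "'k::field \<Rightarrow> complex"
    and scale :: "'k \<Rightarrow> 'a::ab_group_add \<Rightarrow> 'a"
    and amul :: "'a \<Rightarrow> 'a \<Rightarrow> 'a"
    and es :: "'a list" +
  assumes amul_linear_right: "Vector_Spaces.linear scale scale (\<lambda>y. amul x y)"
    and amul_linear_left: "Vector_Spaces.linear scale scale (\<lambda>x. amul x y)"
    and distinct_es: "distinct es"
    and independent_es: "independent (set es)"
    and span_es: "span (set es) = UNIV"

definition Idm0 :: "('a \<Rightarrow> 'a \<Rightarrow> 'a) \<Rightarrow> 'a set" where
  "Idm0 amul = {c. amul c c = c}"

definition coord :: "('k::field \<Rightarrow> 'a::ab_group_add \<Rightarrow> 'a) \<Rightarrow> 'a list \<Rightarrow> 'a \<Rightarrow> nat \<Rightarrow> 'k" where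
  "coord scale es x i = module.representation scale (set es) x (es ! i)"

text \<open>
  The polynomial \<open>det (M - t I)\<close> in \<open>t\<close>. It differs from \<^const>\<open>char_poly\<close>, which is
  \<open>det (t I - M)\<close>, by the sign \<open>(-1) ^ n\<close>.
\<close>

definition chi_mat :: "'c::comm_ring_1 mat \<Rightarrow> 'c poly" where
  "chi_mat M = det (map_mat (\<lambda>a. [:a:]) M - [:0, 1:] \<cdot>\<^sub>m 1\<^sub>m (dim_row M))"

definition chi ::
    "('k::field \<Rightarrow> 'a::ab_group_add \<Rightarrow> 'a) \<Rightarrow> ('a \<Rightarrow> 'a \<Rightarrow> 'a) \<Rightarrow> 'a list \<Rightarrow> 'a \<Rightarrow> 'k poly" where
  "chi scale amul es c =
     chi_mat (mat (length es) (length es) (\<lambda>(i, j). coord scale es (amul c (es ! j)) i))"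

text \<open>
  The complexification, the tensor product of \<open>A\<close> with \<open>\<complex>\<close> over \<open>K\<close>, is realised on
  \<open>\<complex>\<^sup>n\<close>, whose \<open>i\<close>-th unit vector stands for \<open>e\<^sub>i \<otimes> 1\<close>. The theorems \<open>tensor_universal\<close>
  and \<open>cx_mult_tensor\<close> below show that this is the tensor product, with the product
  determined by \<open>(x \<otimes> z) (y \<otimes> w) = x y \<otimes> z w\<close>.
\<close>

definition cx_carrier :: "'a list \<Rightarrow> complex vec set" where
  "cx_carrier es = carrier_vec (length es)"

definition cx_mult ::
    "('k::field \<Rightarrow> complex) \<Rightarrow> ('k \<Rightarrow> 'a::ab_group_add \<Rightarrow> 'a) \<Rightarrow> ('a \<Rightarrow> 'a \<Rightarrow> 'a) \<Rightarrow> 'a list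
      \<Rightarrow> complex vec \<Rightarrow> complex vec \<Rightarrow> complex vec" where
  "cx_mult \<iota> scale amul es u v =
     vec (length es) (\<lambda>k. \<Sum>i<length es. \<Sum>j<length es.
       \<iota> (coord scale es (amul (es ! i) (es ! j)) k) * (u $ i * v $ j))"

definition tensor ::
    "('k::field \<Rightarrow> complex) \<Rightarrow> ('k \<Rightarrow> 'a::ab_group_add \<Rightarrow> 'a) \<Rightarrow> 'a list
      \<Rightarrow> 'a \<Rightarrow> complex \<Rightarrow> complex vec" where
  "tensor \<iota> scale es x z = vec (length es) (\<lambda>i. \<iota> (coord scale es x i) * z)"

definition cx_Idm0 ::
    "('k::field \<Rightarrow> complex) \<Rightarrow> ('k \<Rightarrow> 'a::ab_group_add \<Rightarrow> 'a) \<Rightarrow> ('a \<Rightarrow> 'a \<Rightarrow> 'a) \<Rightarrow> 'a list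
      \<Rightarrow> complex vec set" where
  "cx_Idm0 \<iota> scale amul es = {c \<in> cx_carrier es. cx_mult \<iota> scale amul es c c = c}"

definition cx_chi ::
    "('k::field \<Rightarrow> complex) \<Rightarrow> ('k \<Rightarrow> 'a::ab_group_add \<Rightarrow> 'a) \<Rightarrow> ('a \<Rightarrow> 'a \<Rightarrow> 'a) \<Rightarrow> 'a list
      \<Rightarrow> complex vec \<Rightarrow> complex poly" where
  "cx_chi \<iota> scale amul es c =
     chi_mat (mat (length es) (length es)
       (\<lambda>(i, j). cx_mult \<iota> scale amul es c (unit_vec (length es) j) $ i))"

text \<open>
  A generic algebra need not contain all \<open>2 ^ n\<close> idempotents of its complexification: for \<open>\<complex>\<close>
  as an algebra over the reals, \<^const>\<open>Idm0\<close> has 2 elements and \<^const>\<open>cx_Idm0\<close> has 4.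
\<close>

definition generic ::
    "('k::field \<Rightarrow> complex) \<Rightarrow> ('k \<Rightarrow> 'a::ab_group_add \<Rightarrow> 'a) \<Rightarrow> ('a \<Rightarrow> 'a \<Rightarrow> 'a) \<Rightarrow> 'a list
      \<Rightarrow> bool" where
  "generic \<iota> scale amul es \<longleftrightarrow>
     card (cx_Idm0 \<iota> scale amul es) = 2 ^ vector_space.dim scale (UNIV :: 'a set)"

context fd_nonassoc_algebra
begin

lemma dim_eq_length: "dim UNIV = length es"
  by (metis dim_eq_card_independent dim_span distinct_card distinct_es independent_es span_es)

lemma coord_add: "coord scale es (x + y) i = coord scale es x i + coord scale es y i"
  using span_es by (simp add: coord_def representation_add[OF independent_es])

lemma coord_scale: "coord scale es (scale a x) i = a * coord scale es x i"
  using span_es by (simp add: coord_def representation_scale[OF independent_es])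

lemma coord_sum: "coord scale es (\<Sum>j\<in>S. f j) i = (\<Sum>j\<in>S. coord scale es (f j) i)"
  using span_es by (simp add: coord_def representation_sum[OF independent_es])

lemma coord_basis:
  assumes "i < length es" "j < length es"
  shows "coord scale es (es ! j) i = (if i = j then 1 else 0)"
  using assms distinct_es
  by (simp add: coord_def representation_basis[OF independent_es] nth_eq_iff_index_eq)

lemma expand: "x = (\<Sum>i<length es. scale (coord scale es x i) (es ! i))"
proof -
  have "x = (\<Sum>b\<in>set es. scale (representation (set es) x b) b)"
    by (rule sum_representation_eq[symmetric]) (auto simp: independent_es span_es)
  also have "\<dots> = (\<Sum>i<length es. scale (coord scale es x i) (es ! i))"
    unfolding coord_def
    by (rule sum.reindex_bij_betw[symmetric, OF bij_betw_nth[OF distinct_es]]) auto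
  finally show ?thesis .
qed

lemma cx_mult_tensor:
  "cx_mult \<iota> scale amul es (tensor \<iota> scale es x z) (tensor \<iota> scale es y w)
     = tensor \<iota> scale es (amul x y) (z * w)"
proof -
  let ?n = "length es" let ?c = "coord scale es"
  have xy: "amul x y = (\<Sum>i<?n. \<Sum>j<?n. scale (?c x i * ?c y j) (amul (es ! i) (es ! j)))"
  proof -
    have left: "amul (\<Sum>i\<in>S. scale (a i) (f i)) y = (\<Sum>i\<in>S. scale (a i) (amul (f i) y))"
      for S :: "nat set" and a f y
    proof -
      interpret Vector_Spaces.linear scale scale "\<lambda>x. amul x y" by (rule amul_linear_left)
      show ?thesis by (simp add: sum scale)
    qed
    have right: "amul x (\<Sum>i\<in>S. scale (a i) (f i)) = (\<Sum>i\<in>S. scale (a i) (amul x (f i)))"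
      for S :: "nat set" and a f x
    proof -
      interpret Vector_Spaces.linear scale scale "\<lambda>y. amul x y" by (rule amul_linear_right)
      show ?thesis by (simp add: sum scale)
    qed
    have "amul x y = amul (\<Sum>i<?n. scale (?c x i) (es ! i)) y"
      using expand[of x] by simp
    also have "\<dots> = (\<Sum>i<?n. scale (?c x i) (amul (es ! i) y))"
      by (rule left)
    also have "\<dots> = (\<Sum>i<?n. scale (?c x i) (amul (es ! i) (\<Sum>j<?n. scale (?c y j) (es ! j))))"
      using expand[of y] by simp
    also have "\<dots> = (\<Sum>i<?n. \<Sum>j<?n. scale (?c x i * ?c y j) (amul (es ! i) (es ! j)))"
      by (simp add: right scale_sum_right)
    finally show ?thesis .
  qed
  show ?thesis
    unfolding cx_mult_def tensor_def xy
    by (rule eq_vecI)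
      (auto simp: coord_sum coord_scale emb.hom_sum emb.hom_mult sum_distrib_left sum_distrib_right
        mult_ac intro!: sum.cong)
qed

text \<open>
  Every \<open>K\<close>-bilinear map on \<open>A \<times> \<complex>\<close> factors uniquely through \<^const>\<open>tensor\<close>, as a
  \<open>K\<close>-linear map on \<^term>\<open>cx_carrier es\<close>.
\<close>

theorem tensor_bilinear:
  shows "tensor \<iota> scale es x z \<in> cx_carrier es"
    and "tensor \<iota> scale es (x + y) z = tensor \<iota> scale es x z + tensor \<iota> scale es y z"
    and "tensor \<iota> scale es x (z + w) = tensor \<iota> scale es x z + tensor \<iota> scale es x w"
    and "tensor \<iota> scale es (scale a x) z = \<iota> a \<cdot>\<^sub>v tensor \<iota> scale es x z"
    and "tensor \<iota> scale es x (w * z) = w \<cdot>\<^sub>v tensor \<iota> scale es x z"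
  by (auto simp: tensor_def cx_carrier_def coord_add coord_scale emb.hom_add emb.hom_mult
      algebra_simps intro!: eq_vecI)

lemma vec_expand:
  assumes "v \<in> cx_carrier es"
  shows "v = finsum_vec TYPE(complex) (length es)
    (\<lambda>i. tensor \<iota> scale es (es ! i) (v $ i)) {..<length es}"
proof (rule eq_vecI)
  fix k
  assume k: "k < dim_vec (finsum_vec TYPE(complex) (length es)
    (\<lambda>i. tensor \<iota> scale es (es ! i) (v $ i)) {..<length es})"
  have F: "(\<lambda>i. tensor \<iota> scale es (es ! i) (v $ i)) \<in> {..<length es} \<rightarrow> carrier_vec (length es)"
    by (auto simp: tensor_def)
  from k have k: "k < length es"
    using finsum_vec_closed[OF F] by auto
  have "(\<Sum>i<length es. \<iota> (coord scale es (es ! i) k) * v $ i)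
      = (\<Sum>i<length es. if k = i then v $ i else 0)"
    using k by (intro sum.cong) (auto simp: coord_basis)
  then show "v $ k = finsum_vec TYPE(complex) (length es)
    (\<lambda>i. tensor \<iota> scale es (es ! i) (v $ i)) {..<length es} $ k"
    unfolding index_finsum_vec[OF finite_lessThan k F] using k by (simp add: tensor_def)
next
  have F: "(\<lambda>i. tensor \<iota> scale es (es ! i) (v $ i)) \<in> {..<length es} \<rightarrow> carrier_vec (length es)"
    by (auto simp: tensor_def)
  show "dim_vec v = dim_vec (finsum_vec TYPE(complex) (length es)
    (\<lambda>i. tensor \<iota> scale es (es ! i) (v $ i)) {..<length es})"
    using finsum_vec_closed[OF F] assms by (auto simp: cx_carrier_def)
qed

theorem tensor_universal:
  fixes scaleW :: "'k \<Rightarrow> 'w::ab_group_add \<Rightarrow> 'w" and \<beta> :: "'a \<Rightarrow> complex \<Rightarrow> 'w"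
  assumes W: "vector_space scaleW"
    and add1: "\<And>x y z. \<beta> (x + y) z = \<beta> x z + \<beta> y z"
    and add2: "\<And>x z w. \<beta> x (z + w) = \<beta> x z + \<beta> x w"
    and scale1: "\<And>a x z. \<beta> (scale a x) z = scaleW a (\<beta> x z)"
    and scale2: "\<And>a x z. \<beta> x (\<iota> a * z) = scaleW a (\<beta> x z)"
  shows "\<exists>g. (\<forall>u\<in>cx_carrier es. \<forall>v\<in>cx_carrier es. g (u + v) = g u + g v)
      \<and> (\<forall>a. \<forall>v\<in>cx_carrier es. g (\<iota> a \<cdot>\<^sub>v v) = scaleW a (g v))
      \<and> (\<forall>x z. g (tensor \<iota> scale es x z) = \<beta> x z)
      \<and> (\<forall>h. (\<forall>u\<in>cx_carrier es. \<forall>v\<in>cx_carrier es. h (u + v) = h u + h v)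
            \<and> (\<forall>a. \<forall>v\<in>cx_carrier es. h (\<iota> a \<cdot>\<^sub>v v) = scaleW a (h v))
            \<and> (\<forall>x z. h (tensor \<iota> scale es x z) = \<beta> x z)
          \<longrightarrow> (\<forall>v\<in>cx_carrier es. h v = g v))"
proof -
  interpret W: vector_space scaleW by fact
  define g where "g v = (\<Sum>i<length es. \<beta> (es ! i) (v $ i))" for v
  have sum1: "\<beta> (\<Sum>i\<in>S. f i) z = (\<Sum>i\<in>S. \<beta> (f i) z)" if "finite S"
    for S :: "nat set" and f z
    using that
  proof (induction S rule: finite_induct)
    case empty
    show ?case using add1[of 0 0 z] by simp
  qed (simp add: add1)
  have g_tensor: "g (tensor \<iota> scale es x z) = \<beta> x z" for x z
  proof -
    have "g (tensor \<iota> scale es x z) = \<beta> (\<Sum>i<length es. scale (coord scale es x i) (es ! i)) z"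
      by (simp add: sum1 g_def tensor_def scale1 scale2)
    then show ?thesis using expand[of x] by simp
  qed
  have uniq: "h v = g v"
    if add: "\<And>u v. u \<in> cx_carrier es \<Longrightarrow> v \<in> cx_carrier es \<Longrightarrow> h (u + v) = h u + h v"
      and ten: "\<And>x z. h (tensor \<iota> scale es x z) = \<beta> x z"
      and v: "v \<in> cx_carrier es" for h v
  proof -
    let ?t = "\<lambda>i. tensor \<iota> scale es (es ! i) (v $ i)"
    have C: "?t \<in> S \<rightarrow> carrier_vec (length es)" for S by (auto simp: tensor_def)
    have "h (finsum_vec TYPE(complex) (length es) ?t S) = (\<Sum>i\<in>S. \<beta> (es ! i) (v $ i))"
      if "finite S" for S
      using that
    proof (induction S rule: finite_induct)
      case empty
      have "0\<^sub>v (length es) \<in> cx_carrier es" by (simp add: cx_carrier_def)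
      from add[OF this this] show ?case by (simp add: finsum_vec_empty)
    next
      case (insert i S)
      have "finsum_vec TYPE(complex) (length es) ?t (insert i S)
          = ?t i + finsum_vec TYPE(complex) (length es) ?t S"
        using insert by (intro finsum_vec_insert C) (auto simp: tensor_def)
      moreover have "finsum_vec TYPE(complex) (length es) ?t S \<in> cx_carrier es"
        using finsum_vec_closed[OF C] by (simp add: cx_carrier_def)
      ultimately show ?case
        using insert by (simp add: add ten tensor_bilinear(1))
    qed
    from this[of "{..<length es}"] show ?thesis
      using vec_expand[OF v] by (simp add: g_def)
  qed
  show ?thesis
    by (intro exI[of _ g] conjI allI impI ballI g_tensor uniq)
      (auto simp: g_def cx_carrier_def add2 scale2 sum.distrib W.scale_sum_right)
qed

end

end

theory Submission
  imports Defs "HOL-Library.Function_Algebras" "HOL-Analysis.Continuum_Not_Denumerable"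
begin

text \<open>
  In coordinates the idempotents of the complexification are the zero set \<open>S\<close> of
  \<open>F x = x x - x\<close>, and \<open>\<chi>\<^sub>c(1/2)\<close> is up to the factor \<open>2 ^ n\<close> the Jacobian \<open>J c = det (2 L\<^sub>c - 1)\<close> of
  \<open>F\<close>. The leading form of \<open>det (L\<^sub>x - t)\<close> in \<open>x\<close> does not depend on \<open>t\<close>, so the claim amounts to the
  Euler--Jacobi formula: the sum of \<open>g c / J c\<close> over \<open>S\<close> vanishes for every polynomial \<open>g\<close> of degree
  less than \<open>n\<close>.

  By commutativity \<open>F x - F y = (L\<^bsub>x + y\<^esub> - 1) (x - y)\<close>, so the Bezoutian \<open>det (L\<^bsub>x + y\<^esub> - 1)\<close>, of degree
  \<open>n\<close> in \<open>(x, y)\<close>, restricts on \<open>S \<times> S\<close> to the diagonal matrix with entries \<open>J c\<close>. If \<open>v k\<close> is the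
  dimension of the space of restrictions to \<open>S\<close> of polynomials of degree at most \<open>k\<close>, this yields
  \<open>v k + v (n - 1 - k) \<ge> 2 ^ n\<close>. As the components of \<open>F\<close> are local coordinates at every point of \<open>S\<close>,
  counting the products of monomials in them with a basis of the functions on \<open>S\<close> adapted to the
  degree bounds the sum of all \<open>v k\<close> from above, so that all these inequalities are equalities and
  \<open>v (n - 1) = 2 ^ n - 1\<close>; the Bezoutian then identifies the functional that vanishes on polynomials
  of degree below \<open>n\<close>. That every zero is nondegenerate follows from a similar count, in which a
  degenerate zero would contribute twice; the finiteness of \<open>S\<close> enters there through the
  Nullstellensatz.
\<close>

section \<open>Polynomial functions\<close>

text \<open>As a \<open>vector_space\<close>, functions on any domain get spans and independence,
  both for polynomials and for functions on a finite set.\<close>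

definition cscale :: "complex \<Rightarrow> ('p \<Rightarrow> complex) \<Rightarrow> 'p \<Rightarrow> complex" where
  "cscale a f = (\<lambda>x. a * f x)"

lemma cscale_apply [simp]: "cscale a f x = a * f x"
  by (simp add: cscale_def)

interpretation fvs: vector_space cscale
  by unfold_locales (auto simp: fun_eq_iff algebra_simps)

lemma sum_fun_apply: "(\<Sum>a\<in>A. f a) x = (\<Sum>a\<in>A. f a (x :: 'p) :: complex)"
  by (induction A rule: infinite_finite_induct) auto

text \<open>Independence of a family includes injectivity: equal members would satisfy a relation
  with coefficients 1 and -1. Relations between functions thus become dimension bounds.\<close>

lemma card_le_if_independent_family:
  fixes u :: "'i \<Rightarrow> 'p \<Rightarrow> complex"
  assumes A: "finite A" and G: "finite G"
    and span: "\<And>a. a \<in> A \<Longrightarrow> u a \<in> fvs.span G"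
    and indep: "\<And>co. (\<And>x. (\<Sum>a\<in>A. co a * u a x) = 0) \<Longrightarrow> \<forall>a\<in>A. co a = 0"
  shows "card A \<le> card G"
proof -
  have inj: "inj_on u A"
  proof (rule inj_onI, rule ccontr)
    fix a b assume ab: "a \<in> A" "b \<in> A" "u a = u b" "a \<noteq> b"
    define co where "co i = (if i = a then 1 else if i = b then - 1 else 0 :: complex)" for i
    have "(\<Sum>i\<in>A. co i * u i x) = 0" for x
    proof -
      have "(\<Sum>i\<in>A. co i * u i x) = (\<Sum>i\<in>{a, b}. co i * u i x)"
        using ab A by (intro sum.mono_neutral_right) (auto simp: co_def)
      also have "\<dots> = 0" using ab by (simp add: co_def)
      finally show ?thesis .
    qed
    from indep[OF this] ab show False by (auto simp: co_def)
  qed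
  have "fvs.independent (u ` A)"
  proof (rule fvs.independent_if_scalars_zero)
    fix f y assume 0: "(\<Sum>x\<in>u ` A. cscale (f x) x) = 0" and y: "y \<in> u ` A"
    have "(\<Sum>a\<in>A. f (u a) * u a x) = 0" for x
    proof -
      have "(\<Sum>a\<in>A. f (u a) * u a x) = (\<Sum>g\<in>u ` A. cscale (f g) g) x"
        by (simp add: sum.reindex[OF inj] sum_fun_apply)
      then show ?thesis using 0 by simp
    qed
    from indep[of "\<lambda>a. f (u a)", OF this] y show "f y = 0" by auto
  qed (use A in auto)
  moreover have "u ` A \<subseteq> fvs.span G" using span by auto
  ultimately have "card (u ` A) \<le> card G"
    using fvs.independent_span_bound[OF G] by blast
  then show ?thesis using card_image[OF inj] by simp
qed

section \<open>Monomials and the degree filtration\<close>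

definition mpow :: "nat list \<Rightarrow> (nat \<Rightarrow> complex) \<Rightarrow> complex" where
  "mpow \<alpha> x = (\<Prod>i<length \<alpha>. x i ^ (\<alpha> ! i))"

definition multi_indices :: "nat \<Rightarrow> nat \<Rightarrow> nat list set" where
  "multi_indices n D = {\<alpha>. length \<alpha> = n \<and> sum_list \<alpha> \<le> D}"

text \<open>Polynomials are functions on sequences that depend on the first \<open>n\<close> entries
  only, so that the number of variables can change within one type.\<close>

definition polys :: "nat \<Rightarrow> nat \<Rightarrow> ((nat \<Rightarrow> complex) \<Rightarrow> complex) set" where
  "polys n D = fvs.span (mpow ` multi_indices n D)"

lemma mpow_Nil [simp]: "mpow [] x = 1"
  by (simp add: mpow_def)

lemma mpow_Cons: "mpow (a # \<alpha>) x = x 0 ^ a * mpow \<alpha> (\<lambda>i. x (Suc i))"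
  by (simp add: mpow_def prod.lessThan_Suc_shift del: prod.lessThan_Suc)

lemma mpow_append: "mpow (\<alpha> @ \<beta>) x = mpow \<alpha> x * mpow \<beta> (\<lambda>i. x (length \<alpha> + i))"
  by (induction \<alpha> arbitrary: x) (auto simp: mpow_Cons)

lemma mpow_mult:
  "length \<alpha> = length \<beta> \<Longrightarrow> mpow \<alpha> x * mpow \<beta> x = mpow (map2 (+) \<alpha> \<beta>) x"
  by (simp add: mpow_def power_add flip: prod.distrib)

lemma sum_list_map2_add:
  "length \<alpha> = length \<beta> \<Longrightarrow> sum_list (map2 (+) \<alpha> \<beta>) = sum_list \<alpha> + sum_list (\<beta> :: nat list)"
  by (induction \<alpha> \<beta> rule: list_induct2) auto

text \<open>Grouping by the exponent of the first variable turns a relation into a univariate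
  polynomial that vanishes identically; its coefficients are relations in the remaining
  variables.\<close>

lemma mpow_independent:
  assumes "finite A" "\<And>\<alpha>. \<alpha> \<in> A \<Longrightarrow> length \<alpha> = n"
    and "\<And>x. (\<Sum>\<alpha>\<in>A. c \<alpha> * mpow \<alpha> x) = 0"
  shows "\<forall>\<alpha>\<in>A. c \<alpha> = 0"
  using assms
proof (induction n arbitrary: A c)
  case 0
  then have "A \<subseteq> {[]}" by auto
  then consider "A = {}" | "A = {[]}" by blast
  then show ?case using 0(3) by cases auto
next
  case (Suc n)
  define T where "T a = {\<alpha>. a # \<alpha> \<in> A}" for a
  have T: "finite (T a)" for a
    unfolding T_def using Suc.prems(1) by (intro finite_vimageI[of A "(#) a", unfolded vimage_def]) auto
  \<comment> \<open>\<open>M\<close> bounds the exponents of the first variable; inserting 0 covers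
    an empty \<open>A\<close>.\<close>
  define M where "M = Max (insert 0 (hd ` A))"
  have hd: "hd \<alpha> \<le> M" if "\<alpha> \<in> A" for \<alpha> unfolding M_def using that Suc.prems(1) by auto
  have Asig: "A = (\<lambda>(a, \<alpha>). a # \<alpha>) ` Sigma {..M} T"
  proof (intro equalityI subsetI)
    fix \<alpha> assume \<alpha>: "\<alpha> \<in> A"
    then obtain a \<beta> where "\<alpha> = a # \<beta>" using Suc.prems(2)[OF \<alpha>] by (cases \<alpha>) auto
    then show "\<alpha> \<in> (\<lambda>(a, \<alpha>). a # \<alpha>) ` Sigma {..M} T"
      using \<alpha> hd[OF \<alpha>] by (auto simp: T_def intro!: image_eqI[of _ _ "(a, \<beta>)"])
  qed (auto simp: T_def)
  have "(\<Sum>\<alpha>\<in>T a. c (a # \<alpha>) * mpow \<alpha> x) = 0" for a x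
  proof -
    have "(\<Sum>a\<le>M. (\<Sum>\<alpha>\<in>T a. c (a # \<alpha>) * mpow \<alpha> x) * z ^ a) = 0" for z
    proof -
      have "0 = (\<Sum>\<alpha>\<in>A. c \<alpha> * mpow \<alpha> (case_nat z x))" using Suc.prems(3) by simp
      also have "\<dots> = (\<Sum>(a, \<alpha>)\<in>Sigma {..M} T. c (a # \<alpha>) * mpow (a # \<alpha>) (case_nat z x))"
        unfolding Asig by (subst sum.reindex) (auto simp: inj_on_def intro!: sum.cong)
      also have "\<dots> = (\<Sum>a\<le>M. \<Sum>\<alpha>\<in>T a. c (a # \<alpha>) * mpow (a # \<alpha>) (case_nat z x))"
        using T by (subst sum.Sigma) auto
      also have "\<dots> = (\<Sum>a\<le>M. (\<Sum>\<alpha>\<in>T a. c (a # \<alpha>) * mpow \<alpha> x) * z ^ a)"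
        by (auto simp: mpow_Cons sum_distrib_left sum_distrib_right mult_ac intro!: sum.cong)
      finally show ?thesis by simp
    qed
    then have "\<forall>a\<le>M. (\<Sum>\<alpha>\<in>T a. c (a # \<alpha>) * mpow \<alpha> x) = 0"
      using polyfun_eq_0[of "\<lambda>a. \<Sum>\<alpha>\<in>T a. c (a # \<alpha>) * mpow \<alpha> x" M] by simp
    moreover have "T a = {}" if "a > M" using that hd by (force simp: T_def)
    ultimately show ?thesis by (cases "a \<le> M") auto
  qed
  then have *: "\<forall>\<alpha>\<in>T a. c (a # \<alpha>) = 0" for a
    using Suc.prems(2) by (intro Suc.IH[of "T a" "\<lambda>\<alpha>. c (a # \<alpha>)"] T) (force simp: T_def)+
  show ?case
  proof
    fix \<alpha> assume \<alpha>: "\<alpha> \<in> A"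
    then obtain a \<beta> where "\<alpha> = a # \<beta>" using Suc.prems(2)[OF \<alpha>] by (cases \<alpha>) auto
    then show "c \<alpha> = 0" using * \<alpha> by (auto simp: T_def)
  qed
qed

lemma finite_multi_indices [simp]: "finite (multi_indices n D)"
proof (rule finite_subset)
  show "multi_indices n D \<subseteq> {\<alpha>. set \<alpha> \<subseteq> {..D} \<and> length \<alpha> = n}"
    using member_le_sum_list by (fastforce simp: multi_indices_def)
qed (auto intro: finite_lists_length_eq)

text \<open>The slack \<open>D - sum_list \<alpha>\<close>, prepended as a new entry, turns lists of
  sum at most \<open>D\<close> into lists of \<open>n + 1\<close> entries with sum exactly
  \<open>D\<close>.\<close>

lemma card_multi_indices: "card (multi_indices n D) = (D + n) choose n"
proof -
  have "bij_betw tl {\<alpha>::nat list. length \<alpha> = Suc n \<and> sum_list \<alpha> = D} (multi_indices n D)"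
    by (rule bij_betwI[of _ _ _ "\<lambda>\<alpha>. (D - sum_list \<alpha>) # \<alpha>"])
      (auto simp: multi_indices_def length_Suc_conv)
  then have "card (multi_indices n D) = card {\<alpha>::nat list. length \<alpha> = Suc n \<and> sum_list \<alpha> = D}"
    using bij_betw_same_card by metis
  also have "\<dots> = (D + n) choose D" by (subst card_length_sum_list) simp
  also have "\<dots> = (D + n) choose n" by (subst binomial_symmetric) auto
  finally show ?thesis .
qed

lemma polys_iff: "f \<in> polys n D \<longleftrightarrow> (\<exists>a. \<forall>x. f x = (\<Sum>\<alpha>\<in>multi_indices n D. a \<alpha> * mpow \<alpha> x))"
proof
  assume "f \<in> polys n D"
  then show "\<exists>a. \<forall>x. f x = (\<Sum>\<alpha>\<in>multi_indices n D. a \<alpha> * mpow \<alpha> x)"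
    unfolding polys_def
  proof (induction rule: fvs.span_induct_alt)
    case base
    show ?case by (rule exI[of _ "\<lambda>_. 0"]) simp
  next
    case (step c g f)
    then obtain a \<beta> where a: "\<And>x. f x = (\<Sum>\<alpha>\<in>multi_indices n D. a \<alpha> * mpow \<alpha> x)"
      and \<beta>: "\<beta> \<in> multi_indices n D" "g = mpow \<beta>" by blast
    have "(cscale c g + f) x
        = (\<Sum>\<alpha>\<in>multi_indices n D. (a \<alpha> + (if \<alpha> = \<beta> then c else 0)) * mpow \<alpha> x)" for x
      using \<beta> by (simp add: a ring_distribs sum.distrib if_distrib[of "\<lambda>t. t * _"] cong: if_cong)
    then show ?case by (intro exI[of _ "\<lambda>\<alpha>. a \<alpha> + (if \<alpha> = \<beta> then c else 0)"]) blast
  qed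
next
  assume "\<exists>a. \<forall>x. f x = (\<Sum>\<alpha>\<in>multi_indices n D. a \<alpha> * mpow \<alpha> x)"
  then obtain a where "\<And>x. f x = (\<Sum>\<alpha>\<in>multi_indices n D. a \<alpha> * mpow \<alpha> x)" by blast
  then have f: "f = (\<Sum>\<alpha>\<in>multi_indices n D. cscale (a \<alpha>) (mpow \<alpha>))"
    by (auto simp: fun_eq_iff sum_fun_apply)
  then show "f \<in> polys n D"
    unfolding polys_def f by (intro fvs.span_sum fvs.span_scale fvs.span_base) auto
qed

lemma polys_mono: "D \<le> E \<Longrightarrow> polys n D \<subseteq> polys n E"
  unfolding polys_def by (intro fvs.span_mono) (auto simp: multi_indices_def)

lemma polysD_mono: "f \<in> polys n D \<Longrightarrow> D \<le> E \<Longrightarrow> f \<in> polys n E"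
  using polys_mono by blast

lemma mpow_in_polys: "length \<alpha> = n \<Longrightarrow> sum_list \<alpha> \<le> D \<Longrightarrow> mpow \<alpha> \<in> polys n D"
  unfolding polys_def by (rule fvs.span_base) (auto simp: multi_indices_def)

lemma polys_const: "(\<lambda>x. a) \<in> polys n D"
proof -
  have "cscale a (mpow (replicate n 0)) \<in> polys n D"
    using mpow_in_polys[of "replicate n 0" n D] unfolding polys_def by (intro fvs.span_scale) (auto simp: sum_list_replicate)
  also have "cscale a (mpow (replicate n 0)) = (\<lambda>x. a)" by (auto simp: fun_eq_iff mpow_def)
  finally show ?thesis .
qed

lemma polys_add: "f \<in> polys n D \<Longrightarrow> g \<in> polys n D \<Longrightarrow> (\<lambda>x. f x + g x) \<in> polys n D"
  using fvs.span_add unfolding polys_def plus_fun_def by blast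

lemma polys_scale: "f \<in> polys n D \<Longrightarrow> (\<lambda>x. a * f x) \<in> polys n D"
  using fvs.span_scale unfolding polys_def cscale_def by blast

lemma polys_diff: "f \<in> polys n D \<Longrightarrow> g \<in> polys n D \<Longrightarrow> (\<lambda>x. f x - g x) \<in> polys n D"
  using polys_add[of f n D "\<lambda>x. (- 1) * g x"] polys_scale[of g n D "- 1"] by simp

lemma polys_sum:
  "(\<And>i. i \<in> I \<Longrightarrow> f i \<in> polys n D) \<Longrightarrow> (\<lambda>x. \<Sum>i\<in>I. f i x) \<in> polys n D"
  by (induction I rule: infinite_finite_induct) (auto intro: polys_add polys_const)

lemma polys_var: "i < n \<Longrightarrow> 1 \<le> D \<Longrightarrow> (\<lambda>x. x i) \<in> polys n D"
proof -
  assume i: "i < n" "1 \<le> D"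
  define \<alpha> where "\<alpha> = (replicate n (0::nat))[i := 1]"
  have "mpow \<alpha> x = x i" for x
  proof -
    have "mpow \<alpha> x = (\<Prod>j<n. if j = i then x i else 1)"
      unfolding mpow_def \<alpha>_def using i by (intro prod.cong) (auto simp: nth_list_update)
    then show ?thesis using i by simp
  qed
  moreover have "sum_list \<alpha> = 1" unfolding \<alpha>_def using i by (simp add: sum_list_update)
  moreover have "mpow \<alpha> = (\<lambda>x. x i)" using calculation(1) by auto
  ultimately show ?thesis using mpow_in_polys[of \<alpha> n D] i by (auto simp: \<alpha>_def)
qed

lemma polys_mult:
  assumes "f \<in> polys n D" "g \<in> polys n E"
  shows "(\<lambda>x. f x * g x) \<in> polys n (D + E)"
proof -
  obtain a where a: "\<And>x. f x = (\<Sum>\<alpha>\<in>multi_indices n D. a \<alpha> * mpow \<alpha> x)"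
    using assms(1) polys_iff by blast
  obtain b where b: "\<And>x. g x = (\<Sum>\<alpha>\<in>multi_indices n E. b \<alpha> * mpow \<alpha> x)"
    using assms(2) polys_iff by blast
  have "(\<lambda>x. \<Sum>\<alpha>\<in>multi_indices n D. \<Sum>\<beta>\<in>multi_indices n E.
      (a \<alpha> * b \<beta>) * mpow (map2 (+) \<alpha> \<beta>) x) \<in> polys n (D + E)"
    by (intro polys_sum polys_scale mpow_in_polys)
      (auto simp: multi_indices_def sum_list_map2_add intro: add_mono)
  also have "(\<lambda>x. \<Sum>\<alpha>\<in>multi_indices n D. \<Sum>\<beta>\<in>multi_indices n E.
      (a \<alpha> * b \<beta>) * mpow (map2 (+) \<alpha> \<beta>) x) = (\<lambda>x. f x * g x)"
    unfolding a b sum_product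
    by (intro ext sum.cong refl)
      (auto simp: multi_indices_def mult_ac simp flip: mpow_mult)
  finally show ?thesis .
qed

lemma polys_prod:
  "(\<And>i. i \<in> I \<Longrightarrow> f i \<in> polys n (d i)) \<Longrightarrow> (\<lambda>x. \<Prod>i\<in>I. f i x) \<in> polys n (\<Sum>i\<in>I. d i)"
  by (induction I rule: infinite_finite_induct) (auto intro: polys_mult polys_const)

lemma polys_power: "f \<in> polys n D \<Longrightarrow> (\<lambda>x. f x ^ k) \<in> polys n (k * D)"
  by (induction k) (auto intro: polys_mult polys_const)

definition all_polys :: "nat \<Rightarrow> ((nat \<Rightarrow> complex) \<Rightarrow> complex) set" where
  "all_polys n = (\<Union>D. polys n D)"

section \<open>Hilbert's Nullstellensatz for finite zero sets\<close>

lemma all_polysI: "f \<in> polys n D \<Longrightarrow> f \<in> all_polys n"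
  by (auto simp: all_polys_def)

lemma all_polys_const: "(\<lambda>x. a) \<in> all_polys n"
  by (rule all_polysI[OF polys_const])

lemma all_polys_var: "i < n \<Longrightarrow> (\<lambda>x. x i) \<in> all_polys n"
  by (rule all_polysI[OF polys_var[of _ _ 1]]) auto

lemma all_polys_mult: "f \<in> all_polys n \<Longrightarrow> g \<in> all_polys n \<Longrightarrow> f * g \<in> all_polys n"
proof -
  assume "f \<in> all_polys n" "g \<in> all_polys n"
  then obtain D E where "f \<in> polys n D" "g \<in> polys n E" by (auto simp: all_polys_def)
  then show ?thesis unfolding times_fun_def using all_polysI polys_mult by blast
qed

lemma all_polys_add: "f \<in> all_polys n \<Longrightarrow> g \<in> all_polys n \<Longrightarrow> f + g \<in> all_polys n"
proof -
  assume "f \<in> all_polys n" "g \<in> all_polys n"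
  then obtain D E where "f \<in> polys n D" "g \<in> polys n E" by (auto simp: all_polys_def)
  then have "f \<in> polys n (max D E)" "g \<in> polys n (max D E)"
    by (auto elim: polysD_mono)
  then show ?thesis unfolding plus_fun_def by (intro all_polysI[of _ _ "max D E"] polys_add)
qed

lemma all_polys_uminus: "f \<in> all_polys n \<Longrightarrow> - f \<in> all_polys n"
  using all_polys_mult[OF all_polys_const[of "- 1"], of f] by (simp add: times_fun_def fun_Compl_def)

lemma all_polys_diff: "f \<in> all_polys n \<Longrightarrow> g \<in> all_polys n \<Longrightarrow> f - g \<in> all_polys n"
  using all_polys_add[of f n "- g"] all_polys_uminus by simp

lemma all_polys_sum: "(\<And>i. i \<in> I \<Longrightarrow> f i \<in> all_polys n) \<Longrightarrow> (\<Sum>i\<in>I. f i) \<in> all_polys n"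
  by (induction I rule: infinite_finite_induct)
    (auto intro: all_polys_add all_polys_const simp: zero_fun_def)

lemma all_polys_prod: "(\<And>i. i \<in> I \<Longrightarrow> f i \<in> all_polys n) \<Longrightarrow> (\<Prod>i\<in>I. f i) \<in> all_polys n"
  by (induction I rule: infinite_finite_induct)
    (auto intro: all_polys_mult all_polys_const simp: one_fun_def)

lemma all_polys_power: "f \<in> all_polys n \<Longrightarrow> f ^ k \<in> all_polys n"
  by (induction k) (auto intro: all_polys_mult all_polys_const simp: one_fun_def)

lemma prod_fun_apply: "(\<Prod>a\<in>A. f a) x = (\<Prod>a\<in>A. f a (x :: 'p) :: complex)"
  by (induction A rule: infinite_finite_induct) auto

lemma power_fun_apply: "(f ^ k) x = (f x :: complex) ^ k"
  by (induction k) auto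

lemma all_polys_univariate:
  assumes "j < n" shows "(\<lambda>x. poly g (x j)) \<in> all_polys n"
proof -
  have "(\<lambda>x. poly g (x j)) = (\<Sum>i\<le>degree g. (\<lambda>x. coeff g i) * (\<lambda>x. x j) ^ i)"
    by (auto simp: fun_eq_iff poly_altdef sum_fun_apply power_fun_apply)
  also have "\<dots> \<in> all_polys n"
    by (intro all_polys_sum all_polys_mult all_polys_const all_polys_power all_polys_var assms)
  finally show ?thesis .
qed

lemma all_polys_induct [consumes 1, case_names const var add mult]:
  assumes f: "f \<in> all_polys n"
    and const: "\<And>a. P (\<lambda>x. a)"
    and var: "\<And>i. i < n \<Longrightarrow> P (\<lambda>x. x i)"
    and add: "\<And>f g. P f \<Longrightarrow> P g \<Longrightarrow> P (f + g)"
    and mult: "\<And>f g. P f \<Longrightarrow> P g \<Longrightarrow> P (f * g)"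
  shows "P f"
proof -
  have 0: "P 0" and 1: "P 1" using const by (auto simp: zero_fun_def one_fun_def)
  have sum: "P (\<Sum>i\<in>I. h i)" if "\<And>i. i \<in> I \<Longrightarrow> P (h i)" for I :: "'i set" and h
    using that by (induction I rule: infinite_finite_induct) (auto intro: add 0)
  have prod: "P (\<Prod>i\<in>I. h i)" if "\<And>i. i \<in> I \<Longrightarrow> P (h i)" for I :: "'i set" and h
    using that by (induction I rule: infinite_finite_induct) (auto intro: mult 1)
  have pow: "P (h ^ k)" if "P h" for h k
    using that by (induction k) (auto intro: mult 1)
  obtain D a where "\<And>x. f x = (\<Sum>\<alpha>\<in>multi_indices n D. a \<alpha> * mpow \<alpha> x)"
    using f by (auto simp: all_polys_def polys_iff)
  then have "f = (\<Sum>\<alpha>\<in>multi_indices n D. (\<lambda>x. a \<alpha>) * (\<Prod>i<n. (\<lambda>x. x i) ^ (\<alpha> ! i)))"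
    by (auto simp: fun_eq_iff sum_fun_apply prod_fun_apply power_fun_apply mpow_def
        multi_indices_def intro!: sum.cong)
  moreover have "P (\<Sum>\<alpha>\<in>multi_indices n D. (\<lambda>x. a \<alpha>) * (\<Prod>i<n. (\<lambda>x. x i) ^ (\<alpha> ! i)))"
    by (intro sum mult const prod pow var) auto
  ultimately show ?thesis by simp
qed

section \<open>Ideals of polynomial functions\<close>

definition poly_ideal :: "nat \<Rightarrow> ((nat \<Rightarrow> complex) \<Rightarrow> complex) set \<Rightarrow> bool" where
  "poly_ideal n I \<longleftrightarrow> I \<subseteq> all_polys n \<and> 0 \<in> I \<and> (\<forall>f\<in>I. \<forall>g\<in>I. f + g \<in> I)
     \<and> (\<forall>h\<in>all_polys n. \<forall>f\<in>I. h * f \<in> I)"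

lemma poly_idealD:
  assumes "poly_ideal n I"
  shows "I \<subseteq> all_polys n" "0 \<in> I" "f \<in> I \<Longrightarrow> g \<in> I \<Longrightarrow> f + g \<in> I"
    "h \<in> all_polys n \<Longrightarrow> f \<in> I \<Longrightarrow> h * f \<in> I"
  using assms by (auto simp: poly_ideal_def)

lemma poly_ideal_uminus: "poly_ideal n I \<Longrightarrow> f \<in> I \<Longrightarrow> - f \<in> I"
  using poly_idealD(4)[of n I "- 1" f] all_polys_uminus[OF all_polys_const[of 1 n]]
  by (simp add: one_fun_def fun_Compl_def times_fun_def)

lemma poly_ideal_diff: "poly_ideal n I \<Longrightarrow> f \<in> I \<Longrightarrow> g \<in> I \<Longrightarrow> f - g \<in> I"
  using poly_idealD(3)[of n I f "- g"] poly_ideal_uminus by simp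

lemma poly_ideal_sum: "poly_ideal n I \<Longrightarrow> (\<And>i. i \<in> A \<Longrightarrow> f i \<in> I) \<Longrightarrow> (\<Sum>i\<in>A. f i) \<in> I"
  by (induction A rule: infinite_finite_induct) (auto intro: poly_idealD)

lemma poly_ideal_one_of_const:
  assumes I: "poly_ideal n I" and a: "(\<lambda>x. a) \<in> I" "a \<noteq> 0"
  shows "1 \<in> I"
  using poly_idealD(4)[OF I all_polys_const[of "1 / a"] a(1)] a(2)
  by (simp add: times_fun_def one_fun_def)

definition adjoin :: "nat \<Rightarrow> ((nat \<Rightarrow> complex) \<Rightarrow> complex) set \<Rightarrow> ((nat \<Rightarrow> complex) \<Rightarrow> complex)
    \<Rightarrow> ((nat \<Rightarrow> complex) \<Rightarrow> complex) set" where
  "adjoin n I p = {f + h * p | f h. f \<in> I \<and> h \<in> all_polys n}"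

lemma poly_ideal_adjoin:
  assumes I: "poly_ideal n I" and p: "p \<in> all_polys n"
  shows "poly_ideal n (adjoin n I p)" "I \<subseteq> adjoin n I p" "p \<in> adjoin n I p"
proof -
  note D = poly_idealD[OF I]
  have z: "0 \<in> all_polys n" and o: "1 \<in> all_polys n"
    using all_polys_const[of 0] all_polys_const[of 1] by (auto simp: zero_fun_def one_fun_def)
  show sub: "I \<subseteq> adjoin n I p"
  proof
    fix f assume "f \<in> I"
    then show "f \<in> adjoin n I p" unfolding adjoin_def using z
      by (intro CollectI exI[of _ f] exI[of _ 0]) auto
  qed
  show "p \<in> adjoin n I p" unfolding adjoin_def using o D(2)
    by (intro CollectI exI[of _ 0] exI[of _ 1]) auto
  have "f + g \<in> adjoin n I p" if fg: "f \<in> adjoin n I p" "g \<in> adjoin n I p" for f g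
  proof -
    obtain f1 h1 f2 h2 where *: "f = f1 + h1 * p" "g = f2 + h2 * p" "f1 \<in> I" "f2 \<in> I"
      "h1 \<in> all_polys n" "h2 \<in> all_polys n" using fg unfolding adjoin_def by blast
    then show ?thesis unfolding adjoin_def
      by (intro CollectI exI[of _ "f1 + f2"] exI[of _ "h1 + h2"])
        (auto intro: D all_polys_add simp: algebra_simps)
  qed
  moreover have "h * f \<in> adjoin n I p" if hf: "h \<in> all_polys n" "f \<in> adjoin n I p" for h f
  proof -
    obtain f1 h1 where *: "f = f1 + h1 * p" "f1 \<in> I" "h1 \<in> all_polys n"
      using hf unfolding adjoin_def by blast
    then have "h * f = h * f1 + (h * h1) * p" by (simp add: algebra_simps)
    moreover have "h * f1 \<in> I" "h * h1 \<in> all_polys n"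
      using * hf(1) D(4) all_polys_mult by auto
    ultimately show ?thesis unfolding adjoin_def by blast
  qed
  moreover have "adjoin n I p \<subseteq> all_polys n"
    unfolding adjoin_def using D(1) p by (auto intro!: all_polys_add all_polys_mult)
  ultimately show "poly_ideal n (adjoin n I p)"
    using sub D(2) unfolding poly_ideal_def by blast
qed

text \<open>
  The polynomials of degree at most \<open>D\<close> form a finite-dimensional space while \<open>\<complex>\<close> is
  uncountable, so the inverses of infinitely many \<open>x\<^sub>j - \<lambda>\<close> modulo \<open>I\<close> are linearly dependent.
\<close>

lemma univariate_in_ideal_if_inverses:
  assumes I: "poly_ideal n I" and j: "j < n" and \<Lambda>: "countable \<Lambda>"
    and inv: "\<And>l. l \<notin> \<Lambda> \<Longrightarrow> \<exists>h\<in>all_polys n. h * (\<lambda>x. x j - l) - 1 \<in> I"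
  shows "\<exists>g. g \<noteq> 0 \<and> (\<lambda>x. poly g (x j)) \<in> I"
proof -
  obtain h where h: "\<And>l. l \<notin> \<Lambda> \<Longrightarrow> h l \<in> all_polys n"
    and hI: "\<And>l. l \<notin> \<Lambda> \<Longrightarrow> h l * (\<lambda>x. x j - l) - 1 \<in> I"
    using inv by metis
  \<comment> \<open>Uncountably many scalars outside \<open>\<Lambda>\<close> fall into the
    countably many \<open>T D\<close>, so one of these is infinite.\<close>
  define T where "T D = {l. l \<notin> \<Lambda> \<and> h l \<in> polys n D}" for D
  have "\<exists>D. infinite (T D)"
  proof (rule ccontr)
    assume "\<nexists>D. infinite (T D)"
    then have "countable (\<Union>D. T D)" by (auto intro: countable_finite)
    moreover have "(\<Union>D. T D) = - \<Lambda>" using h by (auto simp: T_def all_polys_def)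
    ultimately have "countable (UNIV :: complex set)"
      using \<Lambda> by (metis Compl_partition countable_Un)
    then show False using uncountable_UNIV_complex by blast
  qed
  then obtain D where "infinite (T D)" by blast
  then obtain L where L: "finite L" "card L = Suc (card (multi_indices n D))" "L \<subseteq> T D"
    by (meson infinite_arbitrarily_large)
  have "\<exists>b. (\<forall>x. (\<Sum>l\<in>L. b l * h l x) = 0) \<and> (\<exists>l\<in>L. b l \<noteq> 0)"
  proof (rule ccontr)
    assume "\<not> ?thesis"
    then have "card L \<le> card (mpow ` multi_indices n D)"
      using L(1,3) by (intro card_le_if_independent_family[where u = h])
        (auto simp: T_def polys_def)
    also have "\<dots> \<le> card (multi_indices n D)" by (rule card_image_le) simp
    finally show False using L by simp
  qed
  then obtain b l0 where b: "\<And>x. (\<Sum>l\<in>L. b l * h l x) = 0" and l0: "l0 \<in> L" "b l0 \<noteq> 0"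
    by blast
  \<comment> \<open>Multiplying the relation between the \<open>h l\<close> by the product of all
    \<open>x j - m\<close> and replacing each \<open>h l * (x j - l)\<close> by 1 leaves the sum of
    the \<open>b l * Q l\<close>, a polynomial in \<open>x j\<close> alone.\<close>
  define Q where "Q l = (\<Prod>m\<in>L - {l}. [:- m, 1:])" for l
  define g where "g = (\<Sum>l\<in>L. Polynomial.smult (b l) (Q l))"
  have Q: "poly (Q l) a = (\<Prod>m\<in>L - {l}. a - m)" for l a
    by (simp add: Q_def poly_prod)
  \<comment> \<open>Every \<open>Q l\<close> with \<open>l \<noteq> l0\<close> has the root
    \<open>l0\<close>, so only one summand survives and \<open>g\<close> is nonzero.\<close>
  have "poly g l0 = (\<Sum>l\<in>{l0}. b l * poly (Q l) l0)"
    unfolding g_def poly_sum poly_smult using L(1) l0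
    by (intro sum.mono_neutral_right) (auto simp: Q)
  then have "poly g l0 \<noteq> 0" using l0 L(1) by (simp add: Q)
  then have "g \<noteq> 0" by auto
  moreover have "(\<lambda>x. poly g (x j)) \<in> I"
  proof -
    have "(\<Sum>l\<in>L. ((\<lambda>x. - b l) * (\<lambda>x. poly (Q l) (x j))) * (h l * (\<lambda>x. x j - l) - 1)) \<in> I"
      using L(3) by (intro poly_ideal_sum[OF I] poly_idealD(4)[OF I] hI all_polys_mult
          all_polys_const all_polys_univariate j) (auto simp: T_def)
    also have "(\<Sum>l\<in>L. ((\<lambda>x. - b l) * (\<lambda>x. poly (Q l) (x j))) * (h l * (\<lambda>x. x j - l) - 1))
        = (\<lambda>x. poly g (x j))"
    proof
      fix x :: "nat \<Rightarrow> complex"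
      have R: "poly (Q l) (x j) * (x j - l) = (\<Prod>m\<in>L. x j - m)" if "l \<in> L" for l
        using that L(1) by (simp add: Q prod.remove[of L l] mult.commute)
      have "(\<Sum>l\<in>L. ((\<lambda>x. - b l) * (\<lambda>x. poly (Q l) (x j))) * (h l * (\<lambda>x. x j - l) - 1)) x
          = (\<Sum>l\<in>L. b l * poly (Q l) (x j) - b l * h l x * (poly (Q l) (x j) * (x j - l)))"
        by (auto simp: sum_fun_apply algebra_simps intro!: sum.cong)
      also have "\<dots> = poly g (x j) - (\<Sum>l\<in>L. b l * h l x * (\<Prod>m\<in>L. x j - m))"
        by (simp add: sum_subtractf g_def poly_sum R)
      also have "(\<Sum>l\<in>L. b l * h l x * (\<Prod>m\<in>L. x j - m)) = 0"
        by (simp add: b flip: sum_distrib_right)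
      finally show "(\<Sum>l\<in>L. ((\<lambda>x. - b l) * (\<lambda>x. poly (Q l) (x j))) * (h l * (\<lambda>x. x j - l) - 1)) x
          = poly g (x j)" by (simp only: diff_zero)
    qed
    finally show ?thesis .
  qed
  ultimately show ?thesis by blast
qed

text \<open>The polynomial \<open>g\<close> splits over \<complex>, and each linear factor is
  invertible modulo \<open>I\<close>; cancelling the factors one by one leaves a nonzero constant in
  \<open>I\<close>.\<close>

lemma one_in_ideal_if_univariate:
  assumes I: "poly_ideal n I" and j: "j < n"
    and inv: "\<And>l. \<exists>h\<in>all_polys n. h * (\<lambda>x. x j - l) - 1 \<in> I"
    and g: "g \<noteq> 0" "(\<lambda>x. poly g (x j)) \<in> I"
  shows "1 \<in> I"
  using g
proof (induction "degree g" arbitrary: g)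
  case 0
  then obtain c where "g = [:c:]" "c \<noteq> 0" by (metis degree_eq_zeroE pCons_0_0)
  then have "(\<lambda>x. c) \<in> I" using 0 by simp
  then show ?case using poly_ideal_one_of_const[OF I] \<open>c \<noteq> 0\<close> by blast
next
  case (Suc d)
  have "\<not> constant (poly g)" using Suc.hyps(2) by (simp add: constant_degree)
  then obtain l where "poly g l = 0" using fundamental_theorem_of_algebra by blast
  then obtain q where q: "g = [:- l, 1:] * q" by (auto simp: poly_eq_0_iff_dvd elim: dvdE)
  then have q0: "q \<noteq> 0" using Suc.prems by auto
  then have deg: "degree q = d" using Suc.hyps(2) unfolding q by (subst (asm) degree_mult_eq) auto
  obtain h where h: "h \<in> all_polys n" "h * (\<lambda>x. x j - l) - 1 \<in> I" using inv by blast
  \<comment> \<open>With \<open>g = (x - l) * q\<close>, both terms contain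
    \<open>q * h * (x - l)\<close>, and their difference is \<open>q\<close>.\<close>
  have "h * (\<lambda>x. poly g (x j)) - (\<lambda>x. poly q (x j)) * (h * (\<lambda>x. x j - l) - 1) \<in> I"
    using poly_ideal_diff[OF I] poly_idealD(4)[OF I] h Suc.prems all_polys_univariate[OF j] by blast
  also have "h * (\<lambda>x. poly g (x j)) - (\<lambda>x. poly q (x j)) * (h * (\<lambda>x. x j - l) - 1)
      = (\<lambda>x. poly q (x j))"
    by (simp add: fun_eq_iff q algebra_simps)
  finally show ?case using Suc.hyps(1)[of q] deg q0 by simp
qed

text \<open>If all these ideals contained 1, every \<open>x j - l\<close> would be invertible modulo
  \<open>I\<close>; then \<open>I\<close> would contain a nonzero polynomial in \<open>x j\<close>
  and therefore 1.\<close>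

lemma adjoin_var_proper:
  assumes I: "poly_ideal n I" "1 \<notin> I" and j: "j < n"
  shows "\<exists>l. 1 \<notin> adjoin n I (\<lambda>x. x j - l)"
proof (rule ccontr)
  assume no: "\<nexists>l. 1 \<notin> adjoin n I (\<lambda>x. x j - l)"
  have inv: "\<exists>h\<in>all_polys n. h * (\<lambda>x. x j - l) - 1 \<in> I" for l
  proof -
    obtain f h where fh: "1 = f + h * (\<lambda>x. x j - l)" "f \<in> I" "h \<in> all_polys n"
      using no unfolding adjoin_def by blast
    then have "h * (\<lambda>x. x j - l) - 1 = - f" by (simp add: algebra_simps)
    then show ?thesis using fh poly_ideal_uminus[OF I(1)] by force
  qed
  obtain g where "g \<noteq> 0" "(\<lambda>x. poly g (x j)) \<in> I"
    using univariate_in_ideal_if_inverses[OF I(1) j, of "{}"] inv by auto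
  then show False using one_in_ideal_if_univariate[OF I(1) j inv] I(2) by blast
qed

text \<open>Adjoining \<open>x i - z i\<close> for one variable after another keeps the ideal
  proper. In the end every polynomial is congruent to its value at \<open>z\<close>, so an element
  of \<open>I\<close> with nonzero value would put a nonzero constant into a proper ideal.\<close>

theorem weak_nullstellensatz:
  assumes I: "poly_ideal n I" "1 \<notin> I"
  shows "\<exists>z. (\<forall>i\<ge>n. z i = 0) \<and> (\<forall>f\<in>I. f z = 0)"
proof -
  have "\<exists>M z. poly_ideal n M \<and> 1 \<notin> M \<and> I \<subseteq> M \<and> (\<forall>i<k. (\<lambda>x. x i - z i) \<in> M)" if "k \<le> n" for k
    using that
  proof (induction k)
    case 0
    show ?case using I by blast
  next
    case (Suc k)
    then obtain M z where M: "poly_ideal n M" "1 \<notin> M" "I \<subseteq> M" "\<forall>i<k. (\<lambda>x. x i - z i) \<in> M"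
      using Suc_leD by blast
    have k: "k < n" using Suc.prems by simp
    obtain l where l: "1 \<notin> adjoin n M (\<lambda>x. x k - l)"
      using adjoin_var_proper[OF M(1,2) k] by blast
    have p: "(\<lambda>x. x k - l) \<in> all_polys n"
      using all_polys_diff[OF all_polys_var[OF k] all_polys_const[of l]]
      by (simp add: fun_diff_def)
    note A = poly_ideal_adjoin[OF M(1) p]
    have "\<forall>i<Suc k. (\<lambda>x. x i - (z(k := l)) i) \<in> adjoin n M (\<lambda>x. x k - l)"
      using A(2,3) M(4) by (auto simp: less_Suc_eq)
    then show ?case using A(1,2) l M(3) by blast
  qed
  then obtain M z0 where M: "poly_ideal n M" "1 \<notin> M" "I \<subseteq> M" "\<forall>i<n. (\<lambda>x. x i - z0 i) \<in> M"
    by blast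
  define z where "z i = (if i < n then z0 i else 0)" for i
  note D = poly_idealD[OF M(1)]
  have "f - (\<lambda>x. f z) \<in> M \<and> f \<in> all_polys n" if "f \<in> all_polys n" for f
    using that
  proof (induction rule: all_polys_induct)
    case (const a)
    have "(\<lambda>x. a) - (\<lambda>x. a) = (0 :: (nat \<Rightarrow> complex) \<Rightarrow> complex)" by simp
    then show ?case using D(2) all_polys_const[of a n] by (metis (no_types))
  next
    case (var i)
    then show ?case using M(4) all_polys_var by (simp add: z_def fun_diff_def)
  next
    case (add f g)
    then have "(f - (\<lambda>x. f z)) + (g - (\<lambda>x. g z)) \<in> M" using D(3) by blast
    also have "(f - (\<lambda>x. f z)) + (g - (\<lambda>x. g z)) = (f + g) - (\<lambda>x. (f + g) z)"
      by (simp add: fun_eq_iff)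
    finally show ?case using add all_polys_add by blast
  next
    case (mult f g)
    then have "g * (f - (\<lambda>x. f z)) + (\<lambda>x. f z) * (g - (\<lambda>x. g z)) \<in> M"
      using D(3,4) all_polys_const by blast
    also have "g * (f - (\<lambda>x. f z)) + (\<lambda>x. f z) * (g - (\<lambda>x. g z)) = (f * g) - (\<lambda>x. (f * g) z)"
      by (simp add: fun_eq_iff algebra_simps)
    finally show ?case using mult all_polys_mult by blast
  qed
  note ev = this
  have "f z = 0" if "f \<in> I" for f
  proof (rule ccontr)
    assume nz: "f z \<noteq> 0"
    have "f \<in> M" "f \<in> all_polys n" using that M(3) D(1) by auto
    then have "f - (f - (\<lambda>x. f z)) \<in> M" using ev poly_ideal_diff[OF M(1)] by blast
    then have "(\<lambda>x. f z) \<in> M" by (simp only: diff_diff_eq2 add_diff_cancel_left')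
    then show False using poly_ideal_one_of_const[OF M(1) _ nz] M(2) by blast
  qed
  then show ?thesis by (intro exI[of _ z]) (auto simp: z_def)
qed

section \<open>Finitely generated ideals with finitely many zeros\<close>

definition gen_ideal :: "nat \<Rightarrow> nat \<Rightarrow> (nat \<Rightarrow> (nat \<Rightarrow> complex) \<Rightarrow> complex)
    \<Rightarrow> ((nat \<Rightarrow> complex) \<Rightarrow> complex) set" where
  "gen_ideal n m F = {\<Sum>k<m. h k * F k | h. \<forall>k<m. h k \<in> all_polys n}"

lemma poly_ideal_gen_ideal:
  assumes F: "\<And>k. k < m \<Longrightarrow> F k \<in> all_polys n"
  shows "poly_ideal n (gen_ideal n m F)"
  unfolding poly_ideal_def
proof (intro conjI ballI)
  show "gen_ideal n m F \<subseteq> all_polys n"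
    unfolding gen_ideal_def using F by (auto intro!: all_polys_sum all_polys_mult)
  show "0 \<in> gen_ideal n m F"
    unfolding gen_ideal_def using all_polys_const[of 0 n]
    by (intro CollectI exI[of _ "\<lambda>_. 0"]) (simp flip: zero_fun_def)
next
  fix f g assume "f \<in> gen_ideal n m F" "g \<in> gen_ideal n m F"
  then obtain a b where "f = (\<Sum>k<m. a k * F k)" "g = (\<Sum>k<m. b k * F k)"
    "\<forall>k<m. a k \<in> all_polys n" "\<forall>k<m. b k \<in> all_polys n" unfolding gen_ideal_def by blast
  then show "f + g \<in> gen_ideal n m F"
    unfolding gen_ideal_def
    by (intro CollectI exI[of _ "\<lambda>k. a k + b k"])
      (auto intro: all_polys_add simp: sum.distrib algebra_simps)
next
  fix h f assume "h \<in> all_polys n" "f \<in> gen_ideal n m F"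
  moreover from this obtain a where "f = (\<Sum>k<m. a k * F k)" "\<forall>k<m. a k \<in> all_polys n"
    unfolding gen_ideal_def by blast
  ultimately show "h * f \<in> gen_ideal n m F"
    unfolding gen_ideal_def
    by (intro CollectI exI[of _ "\<lambda>k. h * a k"])
      (auto intro: all_polys_mult simp: sum_distrib_left algebra_simps)
qed

lemma gen_ideal_base:
  assumes "k < m" shows "F k \<in> gen_ideal n m F"
proof -
  have "F k = (\<Sum>i<m. (if i = k then 1 else 0) * F i)"
    using assms by (simp add: if_distrib[of "\<lambda>t. t * _"] cong: if_cong)
  moreover have "\<forall>i<m. (if i = k then 1 else 0) \<in> all_polys n"
    using all_polys_const[of 0 n] all_polys_const[of 1 n] by (simp add: zero_fun_def one_fun_def)
  ultimately show ?thesis unfolding gen_ideal_def by (intro CollectI exI conjI)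
qed

text \<open>If \<open>l\<close> is not the \<open>j\<close>-th coordinate of a zero, the ideal with
  \<open>x j - l\<close> adjoined has no zeros and contains 1. Hence \<open>x j - l\<close> is
  invertible modulo the ideal for all but finitely many \<open>l\<close>.\<close>

lemma finite_zeros_univariate:
  assumes F: "\<And>k. k < m \<Longrightarrow> F k \<in> all_polys n"
    and fin: "finite {z. (\<forall>i\<ge>n. z i = 0) \<and> (\<forall>k<m. F k z = 0)}" (is "finite ?S")
    and j: "j < n"
  shows "\<exists>g. g \<noteq> 0 \<and> (\<lambda>x. poly g (x j)) \<in> gen_ideal n m F"
proof -
  let ?I = "gen_ideal n m F"
  have I: "poly_ideal n ?I" by (rule poly_ideal_gen_ideal[OF F])
  show ?thesis
  proof (rule univariate_in_ideal_if_inverses[OF I j, of "(\<lambda>z. z j) ` ?S"])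
    show "countable ((\<lambda>z. z j) ` ?S)" using fin by (intro countable_finite finite_imageI)
    fix l assume l: "l \<notin> (\<lambda>z. z j) ` ?S"
    let ?p = "(\<lambda>x. x j - l) :: (nat \<Rightarrow> complex) \<Rightarrow> complex"
    have p: "?p \<in> all_polys n"
      using all_polys_diff[OF all_polys_var[OF j] all_polys_const[of l]]
      by (simp add: fun_diff_def)
    note A = poly_ideal_adjoin[OF I p]
    have "1 \<in> adjoin n ?I ?p"
    proof (rule ccontr)
      assume "1 \<notin> adjoin n ?I ?p"
      from weak_nullstellensatz[OF A(1) this] obtain z
        where z: "\<forall>i\<ge>n. z i = 0" "\<forall>f\<in>adjoin n ?I ?p. f z = 0" by blast
      have "z \<in> ?S" using z A(2) gen_ideal_base[of _ m F n] by auto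
      moreover have "z j = l" using z(2) A(3) by fastforce
      ultimately show False using l by blast
    qed
    then obtain f h where "1 = f + h * ?p" "f \<in> ?I" "h \<in> all_polys n"
      unfolding adjoin_def by blast
    moreover from this(1) have "h * ?p - 1 = - f" by (simp add: algebra_simps)
    ultimately show "\<exists>h\<in>all_polys n. h * ?p - 1 \<in> ?I" using poly_ideal_uminus[OF I] by force
  qed
qed

lemma polys_univariate:
  assumes "j < n" shows "(\<lambda>x. poly g (x j)) \<in> polys n (degree g)"
  unfolding poly_altdef
  by (intro polys_sum polys_scale)
    (use assms in \<open>auto intro!: polysD_mono[OF polys_power[OF polys_var[of j n 1]]]\<close>)

text \<open>Division by a polynomial \<open>g j\<close> in \<open>x j\<close> that lies in the ideal
  bounds the exponent of \<open>x j\<close>; the sum of the degrees of the \<open>g j\<close> then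
  bounds the degree of a representative.\<close>

theorem finite_zeros_bounded_representatives:
  assumes F: "\<And>k. k < m \<Longrightarrow> F k \<in> all_polys n"
    and fin: "finite {z. (\<forall>i\<ge>n. z i = 0) \<and> (\<forall>k<m. F k z = 0)}"
  shows "\<exists>D. \<forall>f\<in>all_polys n. \<exists>p\<in>polys n D. f - p \<in> gen_ideal n m F"
proof -
  let ?I = "gen_ideal n m F"
  have I: "poly_ideal n ?I" by (rule poly_ideal_gen_ideal[OF F])
  note D = poly_idealD[OF I]
  obtain g where g: "\<And>j. j < n \<Longrightarrow> g j \<noteq> 0" "\<And>j. j < n \<Longrightarrow> (\<lambda>x. poly (g j) (x j)) \<in> ?I"
    using finite_zeros_univariate[OF F fin] by metis
  define D0 where "D0 = (\<Sum>j<n. degree (g j))"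
  have var_power: "\<exists>p\<in>polys n (degree (g j)). (\<lambda>x. x j) ^ k - p \<in> ?I" if j: "j < n" for j k
  proof
    let ?q = "monom 1 k div g j" and ?r = "monom 1 k mod g j"
    have "degree ?r \<le> degree (g j)" using degree_mod_less[of "g j" "monom 1 k"] g(1)[OF j] by auto
    then show "(\<lambda>x. poly ?r (x j)) \<in> polys n (degree (g j))"
      using polys_univariate[OF j] polysD_mono by blast
    have "monom 1 k = ?q * g j + ?r" by simp
    then have "poly (monom 1 k) a = poly ?q a * poly (g j) a + poly ?r a" for a
      by (metis poly_add poly_mult)
    then have "(\<lambda>x. x j) ^ k - (\<lambda>x. poly ?r (x j)) = (\<lambda>x. poly ?q (x j)) * (\<lambda>x. poly (g j) (x j))"
      by (simp add: fun_eq_iff power_fun_apply poly_monom)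
    then show "(\<lambda>x. x j) ^ k - (\<lambda>x. poly ?r (x j)) \<in> ?I"
      using D(4)[OF all_polys_univariate[OF j] g(2)[OF j]] by simp
  qed
  have prod: "\<exists>p\<in>polys n (\<Sum>j<k. degree (g j)). (\<Prod>j<k. (\<lambda>x. x j) ^ (\<alpha> ! j)) - p \<in> ?I"
    if "k \<le> n" for k \<alpha>
    using that
  proof (induction k)
    case 0
    have "1 \<in> polys n 0" using polys_const[of 1 n 0] by (simp add: one_fun_def)
    moreover have "(\<Prod>j<0. (\<lambda>x. x j) ^ (\<alpha> ! j)) - 1 = (0 :: (nat \<Rightarrow> complex) \<Rightarrow> complex)"
      by (simp only: lessThan_0 prod.empty diff_self)
    ultimately show ?case using D(2) by (metis (no_types, lifting) lessThan_0 sum.empty)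
  next
    case (Suc k)
    let ?P = "\<Prod>j<k. (\<lambda>x. x j) ^ (\<alpha> ! j) :: (nat \<Rightarrow> complex) \<Rightarrow> complex"
    obtain p where p: "p \<in> polys n (\<Sum>j<k. degree (g j))" "?P - p \<in> ?I"
      using Suc.IH Suc_leD[OF Suc.prems] by blast
    obtain q where q: "q \<in> polys n (degree (g k))" "(\<lambda>x. x k) ^ (\<alpha> ! k) - q \<in> ?I"
      using var_power[of k] Suc_le_lessD[OF Suc.prems] by blast
    \<comment> \<open>With \<open>a\<close> for the new power,
      \<open>a * P - p * q = a * (P - p) + p * (a - q)\<close>.\<close>
    have "((\<lambda>x. x k) ^ (\<alpha> ! k)) * (?P - p) + p * ((\<lambda>x. x k) ^ (\<alpha> ! k) - q) \<in> ?I"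
      using p q Suc.prems
      by (intro D(3,4) all_polys_power all_polys_var) (auto intro: all_polysI)
    also have "((\<lambda>x. x k) ^ (\<alpha> ! k)) * (?P - p) + p * ((\<lambda>x. x k) ^ (\<alpha> ! k) - q)
        = (\<Prod>j<Suc k. (\<lambda>x. x j) ^ (\<alpha> ! j)) - p * q"
      by (simp add: algebra_simps)
    finally have "(\<Prod>j<Suc k. (\<lambda>x. x j) ^ (\<alpha> ! j)) - p * q \<in> ?I" .
    moreover have "p * q \<in> polys n (\<Sum>j<Suc k. degree (g j))"
      using polys_mult[OF p(1) q(1)] by (simp add: times_fun_def)
    ultimately show ?case by blast
  qed
  have "\<exists>p\<in>polys n D0. f - p \<in> ?I" if f_poly: "f \<in> all_polys n" for f
  proof -
    obtain E a where f: "\<And>x. f x = (\<Sum>\<alpha>\<in>multi_indices n E. a \<alpha> * mpow \<alpha> x)"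
      using f_poly by (auto simp: all_polys_def polys_iff)
    have "\<exists>p. \<forall>\<alpha>. p \<alpha> \<in> polys n D0 \<and> (\<Prod>j<n. (\<lambda>x. x j) ^ (\<alpha> ! j)) - p \<alpha> \<in> ?I"
      unfolding D0_def using prod[OF order_refl] by (intro choice) blast
    then obtain p where p: "\<And>\<alpha>. p \<alpha> \<in> polys n D0"
      "\<And>\<alpha>. (\<Prod>j<n. (\<lambda>x. x j) ^ (\<alpha> ! j)) - p \<alpha> \<in> ?I" by blast
    have "(\<Sum>\<alpha>\<in>multi_indices n E. (\<lambda>x. a \<alpha>) * ((\<Prod>j<n. (\<lambda>x. x j) ^ (\<alpha> ! j)) - p \<alpha>)) \<in> ?I"
      using p(2) by (intro poly_ideal_sum[OF I] D(4) all_polys_const)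
    moreover have "(\<Sum>\<alpha>\<in>multi_indices n E. (\<lambda>x. a \<alpha>) * ((\<Prod>j<n. (\<lambda>x. x j) ^ (\<alpha> ! j)) - p \<alpha>))
        = f - (\<lambda>x. \<Sum>\<alpha>\<in>multi_indices n E. a \<alpha> * p \<alpha> x)"
    proof
      fix x
      have "(\<Sum>\<alpha>\<in>multi_indices n E. (\<lambda>x. a \<alpha>) * ((\<Prod>j<n. (\<lambda>x. x j) ^ (\<alpha> ! j)) - p \<alpha>)) x
          = (\<Sum>\<alpha>\<in>multi_indices n E. a \<alpha> * mpow \<alpha> x - a \<alpha> * p \<alpha> x)"
        unfolding sum_fun_apply
        by (rule sum.cong)
          (auto simp: prod_fun_apply power_fun_apply mpow_def multi_indices_def algebra_simps)
      also have "\<dots> = (f - (\<lambda>x. \<Sum>\<alpha>\<in>multi_indices n E. a \<alpha> * p \<alpha> x)) x"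
        by (simp add: f sum_subtractf)
      finally show "(\<Sum>\<alpha>\<in>multi_indices n E. (\<lambda>x. a \<alpha>) * ((\<Prod>j<n. (\<lambda>x. x j) ^ (\<alpha> ! j)) - p \<alpha>)) x
          = (f - (\<lambda>x. \<Sum>\<alpha>\<in>multi_indices n E. a \<alpha> * p \<alpha> x)) x" .
    qed
    moreover have "(\<lambda>x. \<Sum>\<alpha>\<in>multi_indices n E. a \<alpha> * p \<alpha> x) \<in> polys n D0"
      using p(1) by (intro polys_sum polys_scale)
    ultimately show ?thesis by (intro bexI[of _ "\<lambda>x. \<Sum>\<alpha>\<in>multi_indices n E. a \<alpha> * p \<alpha> x"]) (simp only:)
  qed
  then show ?thesis by blast
qed

section \<open>Counting and power series\<close>

text \<open>This is the Hilbert series of polynomials in \<open>n\<close> variables filtered by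
  degree. Multiplying by a geometric series sums the coefficients, and the hockey-stick identity
  gives the next binomial.\<close>

lemma binomial_power_series_sums:
  fixes z :: real
  assumes z: "0 \<le> z" "z < 1"
  shows "(\<lambda>D. real ((D + n) choose n) * z ^ D) sums (1 / (1 - z) ^ Suc n)"
proof (induction n)
  case 0
  show ?case using z geometric_sums[of z] by simp
next
  case (Suc n)
  let ?a = "\<lambda>D. real ((D + n) choose n) * z ^ D"
  have geo: "(\<lambda>D. z ^ D) sums (1 / (1 - z))" using z by (intro geometric_sums) simp
  have "(\<lambda>D. \<Sum>i\<le>D. ?a i * z ^ (D - i)) sums (suminf ?a * (\<Sum>D. z ^ D))"
    using z sums_summable[OF Suc.IH] sums_summable[OF geo]
    by (intro Cauchy_product_sums) (simp_all add: abs_mult)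
  also have "suminf ?a * (\<Sum>D. z ^ D) = 1 / (1 - z) ^ Suc (Suc n)"
    unfolding sums_unique[OF Suc.IH, symmetric] sums_unique[OF geo, symmetric] by simp
  also have "(\<lambda>D. \<Sum>i\<le>D. ?a i * z ^ (D - i)) = (\<lambda>D. real ((D + Suc n) choose Suc n) * z ^ D)"
  proof
    fix D
    have "(\<Sum>i\<le>D. ?a i * z ^ (D - i)) = (\<Sum>i\<le>D. real ((i + n) choose n)) * z ^ D"
      unfolding sum_distrib_right by (intro sum.cong) (simp_all add: mult.assoc flip: power_add)
    also have "(\<Sum>i\<le>D. (i + n) choose n) = (D + Suc n) choose Suc n"
      by (induction D) auto
    then have "(\<Sum>i\<le>D. real ((i + n) choose n)) = real ((D + Suc n) choose Suc n)"
      by (simp only: flip: of_nat_sum)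
    finally show "(\<Sum>i\<le>D. ?a i * z ^ (D - i)) = real ((D + Suc n) choose Suc n) * z ^ D" .
  qed
  finally show ?case .
qed

text \<open>Even and odd exponents are summed separately, giving \<open>s\<close> and
  \<open>z * s\<close>. The halving comes from generators of degree 2.\<close>

lemma halved_power_series_sums:
  fixes z :: real
  assumes "(\<lambda>k. a k * (z\<^sup>2) ^ k) sums s"
  shows "(\<lambda>E. a (E div 2) * z ^ E) sums ((1 + z) * s)"
proof -
  define f where "f E = (if even E then a (E div 2) * z ^ E else 0)" for E
  define g where "g E = (if odd E then a (E div 2) * z ^ E else 0)" for E
  have "(\<lambda>k. f (2 * k)) sums s" using assms by (simp add: f_def power_mult)
  then have "f sums s"
    by (subst (asm) sums_mono_reindex) (auto simp: strict_mono_def f_def image_iff elim!: evenE)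
  moreover have "(\<lambda>k. g (2 * k + 1)) sums (z * s)"
    using sums_mult[OF assms, of z] by (simp add: g_def mult_ac flip: power_mult)
  then have "g sums (z * s)"
    by (subst (asm) sums_mono_reindex) (auto simp: strict_mono_def g_def image_iff elim!: oddE)
  ultimately have "(\<lambda>E. f E + g E) sums (s + z * s)" by (rule sums_add)
  also have "(\<lambda>E. f E + g E) = (\<lambda>E. a (E div 2) * z ^ E)" by (auto simp: f_def g_def)
  finally show ?thesis by (simp add: algebra_simps)
qed

lemma shifted_power_series_sums:
  fixes z :: real
  assumes "(\<lambda>E. a E * z ^ E) sums s"
  shows "(\<lambda>D. if d \<le> D then a (D - d) * z ^ D else 0) sums (z ^ d * s)"
proof -
  let ?f = "\<lambda>D. if d \<le> D then a (D - d) * z ^ D else 0"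
  have "(\<lambda>E. ?f (d + E)) sums (z ^ d * s)"
    using sums_mult[OF assms, of "z ^ d"] by (simp add: power_add mult_ac)
  moreover have "?f D = 0" if "D \<notin> range ((+) d)" for D
    using that by (auto simp: le_iff_add)
  ultimately show ?thesis
    using sums_mono_reindex[of "(+) d" ?f] by (simp add: strict_mono_def)
qed

text \<open>For fixed \<open>b\<close> the admissible \<alpha> have sum at most
  \<open>(D - d b) div 2\<close>; the condition \<open>d b \<le> D\<close> guards against truncated
  subtraction.\<close>

lemma card_two_weighted_degree:
  assumes "finite B"
  shows "card {(b, \<alpha>). b \<in> B \<and> length \<alpha> = n \<and> d b + 2 * sum_list \<alpha> \<le> D}
    = (\<Sum>b\<in>B. if d b \<le> D then ((D - d b) div 2 + n) choose n else 0)"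
proof -
  have "{(b, \<alpha>). b \<in> B \<and> length \<alpha> = n \<and> d b + 2 * sum_list \<alpha> \<le> D}
      = Sigma B (\<lambda>b. {\<alpha>. length \<alpha> = n \<and> d b + 2 * sum_list \<alpha> \<le> D})" by auto
  moreover have *: "{\<alpha>. length \<alpha> = n \<and> d b + 2 * sum_list \<alpha> \<le> D}
      = (if d b \<le> D then multi_indices n ((D - d b) div 2) else {})" for b
    by (auto simp: multi_indices_def)
  ultimately show ?thesis
    using assms by (simp add: card_multi_indices if_distrib cong: if_cong)
qed

text \<open>
  Multiplying the hypothesis by \<open>z ^ D\<close> and summing over \<open>D\<close> yields
  \<open>(\<Sum>b\<in>B. z ^ d b) \<le> (1 + z) ^ n\<close> for \<open>0 < z < 1\<close>, with equality at \<open>z = 1\<close>; the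
  conclusion compares the derivatives at \<open>1\<close>.
\<close>

lemma degree_sum_lower_bound:
  assumes B: "finite B" "card B = 2 ^ n"
    and count: "\<And>D. card {(b, \<alpha>). b \<in> B \<and> length \<alpha> = n \<and> d b + 2 * sum_list \<alpha> \<le> D}
      \<le> (D + n) choose n"
  shows "n * 2 ^ n \<le> 2 * (\<Sum>b\<in>B. d b)"
proof -
  have gen: "(\<Sum>b\<in>B. z ^ d b) \<le> (1 + z) ^ n" if z: "0 < z" "z < 1" for z :: real
  proof -
    have "z\<^sup>2 < 1" using z by (simp add: abs_square_less_1)
    then have "(\<lambda>k. real ((k + n) choose n) * (z\<^sup>2) ^ k) sums (1 / (1 - z\<^sup>2) ^ Suc n)"
      by (intro binomial_power_series_sums) simp
    then have "(\<lambda>E. real ((E div 2 + n) choose n) * z ^ E) sums ((1 + z) * (1 / (1 - z\<^sup>2) ^ Suc n))"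
      by (rule halved_power_series_sums)
    from shifted_power_series_sums[OF this]
    have s1: "(\<lambda>D. \<Sum>b\<in>B. if d b \<le> D then real (((D - d b) div 2 + n) choose n) * z ^ D else 0)
        sums (\<Sum>b\<in>B. z ^ d b * ((1 + z) * (1 / (1 - z\<^sup>2) ^ Suc n)))"
      by (intro sums_sum)
    have s2: "(\<lambda>D. real ((D + n) choose n) * z ^ D) sums (1 / (1 - z) ^ Suc n)"
      using z by (intro binomial_power_series_sums) simp
    have le: "(\<Sum>b\<in>B. if d b \<le> D then real (((D - d b) div 2 + n) choose n) * z ^ D else 0)
        \<le> real ((D + n) choose n) * z ^ D" for D
    proof -
      have "(\<Sum>b\<in>B. if d b \<le> D then real (((D - d b) div 2 + n) choose n) * z ^ D else 0)
          = real (\<Sum>b\<in>B. if d b \<le> D then ((D - d b) div 2 + n) choose n else 0) * z ^ D"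
        unfolding of_nat_sum sum_distrib_right by (intro sum.cong) auto
      also have "\<dots> \<le> real ((D + n) choose n) * z ^ D"
        using count[of D] z unfolding card_two_weighted_degree[OF B(1)]
        by (intro mult_right_mono) (auto simp del: of_nat_sum)
      finally show ?thesis .
    qed
    have "(\<Sum>b\<in>B. z ^ d b * ((1 + z) * (1 / (1 - z\<^sup>2) ^ Suc n))) \<le> 1 / (1 - z) ^ Suc n"
      by (rule sums_le[OF le s1 s2])
    then have "(\<Sum>b\<in>B. z ^ d b) * ((1 + z) * (1 / (1 - z\<^sup>2) ^ Suc n)) \<le> 1 / (1 - z) ^ Suc n"
      by (simp only: sum_distrib_right)
    also have "(1 - z\<^sup>2) ^ Suc n = (1 + z) ^ Suc n * (1 - z) ^ Suc n"
      by (simp add: power2_eq_square algebra_simps flip: power_mult_distrib)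
    finally show ?thesis
      using z by (simp add: divide_simps mult_ac split: if_splits)
  qed
  \<comment> \<open>Difference quotients at 1 replace derivatives: both
    \<open>2 ^ n - (1 + z) ^ n\<close> and the sum of the \<open>1 - z ^ d b\<close> are compared
    with multiples of \<open>1 - z\<close>.\<close>
  have bound: "real n * (1 + z) ^ n \<le> 2 * real (\<Sum>b\<in>B. d b)" if z: "0 < z" "z < 1" for z :: real
  proof -
    have "2 ^ n - (1 + z) ^ n = (1 - z) * (\<Sum>i<n. (1 + z) ^ (n - Suc i) * 2 ^ i)"
      using power_diff_sumr2[of "2 :: real" n "1 + z"] by (simp add: algebra_simps)
    moreover have "2 * (\<Sum>i<n. (1 + z) ^ (n - Suc i) * 2 ^ i) \<ge> real n * (1 + z) ^ n"
    proof -
      have "(1 + z) ^ n \<le> 2 * ((1 + z) ^ (n - Suc i) * 2 ^ i)" if i: "i < n" for i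
      proof -
        have "(1 + z) ^ n = (1 + z) ^ (n - Suc i) * (1 + z) ^ Suc i"
          using i by (simp add: algebra_simps flip: power_Suc power_add)
        also have "\<dots> \<le> (1 + z) ^ (n - Suc i) * 2 ^ Suc i"
          using z by (intro mult_left_mono power_mono) auto
        finally show ?thesis by simp
      qed
      then have "(\<Sum>i<n. (1 + z) ^ n) \<le> (\<Sum>i<n. 2 * ((1 + z) ^ (n - Suc i) * 2 ^ i))"
        by (intro sum_mono) auto
      then show ?thesis by (simp add: sum_distrib_left)
    qed
    ultimately have "(1 - z) * (real n * (1 + z) ^ n) \<le> 2 * (2 ^ n - (1 + z) ^ n)"
      using z by (simp add: mult.left_commute mult_left_mono)
    also have "\<dots> \<le> 2 * (\<Sum>b\<in>B. 1 - z ^ d b)"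
      using gen[OF z] B by (simp add: sum_subtractf)
    also have "(\<Sum>b\<in>B. 1 - z ^ d b) \<le> (\<Sum>b\<in>B. real (d b) * (1 - z))"
    proof (rule sum_mono)
      fix b
      have "1 + real (d b) * (z - 1) \<le> (1 + (z - 1)) ^ d b"
        using z by (intro Bernoulli_inequality) auto
      then show "1 - z ^ d b \<le> real (d b) * (1 - z)" by (simp add: algebra_simps)
    qed
    also have "\<dots> = (1 - z) * real (\<Sum>b\<in>B. d b)" by (simp add: sum_distrib_left mult.commute)
    finally have "(1 - z) * (real n * (1 + z) ^ n) \<le> (1 - z) * (2 * real (\<Sum>b\<in>B. d b))" by simp
    then show ?thesis using z by (simp only: mult_le_cancel_left_pos diff_gt_0_iff_gt)
  qed
  have "((\<lambda>z. real n * (1 + z) ^ n) \<longlongrightarrow> real n * (1 + 1) ^ n) (at_left (1::real))"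
    by (intro tendsto_intros)
  moreover have "eventually (\<lambda>z. real n * (1 + z) ^ n \<le> 2 * real (\<Sum>b\<in>B. d b)) (at_left (1::real))"
    by (rule eventually_at_leftI[of 0]) (auto intro: bound simp del: of_nat_sum)
  ultimately have "real n * (1 + 1) ^ n \<le> 2 * real (\<Sum>b\<in>B. d b)"
    by (intro tendsto_upperbound) auto
  then have "real (n * 2 ^ n) \<le> real (2 * (\<Sum>b\<in>B. d b))" by simp
  then show ?thesis by (simp only: of_nat_le_iff)
qed

text \<open>The right side equals the product of \<open>M + 1\<close>, ...,
  \<open>M + n\<close>.\<close>

lemma power_le_binomial_mult_fact: "(M + 1) ^ n \<le> ((M + n) choose n) * fact n"
proof (induction n)
  case (Suc n)
  have "(M + 1) ^ Suc n = (M + 1) ^ n * (M + 1)" by simp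
  also have "\<dots> \<le> (((M + n) choose n) * fact n) * (M + Suc n)"
    by (rule mult_mono[OF Suc.IH]) auto
  also have "\<dots> = (Suc (M + n) * ((M + n) choose n)) * fact n" by (simp add: algebra_simps)
  also have "\<dots> = (Suc n * (Suc (M + n) choose Suc n)) * fact n" by (simp only: Suc_times_binomial)
  also have "\<dots> = ((M + Suc n) choose Suc n) * fact (Suc n)" by (simp add: algebra_simps)
  finally show ?case .
qed simp

text \<open>As polynomials in \<open>N\<close> of degree \<open>n\<close>, the two sides have
  leading coefficients \<open>(2 ^ n + 1) / n!\<close> and \<open>2 ^ n / n!\<close>, so the
  inequality fails for large \<open>N\<close>.\<close>

lemma binomial_growth_contradiction:
  assumes "\<And>N. N \<ge> 1 \<Longrightarrow> (2 ^ n + 1) * ((N - 1 + n) choose n) \<le> (2 * N + D + n) choose n"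
  shows False
proof -
  have *: "(2 ^ n + 1) * real N ^ n \<le> (2 * real N + real (D + n)) ^ n" if "N \<ge> 1" for N
  proof -
    have "(2 ^ n + 1) * N ^ n \<le> (2 ^ n + 1) * (((N - 1 + n) choose n) * fact n)"
      using power_le_binomial_mult_fact[of "N - 1" n] that by (intro mult_left_mono) auto
    also have "\<dots> = (2 ^ n + 1) * ((N - 1 + n) choose n) * fact n" by (simp only: mult.assoc)
    also have "\<dots> \<le> ((2 * N + D + n) choose n) * fact n"
      by (rule mult_right_mono[OF assms[OF that]]) simp
    also have "\<dots> \<le> (2 * N + D + n) ^ n" by (rule binomial_fact_pow)
    finally have "real ((2 ^ n + 1) * N ^ n) \<le> real ((2 * N + D + n) ^ n)" by (simp only: of_nat_le_iff)
    then show ?thesis by (simp add: algebra_simps)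
  qed
  have "(\<lambda>N. (2 + real (D + n) / real N) ^ n) \<longlonglongrightarrow> (2 + 0) ^ n"
    by (intro tendsto_intros lim_const_over_n)
  moreover have "2 ^ n + 1 \<le> (2 + real (D + n) / real N) ^ n" if "N \<ge> 1" for N
  proof -
    have "(2 ^ n + 1) * real N ^ n \<le> ((2 + real (D + n) / real N) * real N) ^ n"
      using *[OF that] that by (simp add: distrib_right del: of_nat_add)
    then show ?thesis using that by (simp add: power_mult_distrib)
  qed
  ultimately have "2 ^ n + 1 \<le> (2 + 0 :: real) ^ n"
    by (intro LIMSEQ_le_const) auto
  then show False by simp
qed

section \<open>Lowest-order terms in a parameter\<close>

text \<open>Dividing by \<open>t ^ d\<close> and letting \<open>t\<close> tend to 0 kills all terms
  of larger weight, as well as the right side because \<open>d < K\<close>.\<close>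

lemma lowest_terms_vanish:
  fixes h :: "'i \<Rightarrow> complex \<Rightarrow> complex"
  assumes A: "finite A" and h: "\<And>a. a \<in> A \<Longrightarrow> isCont (h a) 0" and g: "isCont g 0"
    and eq: "\<And>t. (\<Sum>a\<in>A. t ^ wt a * h a t) = t ^ K * g t"
    and d: "\<And>a. a \<in> A \<Longrightarrow> d \<le> wt a" "d < K"
  shows "(\<Sum>a | a \<in> A \<and> wt a = d. h a 0) = 0"
proof -
  have "(\<Sum>a\<in>A. t ^ (wt a - d) * h a t) = t ^ (K - d) * g t" if "t \<noteq> 0" for t
  proof -
    have "t ^ d * (\<Sum>a\<in>A. t ^ (wt a - d) * h a t) = (\<Sum>a\<in>A. t ^ wt a * h a t)"
      unfolding sum_distrib_left
    proof (rule sum.cong)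
      fix a assume "a \<in> A"
      then have "t ^ wt a = t ^ d * t ^ (wt a - d)" using d(1) by (simp flip: power_add)
      then show "t ^ d * (t ^ (wt a - d) * h a t) = t ^ wt a * h a t" by (simp only: mult.assoc)
    qed simp
    also have "\<dots> = t ^ d * (t ^ (K - d) * g t)"
    proof -
      have "t ^ K = t ^ d * t ^ (K - d)" using d(2) by (simp flip: power_add)
      then show ?thesis unfolding eq by (simp only: mult.assoc)
    qed
    finally show ?thesis using that by simp
  qed
  then have "eventually (\<lambda>t. t ^ (K - d) * g t = (\<Sum>a\<in>A. t ^ (wt a - d) * h a t)) (at 0)"
    by (simp add: eventually_at_filter)
  moreover have "((\<lambda>t. t ^ (K - d) * g t) \<longlongrightarrow> 0 ^ (K - d) * g 0) (at 0)"
    using g by (intro tendsto_intros) (simp add: isCont_def)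
  ultimately have "((\<lambda>t. \<Sum>a\<in>A. t ^ (wt a - d) * h a t) \<longlongrightarrow> 0 ^ (K - d) * g 0) (at 0)"
    by (rule Lim_transform_eventually[rotated])
  moreover have "((\<lambda>t. \<Sum>a\<in>A. t ^ (wt a - d) * h a t) \<longlongrightarrow> (\<Sum>a\<in>A. 0 ^ (wt a - d) * h a 0)) (at 0)"
    using h by (intro tendsto_intros) (simp add: isCont_def)
  ultimately have "(\<Sum>a\<in>A. 0 ^ (wt a - d) * h a 0) = 0 ^ (K - d) * g 0"
    by (rule tendsto_unique[rotated, THEN sym]) simp
  also have "\<dots> = 0" using d(2) by simp
  \<comment> \<open>\<open>0 ^ (wt a - d)\<close> is 1 for \<open>wt a = d\<close> and 0 otherwise,
    since no weight is below \<open>d\<close>.\<close>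
  also have "(\<Sum>a\<in>A. 0 ^ (wt a - d) * h a 0) = (\<Sum>a | a \<in> A \<and> wt a = d. h a 0)"
  proof (rule sum.mono_neutral_cong_right)
    show "\<forall>i\<in>A - {a. a \<in> A \<and> wt a = d}. 0 ^ (wt i - d) * h i 0 = 0"
      using d(1) by (auto simp: power_0_left intro: antisym)
  qed (use A in auto)
  finally show ?thesis .
qed

lemma isCont_all_polys:
  assumes "f \<in> all_polys n" "\<And>i. i < n \<Longrightarrow> isCont (\<lambda>t. x t i) a"
  shows "isCont (\<lambda>t::complex. f (x t)) a"
  using assms(1)
  by (induction rule: all_polys_induct) (auto intro: assms(2))

lemma mpow_smult: "mpow \<alpha> (\<lambda>i. t * x i) = t ^ sum_list \<alpha> * mpow \<alpha> x"
  by (induction \<alpha> arbitrary: x) (simp_all add: mpow_Cons power_mult_distrib power_add)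

lemma isCont_mpow:
  assumes "\<And>i. i < length \<alpha> \<Longrightarrow> isCont (\<lambda>t. x t i) a"
  shows "isCont (\<lambda>t::complex. mpow \<alpha> (x t)) a"
  unfolding mpow_def using assms by (intro continuous_intros) auto

lemma mpow_cong: "(\<And>i. i < length \<alpha> \<Longrightarrow> x i = y i) \<Longrightarrow> mpow \<alpha> x = mpow \<alpha> y"
  by (auto simp: mpow_def)

section \<open>Orders of vanishing along arcs\<close>

text \<open>Only continuity of the cofactor is demanded: lowest-order terms are extracted by a limit
  at 0.\<close>

definition order_ge :: "nat \<Rightarrow> (complex \<Rightarrow> complex) \<Rightarrow> bool" where
  "order_ge K f \<longleftrightarrow> (\<exists>g. isCont g 0 \<and> (\<forall>t. f t = t ^ K * g t))"

lemma order_geI: "isCont g 0 \<Longrightarrow> (\<And>t. f t = t ^ K * g t) \<Longrightarrow> order_ge K f"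
  unfolding order_ge_def by blast

lemma order_ge_0: "isCont f 0 \<Longrightarrow> order_ge 0 f"
  by (rule order_geI[of f]) auto

lemma order_ge_mult: "order_ge K f \<Longrightarrow> order_ge L g \<Longrightarrow> order_ge (K + L) (\<lambda>t. f t * g t)"
  unfolding order_ge_def
proof (elim exE conjE)
  fix f' g' assume "isCont f' 0" "isCont g' 0" "\<forall>t. f t = t ^ K * f' t" "\<forall>t. g t = t ^ L * g' t"
  then show "\<exists>h. isCont h 0 \<and> (\<forall>t. f t * g t = t ^ (K + L) * h t)"
    by (intro exI[of _ "\<lambda>t. f' t * g' t"]) (auto simp: power_add)
qed

lemma order_ge_add: "order_ge K f \<Longrightarrow> order_ge K g \<Longrightarrow> order_ge K (\<lambda>t. f t + g t)"
  unfolding order_ge_def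
proof (elim exE conjE)
  fix f' g' assume "isCont f' 0" "isCont g' 0" "\<forall>t. f t = t ^ K * f' t" "\<forall>t. g t = t ^ K * g' t"
  then show "\<exists>h. isCont h 0 \<and> (\<forall>t. f t + g t = t ^ K * h t)"
    by (intro exI[of _ "\<lambda>t. f' t + g' t"]) (auto simp: algebra_simps)
qed

lemma order_ge_zero: "order_ge K (\<lambda>t. 0)"
  by (rule order_geI[of "\<lambda>_. 0"]) auto

lemma order_ge_sum:
  "(\<And>i. i \<in> I \<Longrightarrow> order_ge K (f i)) \<Longrightarrow> order_ge K (\<lambda>t. \<Sum>i\<in>I. f i t)"
  by (induction I rule: infinite_finite_induct) (auto intro: order_ge_add order_ge_zero)

lemma order_ge_cmult: "order_ge K f \<Longrightarrow> order_ge K (\<lambda>t. a * f t)"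
  using order_ge_mult[OF order_ge_0[of "\<lambda>_. a"], of K f] by simp

lemma order_ge_power: "order_ge K f \<Longrightarrow> order_ge (m * K) (\<lambda>t. f t ^ m)"
  by (induction m) (auto intro: order_ge_mult order_ge_0)

section \<open>Powers of an ideal and jets at its zeros\<close>

primrec ideal_power :: "nat \<Rightarrow> nat \<Rightarrow> (nat \<Rightarrow> (nat \<Rightarrow> complex) \<Rightarrow> complex) \<Rightarrow> nat
    \<Rightarrow> ((nat \<Rightarrow> complex) \<Rightarrow> complex) set" where
  "ideal_power n m F 0 = all_polys n"
| "ideal_power n m F (Suc N) = {\<Sum>k<m. h k * F k | h. \<forall>k<m. h k \<in> ideal_power n m F N}"

text \<open>The cofactors of the \<open>F k\<close> in \<open>f - p0\<close> are in turn replaced by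
  representatives modulo the \<open>N\<close>-th power; each round adds the degree 2 of the
  \<open>F k\<close>.\<close>

lemma ideal_power_representatives:
  assumes F: "\<And>k. k < m \<Longrightarrow> F k \<in> polys n 2"
    and rep: "\<forall>f\<in>all_polys n. \<exists>p\<in>polys n D. f - p \<in> gen_ideal n m F"
    and f: "f \<in> all_polys n"
  shows "\<exists>p\<in>polys n (2 * N + D). f - p \<in> ideal_power n m F N"
  using f
proof (induction N arbitrary: f)
  case 0
  have "f - (\<lambda>x. 0) \<in> all_polys n" using 0 all_polys_const by (intro all_polys_diff)
  then have "f - (\<lambda>x. 0) \<in> ideal_power n m F 0" by simp
  then show ?case using polys_const[of 0] by blast
next
  case (Suc N)
  obtain p0 where p0: "p0 \<in> polys n D" "f - p0 \<in> gen_ideal n m F" using rep Suc.prems by blast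
  then obtain h where h: "f - p0 = (\<Sum>k<m. h k * F k)" "\<forall>k<m. h k \<in> all_polys n"
    unfolding gen_ideal_def by blast
  have "\<exists>p. \<forall>k. k < m \<longrightarrow> p k \<in> polys n (2 * N + D) \<and> h k - p k \<in> ideal_power n m F N"
    using Suc.IH h(2) by (intro choice) blast
  then obtain p where p: "\<And>k. k < m \<Longrightarrow> p k \<in> polys n (2 * N + D)"
    "\<And>k. k < m \<Longrightarrow> h k - p k \<in> ideal_power n m F N" by blast
  define q where "q = p0 + (\<Sum>k<m. p k * F k)"
  have "f - q = (\<Sum>k<m. (h k - p k) * F k)"
  proof -
    have "f - q = (f - p0) - (\<Sum>k<m. p k * F k)" by (simp only: q_def diff_diff_eq)
    also have "\<dots> = (\<Sum>k<m. (h k - p k) * F k)"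
      unfolding h(1) by (simp only: sum_subtractf left_diff_distrib)
    finally show ?thesis .
  qed
  then have "f - q \<in> ideal_power n m F (Suc N)" using p(2) by auto
  moreover have "q \<in> polys n (2 * Suc N + D)"
  proof -
    have "(\<lambda>x. \<Sum>k<m. p k x * F k x) \<in> polys n (2 * Suc N + D)"
    proof (intro polys_sum)
      fix k assume "k \<in> {..<m}"
      then have "(\<lambda>x. p k x * F k x) \<in> polys n (2 * N + D + 2)"
        using p(1) F by (intro polys_mult) auto
      then show "(\<lambda>x. p k x * F k x) \<in> polys n (2 * Suc N + D)"
        by (rule polysD_mono) simp
    qed
    then have "(\<lambda>x. p0 x + (\<Sum>k<m. p k x * F k x)) \<in> polys n (2 * Suc N + D)"
      using p0(1) by (intro polys_add) (auto elim: polysD_mono)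
    moreover have "(\<lambda>x. p0 x + (\<Sum>k<m. p k x * F k x)) = q"
      by (simp add: q_def fun_eq_iff sum_fun_apply)
    ultimately show ?thesis by simp
  qed
  ultimately show ?case by blast
qed

lemma order_ge_ideal_power:
  assumes x: "\<And>i. i < n \<Longrightarrow> isCont (\<lambda>t. x t i) 0"
    and F: "\<And>k. k < m \<Longrightarrow> order_ge 2 (\<lambda>t. F k (x t))"
    and f: "f \<in> ideal_power n m F N"
  shows "order_ge (2 * N) (\<lambda>t. f (x t))"
  using f
proof (induction N arbitrary: f)
  case 0
  have "isCont (\<lambda>t. f (x t)) 0"
    by (rule isCont_all_polys[of f n]) (use 0 x in simp_all)
  then show ?case by (simp add: order_ge_0)
next
  case (Suc N)
  then obtain h where h: "f = (\<Sum>k<m. h k * F k)" "\<forall>k<m. h k \<in> ideal_power n m F N" by auto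
  have "order_ge (2 * N + 2) (\<lambda>t. \<Sum>k<m. h k (x t) * F k (x t))"
    using h(2) Suc.IH F by (intro order_ge_sum order_ge_mult) auto
  then show ?case by (simp add: h(1) sum_fun_apply)
qed

lemma isCont_if_order_ge_diff:
  assumes "order_ge 1 (\<lambda>t. f t - a)"
  shows "isCont f 0" "f 0 = a"
proof -
  obtain g where g: "isCont g 0" "\<And>t. f t - a = t ^ 1 * g t"
    using assms unfolding order_ge_def by blast
  then have "f t = a + t * g t" for t using g(2)[of t] by (simp add: diff_eq_eq add.commute)
  then have "f = (\<lambda>t. a + t * g t)" by blast
  then show "isCont f 0" "f 0 = a" using g(1) by auto
qed

lemma mpow_weighted:
  "mpow \<beta> (\<lambda>i. t ^ w i * y i) = t ^ (\<Sum>i<length \<beta>. w i * \<beta> ! i) * mpow \<beta> y"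
  by (simp add: mpow_def power_mult_distrib prod.distrib power_sum power_mult)

text \<open>
  Each point \<open>c\<close> comes with weights \<open>w c\<close>, coordinates \<open>Y c\<close> and arcs \<open>X c y\<close> issuing from \<open>c\<close>
  along which the \<open>i\<close>-th coordinate is \<open>t ^ w c i * y i\<close>. Products of the \<open>F k\<close> vanish to order 2
  per factor along the arcs, so monomials in the coordinates of weight below \<open>2 * N\<close>, localised at
  their point by \<open>E\<close>, stay independent modulo the \<open>N\<close>-th power of the ideal of the \<open>F k\<close>.
\<close>

lemma weighted_jets_card_le:
  fixes S :: "(nat \<Rightarrow> complex) set"
  assumes S: "finite S"
    and sep: "\<And>c d. c \<in> S \<Longrightarrow> d \<in> S \<Longrightarrow> c \<noteq> d \<Longrightarrow> \<exists>i<n. c i \<noteq> d i"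
    and F: "\<And>k. k < m \<Longrightarrow> F k \<in> polys n 2"
    and rep: "\<forall>f\<in>all_polys n. \<exists>p\<in>polys n D. f - p \<in> gen_ideal n m F"
    and w: "\<And>c i. c \<in> S \<Longrightarrow> w c i \<ge> (1 :: nat)"
    and Y: "\<And>c i. c \<in> S \<Longrightarrow> i < n \<Longrightarrow> Y c i \<in> all_polys n"
    and X: "\<And>c y i. c \<in> S \<Longrightarrow> i < n \<Longrightarrow> order_ge 1 (\<lambda>t. X c y t i - c i)"
    and YX: "\<And>c y i t. c \<in> S \<Longrightarrow> i < n \<Longrightarrow> Y c i (X c y t) = t ^ w c i * y i"
    and FX: "\<And>c y k. c \<in> S \<Longrightarrow> k < m \<Longrightarrow> order_ge 2 (\<lambda>t. F k (X c y t))"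
  shows "(\<Sum>c\<in>S. card {\<beta>. length \<beta> = n \<and> (\<Sum>i<n. w c i * \<beta> ! i) < 2 * N})
    \<le> (2 * N + D + n) choose n"
proof -
  define G where "G c = {\<beta>. length \<beta> = n \<and> (\<Sum>i<n. w c i * \<beta> ! i) < 2 * N}" for c
  have G: "finite (G c)" if "c \<in> S" for c
  proof (rule finite_subset)
    show "G c \<subseteq> multi_indices n (2 * N)"
    proof
      fix \<beta> assume \<beta>: "\<beta> \<in> G c"
      have "sum_list \<beta> = (\<Sum>i<n. \<beta> ! i)"
        using \<beta> by (simp add: G_def sum_list_sum_nth atLeast0LessThan)
      also have "\<dots> \<le> (\<Sum>i<n. w c i * \<beta> ! i)"
        using w[OF that] by (intro sum_mono) (simp add: Suc_le_eq)
      finally show "\<beta> \<in> multi_indices n (2 * N)" using \<beta> by (auto simp: G_def multi_indices_def)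
    qed
  qed simp
  have "\<forall>c\<in>S. \<forall>d\<in>S. c \<noteq> d \<longrightarrow> (\<exists>i<n. c i \<noteq> d i)" using sep by blast
  then obtain ix where ix: "\<And>c d. c \<in> S \<Longrightarrow> d \<in> S \<Longrightarrow> c \<noteq> d \<Longrightarrow> ix c d < n"
    "\<And>c d. c \<in> S \<Longrightarrow> d \<in> S \<Longrightarrow> c \<noteq> d \<Longrightarrow> c (ix c d) \<noteq> d (ix c d)"
    by metis
  \<comment> \<open>\<open>E c\<close> is an interpolation polynomial: it is 1 at \<open>c\<close>,
    and its factor for \<open>d\<close> vanishes to order at least \<open>2 * N\<close> along the
    arcs from \<open>d\<close>.\<close>
  define E where "E c x = (\<Prod>d\<in>S - {c}.
      ((x (ix c d) - d (ix c d)) * (1 / (c (ix c d) - d (ix c d)))) ^ (2 * N))" for c x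
  have E_poly: "E c \<in> all_polys n" if "c \<in> S" for c
  proof -
    have "E c = (\<Prod>d\<in>S - {c}. (((\<lambda>x. x (ix c d)) - (\<lambda>x. d (ix c d)))
        * (\<lambda>x. 1 / (c (ix c d) - d (ix c d)))) ^ (2 * N))"
      by (simp add: E_def fun_eq_iff prod_fun_apply power_fun_apply)
    moreover have "\<dots> \<in> all_polys n"
      using ix(1) that
      by (intro all_polys_prod all_polys_power all_polys_mult all_polys_const all_polys_diff
          all_polys_var) auto
    ultimately show ?thesis by simp
  qed
  have E_self: "E c c = 1" if "c \<in> S" for c
    unfolding E_def using ix(2)[OF that] by (intro prod.neutral) auto
  define u where "u = (\<lambda>(c, \<beta>) x. mpow \<beta> (\<lambda>i. Y c i x) * E c x)"
  have u_poly: "u (c, \<beta>) \<in> all_polys n" if "c \<in> S" "length \<beta> = n" for c \<beta>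
  proof -
    have "u (c, \<beta>) = (\<Prod>i<n. Y c i ^ (\<beta> ! i)) * E c"
      using that by (simp add: u_def fun_eq_iff mpow_def prod_fun_apply power_fun_apply)
    moreover have "\<dots> \<in> all_polys n"
      using Y that by (intro all_polys_mult all_polys_prod all_polys_power E_poly) auto
    ultimately show ?thesis by simp
  qed
  have "\<forall>a\<in>Sigma S G. \<exists>p\<in>polys n (2 * N + D). u a - p \<in> ideal_power n m F N"
    using ideal_power_representatives[OF F rep] u_poly by (auto simp: G_def)
  then have "\<exists>p. \<forall>a\<in>Sigma S G. p a \<in> polys n (2 * N + D) \<and> u a - p a \<in> ideal_power n m F N"
    by (intro bchoice) blast
  then obtain p where p: "\<forall>a\<in>Sigma S G. p a \<in> polys n (2 * N + D) \<and> u a - p a \<in> ideal_power n m F N" ..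
  note p = conjunct1[OF bspec[OF p]] conjunct2[OF bspec[OF p]]
  have contX: "isCont (\<lambda>t. X c y t i) 0" if "c \<in> S" "i < n" for c y i
    using isCont_if_order_ge_diff(1)[OF X[OF that]] .
  have order_other: "order_ge (2 * N) (\<lambda>t. E c (X d y t))" if cd: "c \<in> S" "d \<in> S" "c \<noteq> d" for c d y
  proof -
    let ?f = "\<lambda>e t. ((X d y t (ix c e) - e (ix c e)) * (1 / (c (ix c e) - e (ix c e)))) ^ (2 * N)"
    have "order_ge (2 * N * (1 + 0)) (?f d)"
      using cd ix(1) by (intro order_ge_power order_ge_mult X order_ge_0) auto
    moreover have "isCont (\<lambda>t. \<Prod>e\<in>S - {c} - {d}. ?f e t) 0"
      using cd ix(1) by (intro continuous_intros contX) auto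
    ultimately have "order_ge (2 * N * (1 + 0) + 0) (\<lambda>t. ?f d t * (\<Prod>e\<in>S - {c} - {d}. ?f e t))"
      by (intro order_ge_mult order_ge_0)
    moreover have "E c (X d y t) = ?f d t * (\<Prod>e\<in>S - {c} - {d}. ?f e t)" for t
      unfolding E_def using S cd by (subst prod.remove[of _ d]) auto
    ultimately show ?thesis by simp
  qed
  have "card (Sigma S G) \<le> card (mpow ` multi_indices n (2 * N + D))"
  proof (rule card_le_if_independent_family[where u = p])
    show "finite (Sigma S G)" using S G by auto
    show "p a \<in> fvs.span (mpow ` multi_indices n (2 * N + D))" if "a \<in> Sigma S G" for a
      using p(1)[OF that] by (simp add: polys_def)
    fix co assume co: "\<And>x. (\<Sum>a\<in>Sigma S G. co a * p a x) = 0"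
    show "\<forall>a\<in>Sigma S G. co a = 0"
    proof (rule ccontr)
      assume "\<not> ?thesis"
      then obtain c \<beta>0 where c: "c \<in> S" "\<beta>0 \<in> G c" "co (c, \<beta>0) \<noteq> 0" by auto
      define A where "A = {\<beta> \<in> G c. co (c, \<beta>) \<noteq> 0}"
      have A: "finite A" "A \<noteq> {}" using G[OF c(1)] c by (auto simp: A_def)
      define wt where "wt \<beta> = (\<Sum>i<n. w c i * \<beta> ! i)" for \<beta>
      define d where "d = Min (wt ` A)"
      have d_le: "d \<le> wt \<beta>" if "\<beta> \<in> A" for \<beta> unfolding d_def using A that by auto
      have "d \<in> wt ` A" unfolding d_def using A by (intro Min_in) auto
      then obtain \<beta>1 where \<beta>1: "\<beta>1 \<in> A" "wt \<beta>1 = d" by auto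
      then have d_less: "d < 2 * N" by (auto simp: A_def G_def wt_def)
      have "(\<Sum>\<beta> | \<beta> \<in> A \<and> wt \<beta> = d. co (c, \<beta>) * mpow \<beta> y) = 0" for y
      proof -
        \<comment> \<open>Along an arc from \<open>c\<close> each \<open>u a\<close> agrees with its
          representative \<open>p a\<close> up to order \<open>2 * N\<close>, so the relation
          between the \<open>p a\<close> holds for the \<open>u a\<close> up to that order.\<close>
        have "order_ge (2 * N) (\<lambda>t. \<Sum>a\<in>Sigma S G. co a * (u a - p a) (X c y t))"
        proof (intro order_ge_sum order_ge_cmult)
          fix a assume "a \<in> Sigma S G"
          from p(2)[OF this] show "order_ge (2 * N) (\<lambda>t. (u a - p a) (X c y t))"
            by (rule order_ge_ideal_power[rotated 2]) (simp_all add: contX FX c(1))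
        qed
        moreover have "(\<Sum>a\<in>Sigma S G. co a * (u a - p a) x) = (\<Sum>a\<in>Sigma S G. co a * u a x)" for x
          using co[of x] by (simp add: right_diff_distrib sum_subtractf)
        ultimately have "order_ge (2 * N) (\<lambda>t. \<Sum>a\<in>Sigma S G. co a * u a (X c y t))" by simp
        \<comment> \<open>The factors \<open>E e\<close> with \<open>e \<noteq> c\<close> make the
          monomials at all other points negligible.\<close>
        moreover have "order_ge (2 * N) (\<lambda>t. \<Sum>a\<in>Sigma (S - {c}) G. - co a * u a (X c y t))"
        proof (intro order_ge_sum order_ge_cmult)
          fix a assume "a \<in> Sigma (S - {c}) G"
          then obtain e \<beta> where a: "a = (e, \<beta>)" "e \<in> S" "e \<noteq> c" "\<beta> \<in> G e" by auto
          have "order_ge (0 + 2 * N) (\<lambda>t. mpow \<beta> (\<lambda>i. Y e i (X c y t)) * E e (X c y t))"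
            using a c(1)
            by (intro order_ge_mult order_ge_0 order_other isCont_mpow isCont_all_polys[OF Y] contX)
              (auto simp: G_def)
          then show "order_ge (2 * N) (\<lambda>t. u a (X c y t))" by (simp add: u_def a)
        qed
        ultimately have "order_ge (2 * N) (\<lambda>t. (\<Sum>a\<in>Sigma S G. co a * u a (X c y t))
            + (\<Sum>a\<in>Sigma (S - {c}) G. - co a * u a (X c y t)))" by (rule order_ge_add)
        moreover have "(\<Sum>a\<in>Sigma S G. co a * u a x) + (\<Sum>a\<in>Sigma (S - {c}) G. - co a * u a x)
            = (\<Sum>\<beta>\<in>A. co (c, \<beta>) * u (c, \<beta>) x)" for x
        proof -
          have "(\<Sum>a\<in>Sigma S G. co a * u a x) = (\<Sum>e\<in>S. \<Sum>\<beta>\<in>G e. co (e, \<beta>) * u (e, \<beta>) x)"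
            using S G by (subst sum.Sigma) (auto intro!: sum.cong)
          also have "\<dots> = (\<Sum>\<beta>\<in>G c. co (c, \<beta>) * u (c, \<beta>) x)
              + (\<Sum>e\<in>S - {c}. \<Sum>\<beta>\<in>G e. co (e, \<beta>) * u (e, \<beta>) x)"
            using S c(1) by (rule sum.remove)
          also have "(\<Sum>e\<in>S - {c}. \<Sum>\<beta>\<in>G e. co (e, \<beta>) * u (e, \<beta>) x)
              = (\<Sum>a\<in>Sigma (S - {c}) G. co a * u a x)"
            using S G by (subst sum.Sigma) (auto intro!: sum.cong)
          also have "(\<Sum>\<beta>\<in>G c. co (c, \<beta>) * u (c, \<beta>) x) = (\<Sum>\<beta>\<in>A. co (c, \<beta>) * u (c, \<beta>) x)"
            using G[OF c(1)] by (intro sum.mono_neutral_right) (auto simp: A_def)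
          finally show ?thesis by (simp add: sum_negf)
        qed
        ultimately have "order_ge (2 * N) (\<lambda>t. \<Sum>\<beta>\<in>A. co (c, \<beta>) * u (c, \<beta>) (X c y t))" by simp
        then obtain g where g: "isCont g 0"
          "\<And>t. (\<Sum>\<beta>\<in>A. co (c, \<beta>) * u (c, \<beta>) (X c y t)) = t ^ (2 * N) * g t"
          unfolding order_ge_def by blast
        have u_arc: "u (c, \<beta>) (X c y t) = t ^ wt \<beta> * (mpow \<beta> y * E c (X c y t))"
          if "\<beta> \<in> A" for \<beta> t
        proof -
          have len: "length \<beta> = n" using that by (simp add: A_def G_def)
          have "mpow \<beta> (\<lambda>i. Y c i (X c y t)) = mpow \<beta> (\<lambda>i. t ^ w c i * y i)"
            using len c(1) by (intro mpow_cong) (simp add: YX)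
          then show ?thesis by (simp add: u_def mpow_weighted len wt_def)
        qed
        have "(\<Sum>\<beta> | \<beta> \<in> A \<and> wt \<beta> = d. co (c, \<beta>) * (mpow \<beta> y * E c (X c y 0))) = 0"
        proof (rule lowest_terms_vanish[OF A(1) _ g(1) _ d_le d_less])
          show "isCont (\<lambda>t. co (c, \<beta>) * (mpow \<beta> y * E c (X c y t))) 0" for \<beta>
            by (intro continuous_intros isCont_all_polys[OF E_poly] contX c(1))
          show "(\<Sum>\<beta>\<in>A. t ^ wt \<beta> * (co (c, \<beta>) * (mpow \<beta> y * E c (X c y t)))) = t ^ (2 * N) * g t" for t
            unfolding g(2)[symmetric] by (intro sum.cong) (simp_all add: u_arc mult_ac)
        qed
        moreover have "E c (X c y 0) = 1"
        proof -
          have "E c (X c y 0) = E c c"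
            unfolding E_def
            using ix(1)[OF c(1)] isCont_if_order_ge_diff(2)[OF X[OF c(1)]]
            by (intro prod.cong refl) auto
          then show ?thesis using E_self[OF c(1)] by simp
        qed
        ultimately show ?thesis by simp
      qed
      \<comment> \<open>The direction \<open>y\<close> was arbitrary, so the lowest-weight part is a
        vanishing polynomial in \<open>y\<close>.\<close>
      then have "\<forall>\<beta>\<in>{\<beta>. \<beta> \<in> A \<and> wt \<beta> = d}. co (c, \<beta>) = 0"
        using finite_subset[OF _ A(1), of "{\<beta>. \<beta> \<in> A \<and> wt \<beta> = d}"]
        by (intro mpow_independent[where n = n]) (auto simp: A_def G_def)
      then show False using \<beta>1 by (auto simp: A_def)
    qed
  qed simp
  also have "\<dots> \<le> card (multi_indices n (2 * N + D))" by (rule card_image_le) simp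
  also have "\<dots> = (2 * N + D + n) choose n" by (rule card_multi_indices)
  finally show ?thesis using S G by (simp add: card_SigmaI G_def)
qed

section \<open>Idempotents of a commutative algebra in coordinates\<close>

text \<open>\<open>\<gamma> i j k\<close> is the \<open>k\<close>-th coordinate of the product of
  the basis vectors \<open>i\<close> and \<open>j\<close>; the symmetry expresses
  commutativity.\<close>

locale structure_constants =
  fixes n :: nat and \<gamma> :: "nat \<Rightarrow> nat \<Rightarrow> nat \<Rightarrow> complex"
  assumes sym: "\<gamma> i j k = \<gamma> j i k"
begin

definition prd :: "(nat \<Rightarrow> complex) \<Rightarrow> (nat \<Rightarrow> complex) \<Rightarrow> nat \<Rightarrow> complex" where
  "prd x y k = (\<Sum>i<n. \<Sum>j<n. \<gamma> i j k * (x i * y j))"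

definition F :: "nat \<Rightarrow> (nat \<Rightarrow> complex) \<Rightarrow> complex" where
  "F k x = prd x x k - x k"

text \<open>Coordinates from \<open>n\<close> on are fixed at 0, so each zero in
  \<open>n\<close>-space is counted once.\<close>

definition S :: "(nat \<Rightarrow> complex) set" where
  "S = {x. (\<forall>i\<ge>n. x i = 0) \<and> (\<forall>k<n. F k x = 0)}"

text \<open>This is the matrix of multiplication by \<open>z\<close> minus 1; at
  \<open>z = c + c\<close> it is the Jacobian matrix of \<open>F\<close> at
  \<open>c\<close>.\<close>

definition pmat :: "(nat \<Rightarrow> complex) \<Rightarrow> complex mat" where
  "pmat z = mat n n (\<lambda>(k, j). (\<Sum>i<n. \<gamma> i j k * z i) - (if k = j then 1 else 0))"

definition pdet :: "(nat \<Rightarrow> complex) \<Rightarrow> complex" where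
  "pdet z = det (pmat z)"

lemma prd_commute: "prd x y k = prd y x k"
  unfolding prd_def by (subst sum.swap) (simp add: mult.commute sym)

lemma prd_add_left: "prd (\<lambda>i. x i + x' i) y k = prd x y k + prd x' y k"
  by (simp add: prd_def algebra_simps sum.distrib)

lemma prd_add_right: "prd x (\<lambda>i. y i + y' i) k = prd x y k + prd x y' k"
  by (simp add: prd_def algebra_simps sum.distrib)

lemma prd_smult_left: "prd (\<lambda>i. a * x i) y k = a * prd x y k"
  by (simp add: prd_def sum_distrib_left mult_ac)

lemma prd_smult_right: "prd x (\<lambda>i. a * y i) k = a * prd x y k"
  by (simp add: prd_def sum_distrib_left mult_ac)

text \<open>Taylor expansion of \<open>F\<close> at \<open>c\<close>; by commutativity its linear
  part is multiplication by \<open>c + c\<close> minus 1.\<close>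

lemma F_add: "F k (\<lambda>i. c i + u i) = F k c + (prd (\<lambda>i. c i + c i) u k - u k) + prd u u k"
  unfolding F_def prd_add_left prd_add_right by (simp add: prd_commute[of u c])

lemma F_arc:
  assumes "c \<in> S" "k < n"
  shows "F k (\<lambda>i. c i + u i) = (prd (\<lambda>i. c i + c i) u k - u k) + prd u u k"
  using assms by (simp add: F_add S_def)

lemma pmat_carrier [simp]: "pmat z \<in> carrier_mat n n"
  by (simp add: pmat_def)

lemma pmat_mult_vec:
  assumes "k < n"
  shows "(pmat z *\<^sub>v vec n u) $ k = prd z u k - u k"
proof -
  have "(pmat z *\<^sub>v vec n u) $ k = (\<Sum>j<n. ((\<Sum>i<n. \<gamma> i j k * z i) - (if k = j then 1 else 0)) * u j)"
    using assms by (simp add: pmat_def scalar_prod_def atLeast0LessThan)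
  also have "\<dots> = (\<Sum>j<n. (\<Sum>i<n. \<gamma> i j k * (z i * u j)) - (if k = j then u j else 0))"
    by (intro sum.cong) (auto simp: left_diff_distrib sum_distrib_right mult.assoc)
  also have "\<dots> = (\<Sum>j<n. \<Sum>i<n. \<gamma> i j k * (z i * u j)) - (\<Sum>j<n. if k = j then u j else 0)"
    by (rule sum_subtractf)
  also have "(\<Sum>j<n. \<Sum>i<n. \<gamma> i j k * (z i * u j)) = prd z u k"
    unfolding prd_def by (rule sum.swap)
  finally show ?thesis using assms by simp
qed

text \<open>Cramer's rule with the adjugate matrix. At a nondegenerate zero it provides a direction
  along which the derivatives of the \<open>F k\<close> take prescribed values.\<close>

lemma pdet_surjective:
  assumes "pdet z \<noteq> 0"
  shows "\<exists>y. \<forall>k<n. prd z y k - y k = w k"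
proof -
  let ?A = "pmat z"
  note adj = adj_mat[OF pmat_carrier[of z]]
  define v where "v = (1 / pdet z) \<cdot>\<^sub>v (adj_mat ?A *\<^sub>v vec n w)"
  have "?A *\<^sub>v v = (1 / pdet z) \<cdot>\<^sub>v (?A *\<^sub>v (adj_mat ?A *\<^sub>v vec n w))"
    unfolding v_def using adj(1) by (intro mult_mat_vec[of _ n n] mult_mat_vec_carrier) auto
  also have "?A *\<^sub>v (adj_mat ?A *\<^sub>v vec n w) = (?A * adj_mat ?A) *\<^sub>v vec n w"
    by (rule assoc_mult_mat_vec[OF pmat_carrier adj(1), symmetric]) simp
  also have "\<dots> = pdet z \<cdot>\<^sub>v vec n w"
    unfolding adj(2) pdet_def by (intro eq_vecI) (auto simp: smult_scalar_prod_distrib[of _ n])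
  finally have Av: "?A *\<^sub>v v = vec n w" using assms by (simp add: smult_smult_assoc)
  have "dim_vec v = n" using adj(1) by (simp add: v_def)
  then have v: "v = vec n (($) v)" by auto
  have "prd z (($) v) k - v $ k = w k" if "k < n" for k
    using pmat_mult_vec[OF that, of z "($) v"] v Av that by simp
  then show ?thesis by blast
qed

lemma pdet_eq_0_if_kernel:
  assumes "\<And>k. k < n \<Longrightarrow> prd z u k - u k = 0" "i < n" "u i \<noteq> 0"
  shows "pdet z = 0"
proof -
  have "pmat z *\<^sub>v vec n u = 0\<^sub>v n"
  proof (rule eq_vecI)
    fix k assume "k < dim_vec (0\<^sub>v n :: complex vec)"
    then show "(pmat z *\<^sub>v vec n u) $ k = 0\<^sub>v n $ k" using assms(1) by (simp add: pmat_mult_vec)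
  qed (simp add: pmat_def)
  moreover have "vec n u \<noteq> 0\<^sub>v n" using assms(2,3) by (metis index_vec index_zero_vec(1))
  ultimately show ?thesis
    unfolding pdet_def using det_0_iff_vec_prod_zero_field[OF pmat_carrier] vec_carrier by blast
qed

text \<open>A kernel vector is scaled so that one coordinate is 1; that coordinate can then
  parametrise motion along the kernel.\<close>

lemma kernel_if_pdet_eq_0:
  assumes "pdet z = 0"
  shows "\<exists>u i. (\<forall>k<n. prd z u k - u k = 0) \<and> i < n \<and> u i = 1"
proof -
  obtain v where v: "v \<in> carrier_vec n" "v \<noteq> 0\<^sub>v n" "pmat z *\<^sub>v v = 0\<^sub>v n"
    using assms det_0_iff_vec_prod_zero_field[OF pmat_carrier] unfolding pdet_def by blast
  obtain i where i: "i < n" "v $ i \<noteq> 0" using v(1,2) by (metis carrier_vecD eq_vecI index_zero_vec)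
  have vv: "v = vec n (($) v)" using v(1) by auto
  have "prd z (($) v) k - v $ k = 0" if "k < n" for k
    using pmat_mult_vec[OF that, of z "($) v"] vv v(3) that by simp
  then have "\<forall>k<n. prd z (\<lambda>j. (1 / v $ i) * v $ j) k - (1 / v $ i) * v $ k = 0"
    unfolding prd_smult_right by (simp flip: right_diff_distrib)
  then show ?thesis using i by (intro exI[of _ "\<lambda>j. (1 / v $ i) * v $ j"] exI[of _ i]) simp
qed

lemma separated:
  assumes "c \<in> S" "d \<in> S" "c \<noteq> d"
  shows "\<exists>i<n. c i \<noteq> d i"
proof (rule ccontr)
  assume "\<not> ?thesis"
  then have "c i = d i" for i using assms by (cases "i < n") (auto simp: S_def)
  then show False using assms(3) by blast
qed

text \<open>By commutativity \<open>F x - F y = (L\<^bsub>x + y\<^esub> - 1) (x - y)\<close>.\<close>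

lemma pdet_add_eq_0:
  assumes c: "c \<in> S" and d: "d \<in> S" and cd: "c \<noteq> d"
  shows "pdet (\<lambda>i. c i + d i) = 0"
proof -
  obtain i where "i < n" "c i \<noteq> d i" using separated[OF c d cd] by blast
  moreover have "prd (\<lambda>i. c i + d i) (\<lambda>i. c i - d i) k - (c k - d k) = 0" if "k < n" for k
  proof -
    have "prd (\<lambda>i. c i + d i) (\<lambda>i. c i + (- 1) * d i) k = prd c c k - prd d d k"
      unfolding prd_add_left prd_add_right prd_smult_right by (simp add: prd_commute[of d c])
    moreover have "prd c c k = c k" "prd d d k = d k" using c d that by (auto simp: S_def F_def)
    ultimately show ?thesis by simp
  qed
  ultimately show ?thesis by (intro pdet_eq_0_if_kernel[of _ "\<lambda>i. c i - d i" i]) auto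
qed

lemma F_polys: "k < n \<Longrightarrow> F k \<in> polys n 2"
  unfolding F_def[abs_def] prd_def
  by (intro polys_diff polys_sum polys_scale polys_var)
    (auto intro: polys_mult[of _ n 1 _ 1, unfolded one_add_one] polys_var)

lemma F_all_polys: "k < n \<Longrightarrow> F k \<in> all_polys n"
  using F_polys all_polysI by blast

lemma isCont_prd:
  assumes "\<And>i. i < n \<Longrightarrow> isCont (\<lambda>t. x t i) a" "\<And>i. i < n \<Longrightarrow> isCont (\<lambda>t. y t i) a"
  shows "isCont (\<lambda>t::complex. prd (x t) (y t) k) a"
  unfolding prd_def using assms by (intro continuous_intros) auto

text \<open>
  At a degenerate zero the kernel of the derivative of \<open>F\<close> contains some \<open>v\<close> with \<open>v k0 = 1\<close>; moving
  by \<open>t\<close> along \<open>v\<close> and by \<open>t\<^sup>2\<close> in the other coordinates still makes \<open>F\<close> vanish to order 2.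
\<close>

theorem nondegenerate:
  assumes fin: "finite S" and card: "card S = 2 ^ n" and c0: "c0 \<in> S"
  shows "pdet (\<lambda>i. c0 i + c0 i) \<noteq> 0"
proof
  assume "pdet (\<lambda>i. c0 i + c0 i) = 0"
  then obtain v k0 where v: "\<And>k. k < n \<Longrightarrow> prd (\<lambda>i. c0 i + c0 i) v k - v k = 0" "k0 < n" "v k0 = 1"
    using kernel_if_pdet_eq_0 by blast
  \<comment> \<open>The coordinate \<open>k0\<close> at \<open>c0\<close> gets weight 1, everything
    else weight 2: along the kernel \<open>F\<close> vanishes to order 2 already when the point
    moves by order 1.\<close>
  define w :: "(nat \<Rightarrow> complex) \<Rightarrow> nat \<Rightarrow> nat" where "w c i = (if c = c0 \<and> i = k0 then 1 else 2)" for c i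
  \<comment> \<open>At \<open>c0\<close>, subtracting the multiple of \<open>v\<close> removes the
    linear motion from the coordinates other than \<open>k0\<close>; thus \<open>Y\<close> recovers
    \<open>y\<close> from the arc \<open>X\<close>, up to powers of \<open>t\<close>.\<close>
  define Y where "Y c i x = (if c = c0 \<and> i \<noteq> k0 then x i - c i - (x k0 - c k0) * v i else x i - c i)"
    for c :: "nat \<Rightarrow> complex" and i and x :: "nat \<Rightarrow> complex"
  define X where "X c y t i = c i + (if c = c0 then t * (y k0 * v i) + t ^ 2 * (if i = k0 then 0 else y i)
      else t ^ 2 * y i)"
    for c y :: "nat \<Rightarrow> complex" and t i
  obtain D where D: "\<forall>f\<in>all_polys n. \<exists>p\<in>polys n D. f - p \<in> gen_ideal n n F"
    using finite_zeros_bounded_representatives[of n F n] F_all_polys fin unfolding S_def by blast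
  have FX: "order_ge 2 (\<lambda>t. F k (X c y t))" if c: "c \<in> S" and k: "k < n" for c y k
  proof (cases "c = c0")
    case False
    have "F k (X c y t) = t ^ 2 * (prd (\<lambda>i. c i + c i) y k - y k + t ^ 2 * prd y y k)" for t
    proof -
      have "F k (X c y t) = F k (\<lambda>i. c i + t ^ 2 * y i)" using False by (simp add: X_def[abs_def])
      also have "\<dots> = t ^ 2 * (prd (\<lambda>i. c i + c i) y k - y k + t ^ 2 * prd y y k)"
        unfolding F_arc[OF c k] prd_smult_left prd_smult_right by (simp add: algebra_simps)
      finally show ?thesis .
    qed
    then show ?thesis by (intro order_geI[rotated]) (assumption, intro continuous_intros)
  next
    case True
    define y' where "y' i = (if i = k0 then 0 else y i)" for i
    define a where "a t i = y k0 * v i + t * y' i" for t i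
    let ?c = "\<lambda>i. c i + c i"
    have "F k (X c y t) = t ^ 2 * (prd ?c y' k - y' k + prd (a t) (a t) k)" for t
    proof -
      have "F k (X c y t) = F k (\<lambda>i. c i + t * a t i)"
        using True by (simp add: X_def[abs_def] a_def y'_def distrib_left power2_eq_square mult_ac)
      also have "\<dots> = t * (prd ?c (a t) k - a t k) + t ^ 2 * prd (a t) (a t) k"
        unfolding F_arc[OF c k] prd_smult_left prd_smult_right
        by (simp add: algebra_simps power2_eq_square)
      also have "prd ?c (a t) k - a t k = y k0 * (prd ?c v k - v k) + t * (prd ?c y' k - y' k)"
        unfolding a_def prd_add_right prd_smult_right by (simp add: algebra_simps)
      \<comment> \<open>Since \<open>v\<close> lies in the kernel, the term linear in
        \<open>t\<close> disappears.\<close>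
      also have "prd ?c v k - v k = 0" using v(1)[OF k] True by simp
      finally show ?thesis by (simp add: algebra_simps power2_eq_square)
    qed
    then show ?thesis
      by (intro order_geI[rotated]) (assumption, unfold a_def, intro continuous_intros isCont_prd)
  qed
  have count: "(\<Sum>c\<in>S. card {\<beta>. length \<beta> = n \<and> (\<Sum>i<n. w c i * \<beta> ! i) < 2 * N})
      \<le> (2 * N + D + n) choose n" for N
  proof (rule weighted_jets_card_le[OF fin separated F_polys D])
    show "Y c i \<in> all_polys n" if "i < n" for c i
    proof -
      have "Y c i = (if c = c0 \<and> i \<noteq> k0 then (\<lambda>x. x i) - (\<lambda>x. c i) - ((\<lambda>x. x k0) - (\<lambda>x. c k0)) * (\<lambda>x. v i)
          else (\<lambda>x. x i) - (\<lambda>x. c i))"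
        by (auto simp: Y_def fun_eq_iff)
      moreover have "\<dots> \<in> all_polys n"
        using that v(2)
        by (auto intro!: all_polys_diff all_polys_mult all_polys_var all_polys_const)
      ultimately show ?thesis by simp
    qed
    show "order_ge 1 (\<lambda>t. X c y t i - c i)" for c y i
    proof (rule order_geI)
      show "X c y t i - c i = t ^ 1 * (if c = c0 then y k0 * v i + t * (if i = k0 then 0 else y i)
          else t * y i)" for t
        by (simp add: X_def algebra_simps power2_eq_square)
      show "isCont (\<lambda>t. if c = c0 then y k0 * v i + t * (if i = k0 then 0 else y i) else t * y i) 0"
        by (cases "c = c0") (auto intro!: continuous_intros)
    qed
    show "Y c i (X c y t) = t ^ w c i * y i" for c y i t
      using v(3) by (auto simp: X_def Y_def w_def algebra_simps)
  qed (use FX in \<open>auto simp: w_def\<close>)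
  have "(2 ^ n + 1) * ((N - 1 + n) choose n) \<le> (2 * N + D + n) choose n" if N: "N \<ge> 1" for N
  proof -
    let ?G = "\<lambda>c. {\<beta>. length \<beta> = n \<and> (\<Sum>i<n. w c i * \<beta> ! i) < 2 * N}"
    let ?M = "multi_indices n (N - 1)"
    have sum_nth: "sum_list \<beta> = (\<Sum>i<n. \<beta> ! i)" if "length \<beta> = n" for \<beta> :: "nat list"
      using that by (simp add: sum_list_sum_nth atLeast0LessThan)
    have other: "card (?G c) = (N - 1 + n) choose n" if "c \<noteq> c0" for c
    proof -
      have "?G c = ?M"
        using that N by (auto simp: w_def multi_indices_def sum_nth simp flip: sum_distrib_left)
      then show ?thesis by (simp add: card_multi_indices)
    qed
    have weight: "(\<Sum>i<n. w c0 i * \<beta> ! i) = \<beta> ! k0 + 2 * (\<Sum>i\<in>{..<n} - {k0}. \<beta> ! i)" for \<beta>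
      using v(2) by (subst sum.remove[of _ k0]) (auto simp: w_def sum_distrib_left)
    have "2 * ((N - 1 + n) choose n) \<le> card (?G c0)"
    proof -
      \<comment> \<open>The exponent at \<open>k0\<close> is replaced by
        \<open>2 * \<alpha> ! k0 + e\<close> with \<open>e < 2\<close>; each \<alpha> thus yields
        two monomials, of weight at most \<open>2 * (N - 1) + 1\<close>.\<close>
      define h where "h = (\<lambda>(e, \<alpha>). \<alpha>[k0 := 2 * \<alpha> ! k0 + e] :: nat list)"
      have "inj_on h ({..<2} \<times> ?M)"
      proof (rule inj_onI)
        fix p q assume pq: "p \<in> {..<2} \<times> ?M" "q \<in> {..<2} \<times> ?M" "h p = h q"
        obtain e \<alpha> e' \<alpha>' where [simp]: "p = (e, \<alpha>)" "q = (e', \<alpha>')" by (metis surj_pair)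
        have len: "length \<alpha> = n" "length \<alpha>' = n" using pq by (auto simp: multi_indices_def)
        have *: "\<alpha>[k0 := 2 * \<alpha> ! k0 + e] ! i = \<alpha>'[k0 := 2 * \<alpha>' ! k0 + e'] ! i" for i
          using pq(3) by (simp add: h_def)
        have "2 * \<alpha> ! k0 + e = 2 * \<alpha>' ! k0 + e'" using *[of k0] len v(2) by simp
        moreover have "e < 2" "e' < 2" using pq by auto
        ultimately have e: "e = e'" "\<alpha> ! k0 = \<alpha>' ! k0" by presburger+
        have "\<alpha> ! i = \<alpha>' ! i" if "i < n" for i
          using *[of i] e(2) that len by (cases "i = k0") auto
        then have "\<alpha> = \<alpha>'" using len by (intro nth_equalityI) auto
        then show "p = q" using e by simp
      qed
      moreover have "h ` ({..<2} \<times> ?M) \<subseteq> ?G c0"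
      proof
        fix \<beta> assume "\<beta> \<in> h ` ({..<2} \<times> ?M)"
        then obtain e \<alpha> where \<beta>: "\<beta> = \<alpha>[k0 := 2 * \<alpha> ! k0 + e]" "e < 2" "length \<alpha> = n" "sum_list \<alpha> \<le> N - 1"
          by (auto simp: h_def multi_indices_def)
        have "(\<Sum>i\<in>{..<n} - {k0}. \<beta> ! i) = (\<Sum>i\<in>{..<n} - {k0}. \<alpha> ! i)"
          using \<beta> by (intro sum.cong) auto
        moreover have "sum_list \<alpha> = \<alpha> ! k0 + (\<Sum>i\<in>{..<n} - {k0}. \<alpha> ! i)"
          using \<beta>(3) v(2) by (simp add: sum_nth sum.remove)
        moreover have "\<beta> ! k0 = 2 * \<alpha> ! k0 + e" "length \<beta> = n" using \<beta> v(2) by auto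
        ultimately show "\<beta> \<in> ?G c0" using \<beta>(2,4) N by (auto simp: weight)
      qed
      moreover have "finite (?G c0)"
      proof (rule finite_subset)
        show "?G c0 \<subseteq> multi_indices n (2 * N)"
        proof
          fix \<beta> assume \<beta>: "\<beta> \<in> ?G c0"
          then have "sum_list \<beta> \<le> (\<Sum>i<n. w c0 i * \<beta> ! i)"
            by (auto simp: sum_nth w_def intro!: sum_mono)
          then show "\<beta> \<in> multi_indices n (2 * N)" using \<beta> by (auto simp: multi_indices_def)
        qed
      qed simp
      ultimately have "card ({..<2 :: nat} \<times> ?M) \<le> card (?G c0)" using card_inj_on_le by blast
      then show ?thesis by (simp add: card_cartesian_product card_multi_indices)
    qed
    moreover have "(\<Sum>c\<in>S - {c0}. card (?G c)) = (2 ^ n - 1) * ((N - 1 + n) choose n)"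
      using other fin card c0 by simp
    moreover have "(\<Sum>c\<in>S. card (?G c)) = card (?G c0) + (\<Sum>c\<in>S - {c0}. card (?G c))"
      using fin c0 by (rule sum.remove)
    \<comment> \<open>The double count at \<open>c0\<close> and the simple counts at the other
      \<open>2 ^ n - 1\<close> points add up to \<open>2 ^ n + 1\<close> copies, one too many for
      the growth of the right side.\<close>
    ultimately have "2 * ((N - 1 + n) choose n) + (2 ^ n - 1) * ((N - 1 + n) choose n)
        \<le> (2 * N + D + n) choose n" using count[of N] by linarith
    also have "2 * ((N - 1 + n) choose n) + (2 ^ n - 1) * ((N - 1 + n) choose n)
        = (2 + (2 ^ n - 1)) * ((N - 1 + n) choose n)" by (simp only: distrib_right)
    also have "2 + (2 ^ n - 1) = (2 ^ n + 1 :: nat)" by simp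
    finally show ?thesis .
  qed
  then show False by (rule binomial_growth_contradiction)
qed

end

section \<open>Independence of powers and the Bezoutian\<close>

lemma polys_det:
  assumes "\<And>i j. i < m \<Longrightarrow> j < m \<Longrightarrow> a i j \<in> polys N 1"
  shows "(\<lambda>z. det (mat m m (\<lambda>(i, j). a i j z))) \<in> polys N m"
proof -
  have "(\<lambda>z. \<Sum>p | p permutes {0..<m}. signof p * (\<Prod>i=0..<m. a i (p i) z)) \<in> polys N m"
  proof (intro polys_sum polys_scale)
    fix p assume "p \<in> {p. p permutes {0..<m}}"
    then have "(\<lambda>z. \<Prod>i=0..<m. a i (p i) z) \<in> polys N (\<Sum>i=0..<m. 1)"
      using assms by (intro polys_prod) (auto dest: permutes_nat_less)
    then show "(\<lambda>z. \<Prod>i=0..<m. a i (p i) z) \<in> polys N m" by simp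
  qed
  moreover have "det (mat m m (\<lambda>(i, j). a i j z))
      = (\<Sum>p | p permutes {0..<m}. signof p * (\<Prod>i=0..<m. a i (p i) z))" for z
    by (auto simp: det_def permutes_nat_less intro!: sum.cong prod.cong)
  ultimately show ?thesis by simp
qed

text \<open>In each Leibniz term, constants subtracted from the entries only affect the part of
  degree below \<open>m\<close>; this is why the leading form of the characteristic determinant does
  not depend on \<open>t\<close>.\<close>

lemma polys_det_diff:
  assumes a: "\<And>i j. i < m \<Longrightarrow> j < m \<Longrightarrow> a i j \<in> polys N 1" and "m \<ge> 1"
  shows "(\<lambda>z. det (mat m m (\<lambda>(i, j). a i j z - t i j)) - det (mat m m (\<lambda>(i, j). a i j z - s i j)))
    \<in> polys N (m - 1)"
proof -
  have lin: "(\<lambda>z. a i j z - b) \<in> polys N 1" if "i < m" "j < m" for i j b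
    using polys_diff[OF a[OF that] polys_const] .
  have prod: "(\<lambda>z. (\<Prod>i<k. a i (p i) z - t i (p i)) - (\<Prod>i<k. a i (p i) z - s i (p i)))
      \<in> polys N (k - 1)" if p: "p permutes {0..<m}" and "k \<le> m" for p k
    using that(2)
  proof (induction k)
    case 0
    then show ?case using polys_const[of 0] by simp
  next
    case (Suc k)
    have pk: "p i < m" if "i < m" for i using permutes_nat_less[OF p that] .
    let ?T = "\<lambda>z. \<Prod>i<k. a i (p i) z - t i (p i)" and ?S = "\<lambda>z. \<Prod>i<k. a i (p i) z - s i (p i)"
    have S: "?S \<in> polys N k"
    proof -
      have "?S \<in> polys N (\<Sum>i<k. 1)" using Suc.prems pk by (intro polys_prod lin) auto
      then show ?thesis by simp
    qed
    \<comment> \<open>The telescoping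
      \<open>T * (a - t) - S * (a - s) = (T - S) * (a - t) + (s - t) * S\<close> reduces to products
      with one factor less.\<close>
    have "(\<lambda>z. (?T z - ?S z) * (a k (p k) z - t k (p k)) + (s k (p k) - t k (p k)) * ?S z) \<in> polys N k"
    proof (intro polys_add polys_scale S)
      show "(\<lambda>z. (?T z - ?S z) * (a k (p k) z - t k (p k))) \<in> polys N k"
      proof (cases "k = 0")
        \<comment> \<open>For \<open>k = 0\<close> the bound \<open>k - 1 + 1\<close> would be 1 by
          truncation, but both products are empty and the difference is 0.\<close>
        case True
        then show ?thesis using polys_const[of 0] by simp
      next
        case False
        have "(\<lambda>z. (?T z - ?S z) * (a k (p k) z - t k (p k))) \<in> polys N (k - 1 + 1)"
          using Suc pk by (intro polys_mult lin) auto
        then show ?thesis using False by simp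
      qed
    qed
    also have "(\<lambda>z. (?T z - ?S z) * (a k (p k) z - t k (p k)) + (s k (p k) - t k (p k)) * ?S z)
        = (\<lambda>z. (\<Prod>i<Suc k. a i (p i) z - t i (p i)) - (\<Prod>i<Suc k. a i (p i) z - s i (p i)))"
      by (simp add: fun_eq_iff algebra_simps)
    finally show ?case by simp
  qed
  have "(\<lambda>z. \<Sum>p | p permutes {0..<m}. signof p *
      ((\<Prod>i<m. a i (p i) z - t i (p i)) - (\<Prod>i<m. a i (p i) z - s i (p i)))) \<in> polys N (m - 1)"
    using prod by (intro polys_sum polys_scale) auto
  moreover have "det (mat m m (\<lambda>(i, j). a i j z - t i j))
      = (\<Sum>p | p permutes {0..<m}. signof p * (\<Prod>i<m. a i (p i) z - t i (p i)))" for z t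
    by (auto simp: det_def permutes_nat_less intro!: sum.cong prod.cong simp flip: atLeast0LessThan)
  ultimately show ?thesis by (simp add: right_diff_distrib sum_subtractf)
qed

section \<open>Bases adapted to a filtration\<close>

lemma span_finite_obtain:
  assumes "finite B" "f \<in> fvs.span B"
  obtains c where "\<And>x. f x = (\<Sum>b\<in>B. c b * b x)"
proof -
  obtain c where "f = (\<Sum>b\<in>B. cscale (c b) b)"
    using assms fvs.span_finite[OF assms(1)] by auto
  then show ?thesis using that by (simp add: sum_fun_apply)
qed

lemma in_span_sum_scale:
  assumes "\<And>i. i \<in> I \<Longrightarrow> g i \<in> fvs.span B" "\<And>x. f x = (\<Sum>i\<in>I. c i * g i x)"
  shows "f \<in> fvs.span B"
proof -
  have "f = (\<Sum>i\<in>I. cscale (c i) (g i))" using assms(2) by (simp add: fun_eq_iff sum_fun_apply)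
  then show ?thesis using assms(1) by (simp add: fvs.span_sum fvs.span_scale)
qed

text \<open>A basis at each stage extends to one at the next stage, and dependent choice yields the
  sequence. Taking the basis elements among the generators lets them later be lifted to
  monomials.\<close>

lemma nested_bases:
  assumes mono: "\<And>k. G k \<subseteq> G (Suc k)"
  shows "\<exists>B. \<forall>k. B k \<subseteq> G k \<and> fvs.independent (B k) \<and> fvs.span (B k) = fvs.span (G k) \<and> B k \<subseteq> B (Suc k)"
proof -
  have base: "\<exists>B'. B \<subseteq> B' \<and> B' \<subseteq> G k \<and> fvs.independent B' \<and> fvs.span B' = fvs.span (G k)"
    if B: "B \<subseteq> G k" "fvs.independent B" for B k
  proof -
    obtain B' where B': "B \<subseteq> B'" "B' \<subseteq> G k" "fvs.independent B'" "G k \<subseteq> fvs.span B'"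
      by (rule fvs.maximal_independent_subset_extend[OF B])
    then have "fvs.span B' = fvs.span (G k)"
      by (metis fvs.span_mono fvs.span_span subset_antisym)
    then show ?thesis using B' by blast
  qed
  have "\<exists>B. \<forall>k. (B k \<subseteq> G k \<and> fvs.independent (B k) \<and> fvs.span (B k) = fvs.span (G k))
      \<and> B k \<subseteq> B (Suc k)"
  proof (rule dependent_nat_choice)
    show "\<exists>B. B \<subseteq> G 0 \<and> fvs.independent B \<and> fvs.span B = fvs.span (G 0)"
      using base[of "{}" 0] fvs.independent_empty by auto
    fix B k assume "B \<subseteq> G k \<and> fvs.independent B \<and> fvs.span B = fvs.span (G k)"
    then show "\<exists>B'. (B' \<subseteq> G (Suc k) \<and> fvs.independent B' \<and> fvs.span B' = fvs.span (G (Suc k))) \<and> B \<subseteq> B'"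
      using base[of B "Suc k"] mono[of k] by blast
  qed
  then show ?thesis by blast
qed

context structure_constants
begin

lemma mpow_F_polys:
  assumes "length \<alpha> = n"
  shows "(\<lambda>x. mpow \<alpha> (\<lambda>k. F k x)) \<in> polys n (2 * sum_list \<alpha>)"
proof -
  have "(\<lambda>x. \<Prod>k<n. F k x ^ (\<alpha> ! k)) \<in> polys n (\<Sum>k<n. \<alpha> ! k * 2)"
    by (intro polys_prod polys_power F_polys) simp
  moreover have "(\<Sum>k<n. \<alpha> ! k * 2) = 2 * sum_list \<alpha>"
    using assms by (simp add: sum_list_sum_nth atLeast0LessThan mult.commute sum_distrib_left)
  ultimately show ?thesis using assms by (simp add: mpow_def)
qed

text \<open>
  At a nondegenerate zero the \<open>F k\<close> are local coordinates, so the lowest-degree terms in the \<open>F k\<close> of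
  a relation give a relation between the values of the \<open>e b\<close> on \<open>S\<close>.
\<close>

lemma F_powers_independent:
  assumes B: "finite B" and e: "\<And>b. b \<in> B \<Longrightarrow> e b \<in> all_polys n"
    and nd: "\<And>c. c \<in> S \<Longrightarrow> pdet (\<lambda>i. c i + c i) \<noteq> 0"
    and inj: "\<And>co. (\<And>c. c \<in> S \<Longrightarrow> (\<Sum>b\<in>B. co b * e b c) = 0) \<Longrightarrow> \<forall>b\<in>B. co b = 0"
    and A: "finite A" "A \<subseteq> B \<times> {\<alpha>. length \<alpha> = n}"
    and zero: "\<And>x. (\<Sum>p\<in>A. a p * (e (fst p) x * mpow (snd p) (\<lambda>k. F k x))) = 0"
  shows "\<forall>p\<in>A. a p = 0"
proof (rule ccontr)
  assume neg: "\<not> ?thesis"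
  define A' where "A' = {p \<in> A. a p \<noteq> 0}"
  have A': "finite A'" "A' \<noteq> {}" "A' \<subseteq> A" using A neg by (auto simp: A'_def)
  define wt where "wt p = sum_list (snd p)" for p :: "'a \<times> nat list"
  define d where "d = Min (wt ` A')"
  have d_le: "d \<le> wt p" if "p \<in> A'" for p unfolding d_def using A' that by auto
  have "d \<in> wt ` A'" unfolding d_def using A' by (intro Min_in) auto
  then obtain p1 where p1: "p1 \<in> A'" "wt p1 = d" by auto
  define T where "T = {\<alpha> \<in> snd ` A'. sum_list \<alpha> = d}"
  have T: "finite T" "\<And>\<alpha>. \<alpha> \<in> T \<Longrightarrow> length \<alpha> = n" using A' A by (auto simp: T_def)
  define a' where "a' p = (if p \<in> A' then a p else 0)" for p
  have key: "(\<Sum>b\<in>B. a' (b, \<alpha>) * e b c) = 0" if c: "c \<in> S" and \<alpha>: "\<alpha> \<in> T" for c \<alpha>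
  proof -
    have "(\<Sum>\<alpha>\<in>T. (\<Sum>b\<in>B. a' (b, \<alpha>) * e b c) * mpow \<alpha> z) = 0" for z
    proof -
      \<comment> \<open>In direction \<open>y\<close> the \<open>F k\<close> have derivatives
        \<open>z k\<close> at \<open>c\<close>, so \<open>F k\<close> is \<open>t * z k\<close> up
        to second order along this line, with \<open>z\<close> arbitrary.\<close>
      obtain y where y: "\<And>k. k < n \<Longrightarrow> prd (\<lambda>i. c i + c i) y k - y k = z k"
        using pdet_surjective[OF nd[OF c]] by blast
      have F: "F k (\<lambda>i. c i + t * y i) = t * (z k + t * prd y y k)" if "k < n" for k t
      proof -
        have "F k (\<lambda>i. c i + t * y i) = t * ((prd (\<lambda>i. c i + c i) y k - y k) + t * prd y y k)"
          unfolding F_arc[OF c that] prd_smult_left prd_smult_right by (simp add: algebra_simps)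
        then show ?thesis by (simp only: y[OF that])
      qed
      define h where "h p t = a p * (e (fst p) (\<lambda>i. c i + t * y i)
          * mpow (snd p) (\<lambda>k. z k + t * prd y y k))" for p t
      have "(\<Sum>p | p \<in> A' \<and> wt p = d. h p 0) = 0"
      proof (rule lowest_terms_vanish[OF A'(1), of h "\<lambda>_. 0" wt "Suc d" d])
        fix p assume "p \<in> A'"
        then have p: "fst p \<in> B" "length (snd p) = n" using A' A by auto
        show "isCont (h p) 0"
          unfolding h_def[abs_def]
          by (intro continuous_intros isCont_all_polys[OF e[OF p(1)]] isCont_mpow)
      next
        fix t
        have "(\<Sum>p\<in>A'. t ^ wt p * h p t)
            = (\<Sum>p\<in>A'. a p * (e (fst p) (\<lambda>i. c i + t * y i) * mpow (snd p) (\<lambda>k. F k (\<lambda>i. c i + t * y i))))"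
        proof (rule sum.cong)
          fix p assume "p \<in> A'"
          then have "length (snd p) = n" using A' A by auto
          then have "mpow (snd p) (\<lambda>k. F k (\<lambda>i. c i + t * y i)) = mpow (snd p) (\<lambda>k. t * (z k + t * prd y y k))"
            by (intro mpow_cong) (simp add: F)
          then show "t ^ wt p * h p t
              = a p * (e (fst p) (\<lambda>i. c i + t * y i) * mpow (snd p) (\<lambda>k. F k (\<lambda>i. c i + t * y i)))"
            by (simp add: mpow_smult h_def wt_def)
        qed simp
        also have "\<dots> = (\<Sum>p\<in>A. a p * (e (fst p) (\<lambda>i. c i + t * y i) * mpow (snd p) (\<lambda>k. F k (\<lambda>i. c i + t * y i))))"
          using A by (intro sum.mono_neutral_left) (auto simp: A'_def)
        finally show "(\<Sum>p\<in>A'. t ^ wt p * h p t) = t ^ Suc d * 0" using zero by simp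
      qed (use d_le in auto)
      moreover have "(\<Sum>p | p \<in> A' \<and> wt p = d. h p 0) = (\<Sum>p\<in>B \<times> T. a' p * e (fst p) c * mpow (snd p) z)"
      proof (rule sum.mono_neutral_cong_left)
        show "finite (B \<times> T)" using B T by auto
        show "{p. p \<in> A' \<and> wt p = d} \<subseteq> B \<times> T" using A A' by (force simp: T_def wt_def)
        show "\<forall>p\<in>B \<times> T - {p. p \<in> A' \<and> wt p = d}. a' p * e (fst p) c * mpow (snd p) z = 0"
          by (auto simp: a'_def T_def wt_def)
      qed (auto simp: h_def a'_def)
      moreover have "(\<Sum>p\<in>B \<times> T. a' p * e (fst p) c * mpow (snd p) z)
          = (\<Sum>\<alpha>\<in>T. \<Sum>b\<in>B. a' (b, \<alpha>) * e b c * mpow \<alpha> z)"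
        by (subst sum.swap) (simp add: sum.cartesian_product case_prod_beta)
      ultimately show ?thesis by (simp add: sum_distrib_right)
    qed
    from mpow_independent[OF T this] \<alpha> show ?thesis by blast
  qed
  have "snd p1 \<in> T" "fst p1 \<in> B" using p1 A A' by (auto simp: T_def wt_def)
  with inj[of "\<lambda>b. a' (b, snd p1)"] key have "a' p1 = 0" by auto
  then show False using p1 by (auto simp: a'_def A'_def)
qed

text \<open>The Bezoutian is a polynomial of degree at most \<open>n\<close> in \<open>n + n\<close>
  variables, the first \<open>n\<close> standing for \<open>x\<close> and the others for
  \<open>y\<close>; splitting each exponent list separates the two points.\<close>

lemma bezoutian_expansion:
  obtains a where "\<And>x y. pdet (\<lambda>i. x i + y i)
    = (\<Sum>\<eta>\<in>multi_indices (n + n) n. a \<eta> * (mpow (take n \<eta>) x * mpow (drop n \<eta>) y))"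
proof -
  have "(\<lambda>z. det (mat n n (\<lambda>(k, j). (\<Sum>i<n. \<gamma> i j k * (z i + z (n + i))) - (if k = j then 1 else 0))))
      \<in> polys (n + n) n"
    by (intro polys_det polys_diff polys_sum polys_scale polys_add polys_var polys_const) auto
  then obtain a where a: "\<And>z. pdet (\<lambda>i. z i + z (n + i)) = (\<Sum>\<eta>\<in>multi_indices (n + n) n. a \<eta> * mpow \<eta> z)"
    unfolding polys_iff pdet_def pmat_def by blast
  have "pdet (\<lambda>i. x i + y i) = (\<Sum>\<eta>\<in>multi_indices (n + n) n. a \<eta> * (mpow (take n \<eta>) x * mpow (drop n \<eta>) y))"
    for x y
  proof -
    define z where "z i = (if i < n then x i else y (i - n))" for i
    have "pmat (\<lambda>i. x i + y i) = pmat (\<lambda>i. z i + z (n + i))"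
      unfolding pmat_def by (intro cong_mat) (auto simp: z_def)
    then have "pdet (\<lambda>i. x i + y i) = (\<Sum>\<eta>\<in>multi_indices (n + n) n. a \<eta> * mpow \<eta> z)"
      using a[of z] by (simp add: pdet_def)
    also have "\<dots> = (\<Sum>\<eta>\<in>multi_indices (n + n) n. a \<eta> * (mpow (take n \<eta>) x * mpow (drop n \<eta>) y))"
    proof (rule sum.cong)
      fix \<eta> assume "\<eta> \<in> multi_indices (n + n) n"
      then have len: "length \<eta> = n + n" by (simp add: multi_indices_def)
      have "mpow \<eta> z = mpow (take n \<eta> @ drop n \<eta>) z" by simp
      also have "\<dots> = mpow (take n \<eta>) z * mpow (drop n \<eta>) (\<lambda>i. z (n + i))"
        using len by (simp only: mpow_append) simp
      also have "mpow (take n \<eta>) z = mpow (take n \<eta>) x" by (rule mpow_cong) (simp add: z_def)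
      also have "mpow (drop n \<eta>) (\<lambda>i. z (n + i)) = mpow (drop n \<eta>) y"
        by (rule mpow_cong) (simp add: z_def)
      finally show "a \<eta> * mpow \<eta> z = a \<eta> * (mpow (take n \<eta>) x * mpow (drop n \<eta>) y)" by simp
    qed simp
    finally show ?thesis .
  qed
  then show ?thesis by (rule that)
qed

end

section \<open>The Euler--Jacobi formula\<close>

context structure_constants
begin

text \<open>Values off \<open>S\<close> are set to 0, so that restrictions are equal as functions
  exactly when the polynomials agree on \<open>S\<close>.\<close>

definition restr :: "((nat \<Rightarrow> complex) \<Rightarrow> complex) \<Rightarrow> (nat \<Rightarrow> complex) \<Rightarrow> complex" where
  "restr f x = (if x \<in> S then f x else 0)"

definition gens :: "nat \<Rightarrow> ((nat \<Rightarrow> complex) \<Rightarrow> complex) set" where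
  "gens k = (\<lambda>\<alpha>. restr (mpow \<alpha>)) ` multi_indices n k"

definition V :: "nat \<Rightarrow> ((nat \<Rightarrow> complex) \<Rightarrow> complex) set" where
  "V k = fvs.span (gens k)"

definition delta :: "(nat \<Rightarrow> complex) \<Rightarrow> (nat \<Rightarrow> complex) \<Rightarrow> complex" where
  "delta d x = (if x = d then 1 else 0)"

definition J :: "(nat \<Rightarrow> complex) \<Rightarrow> complex" where
  "J c = pdet (\<lambda>i. c i + c i)"

lemma finite_gens: "finite (gens k)"
  by (simp add: gens_def)

lemma restr_mpow_in_V: "length \<alpha> = n \<Longrightarrow> sum_list \<alpha> \<le> k \<Longrightarrow> restr (mpow \<alpha>) \<in> V k"
  unfolding V_def gens_def by (rule fvs.span_base) (auto simp: multi_indices_def)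

lemma restr_polys_in_V:
  assumes "f \<in> polys n k"
  shows "restr f \<in> V k"
proof -
  obtain a where a: "\<And>x. f x = (\<Sum>\<alpha>\<in>multi_indices n k. a \<alpha> * mpow \<alpha> x)"
    using assms polys_iff by blast
  show ?thesis unfolding V_def
    by (rule in_span_sum_scale[where I = "multi_indices n k" and g = "\<lambda>\<alpha>. restr (mpow \<alpha>)" and c = a])
      (auto simp: restr_def a gens_def intro: fvs.span_base)
qed

lemma card_S_le_if_delta_in_span:
  assumes "finite S" "finite B" "\<And>d. d \<in> S \<Longrightarrow> delta d \<in> fvs.span B"
  shows "card S \<le> card B"
proof (rule card_le_if_independent_family[where u = delta])
  fix co assume co: "\<And>x. (\<Sum>d\<in>S. co d * delta d x) = 0"
  show "\<forall>d\<in>S. co d = 0"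
  proof
    fix d assume "d \<in> S"
    have "(\<Sum>e\<in>S. co e * delta e d) = (\<Sum>e\<in>S. if e = d then co e else 0)"
      by (intro sum.cong) (auto simp: delta_def)
    then show "co d = 0" using co[of d] assms(1) \<open>d \<in> S\<close> by simp
  qed
qed (use assms in auto)

section \<open>The Bezoutian on pairs of zeros\<close>

text \<open>As a function of \<open>x\<close> on \<open>S\<close>, the Bezoutian with
  \<open>y = d\<close> vanishes except at \<open>d\<close>, where it is the Jacobian.\<close>

lemma delta_bezout:
  assumes a: "\<And>x y. pdet (\<lambda>i. x i + y i)
      = (\<Sum>\<eta>\<in>multi_indices (n + n) n. a \<eta> * (mpow (take n \<eta>) x * mpow (drop n \<eta>) y))"
    and d: "d \<in> S"
  shows "J d * delta d x
    = (\<Sum>\<eta>\<in>multi_indices (n + n) n. a \<eta> * mpow (drop n \<eta>) d * restr (mpow (take n \<eta>)) x)"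
proof (cases "x \<in> S")
  case True
  have "J d * delta d x = pdet (\<lambda>i. x i + d i)"
    using pdet_add_eq_0[OF True d] by (auto simp: delta_def J_def)
  then show ?thesis using True by (simp add: a restr_def mult_ac)
next
  case False
  then show ?thesis using d by (auto simp: delta_def restr_def)
qed

lemma split_multi_index:
  assumes "\<eta> \<in> multi_indices (n + n) n"
  shows "length (take n \<eta>) = n" "length (drop n \<eta>) = n"
    "sum_list (take n \<eta>) + sum_list (drop n \<eta>) \<le> n"
proof -
  have "sum_list (take n \<eta> @ drop n \<eta>) \<le> n" using assms by (simp add: multi_indices_def)
  then show "sum_list (take n \<eta>) + sum_list (drop n \<eta>) \<le> n" by (simp only: sum_list_append)
qed (use assms in \<open>auto simp: multi_indices_def\<close>)

lemma delta_in_V: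
  assumes J: "\<And>c. c \<in> S \<Longrightarrow> J c \<noteq> 0" and d: "d \<in> S"
  shows "delta d \<in> V n"
proof -
  obtain a where a: "\<And>x y. pdet (\<lambda>i. x i + y i)
      = (\<Sum>\<eta>\<in>multi_indices (n + n) n. a \<eta> * (mpow (take n \<eta>) x * mpow (drop n \<eta>) y))"
    using bezoutian_expansion by blast
  show ?thesis unfolding V_def
  proof (rule in_span_sum_scale)
    show "restr (mpow (take n \<eta>)) \<in> fvs.span (gens n)" if "\<eta> \<in> multi_indices (n + n) n" for \<eta>
      using restr_mpow_in_V[of "take n \<eta>" n] split_multi_index[OF that] by (simp add: V_def)
    show "delta d x = (\<Sum>\<eta>\<in>multi_indices (n + n) n. (1 / J d * (a \<eta> * mpow (drop n \<eta>) d))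
        * restr (mpow (take n \<eta>)) x)" for x
    proof -
      have "delta d x = 1 / J d * (J d * delta d x)" using J[OF d] by simp
      then show ?thesis
        unfolding delta_bezout[OF a d] by (simp only: sum_distrib_left mult.assoc)
    qed
  qed
qed

text \<open>
  In the Bezoutian every term has degree at most \<open>k\<close> in \<open>x\<close> or at most \<open>n - 1 - k\<close> in \<open>y\<close>, while its
  restriction to \<open>S \<times> S\<close> is an invertible diagonal matrix.
\<close>

lemma bezout_dimension_bound:
  assumes fin: "finite S" and J: "\<And>c. c \<in> S \<Longrightarrow> J c \<noteq> 0" and kl: "k + l + 1 \<ge> n"
    and B: "finite B" "fvs.span B = V k" and C: "finite C" "fvs.span C = V l"
  shows "card S \<le> card B + card C"
proof -
  obtain a where a: "\<And>x y. pdet (\<lambda>i. x i + y i)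
      = (\<Sum>\<eta>\<in>multi_indices (n + n) n. a \<eta> * (mpow (take n \<eta>) x * mpow (drop n \<eta>) y))"
    using bezoutian_expansion by blast
  let ?M = "multi_indices (n + n) n"
  \<comment> \<open>Terms outside \<open>M1\<close> have degree at least \<open>k + 1\<close> in
    \<open>x\<close>, hence at most \<open>n - k - 1 \<le> l\<close> in \<open>y\<close>.\<close>
  define M1 where "M1 = {\<eta> \<in> ?M. sum_list (take n \<eta>) \<le> k}"
  define M2 where "M2 = ?M - M1"
  have M: "finite M1" "finite M2" "?M = M1 \<union> M2" "M1 \<inter> M2 = {}" by (auto simp: M1_def M2_def)
  have "\<exists>\<tau>. \<forall>x. restr (mpow (drop n \<eta>)) x = (\<Sum>b\<in>C. \<tau> b * b x)" if "\<eta> \<in> M2" for \<eta>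
  proof -
    have "restr (mpow (drop n \<eta>)) \<in> V l"
      using that split_multi_index[of \<eta>] kl by (intro restr_mpow_in_V) (auto simp: M1_def M2_def)
    then have "restr (mpow (drop n \<eta>)) \<in> fvs.span C" by (simp add: C(2))
    from span_finite_obtain[OF C(1) this] show ?thesis by blast
  qed
  then have "\<exists>\<tau>. \<forall>\<eta>\<in>M2. \<forall>x. restr (mpow (drop n \<eta>)) x = (\<Sum>b\<in>C. \<tau> \<eta> b * b x)"
    by (intro bchoice ballI)
  then obtain \<tau> where \<tau>: "\<And>\<eta> x. \<eta> \<in> M2 \<Longrightarrow> restr (mpow (drop n \<eta>)) x = (\<Sum>b\<in>C. \<tau> \<eta> b * b x)"
    by blast
  \<comment> \<open>Expanding the \<open>y\<close>-parts over \<open>C\<close> collects the terms in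
    \<open>M2\<close> into one function of \<open>x\<close> per element of \<open>C\<close>,
    independent of \<open>d\<close>.\<close>
  define H where "H b x = (\<Sum>\<eta>\<in>M2. a \<eta> * \<tau> \<eta> b * restr (mpow (take n \<eta>)) x)" for b x
  have "card S \<le> card (B \<union> H ` C)"
  proof (rule card_S_le_if_delta_in_span[OF fin])
    fix d assume d: "d \<in> S"
    have eq: "J d * delta d x = (\<Sum>\<eta>\<in>M1. a \<eta> * mpow (drop n \<eta>) d * restr (mpow (take n \<eta>)) x)
        + (\<Sum>b\<in>C. b d * H b x)" for x
    proof -
      have "(\<Sum>\<eta>\<in>M2. a \<eta> * mpow (drop n \<eta>) d * restr (mpow (take n \<eta>)) x)
          = (\<Sum>\<eta>\<in>M2. \<Sum>b\<in>C. b d * (a \<eta> * \<tau> \<eta> b * restr (mpow (take n \<eta>)) x))"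
      proof (rule sum.cong)
        fix \<eta> assume "\<eta> \<in> M2"
        from \<tau>[OF this, of d] have "mpow (drop n \<eta>) d = (\<Sum>b\<in>C. \<tau> \<eta> b * b d)"
          using d by (simp add: restr_def)
        then show "a \<eta> * mpow (drop n \<eta>) d * restr (mpow (take n \<eta>)) x
            = (\<Sum>b\<in>C. b d * (a \<eta> * \<tau> \<eta> b * restr (mpow (take n \<eta>)) x))"
          by (simp add: sum_distrib_left sum_distrib_right mult_ac)
      qed simp
      also have "\<dots> = (\<Sum>b\<in>C. b d * H b x)"
        by (subst sum.swap) (simp add: H_def sum_distrib_left)
      finally show ?thesis
        using delta_bezout[OF a d, of x] M by (simp add: sum.union_disjoint)
    qed
    have 1: "(\<lambda>x. \<Sum>\<eta>\<in>M1. a \<eta> * mpow (drop n \<eta>) d * restr (mpow (take n \<eta>)) x) \<in> fvs.span (B \<union> H ` C)"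
    proof (rule in_span_sum_scale)
      fix \<eta> assume "\<eta> \<in> M1"
      then have "restr (mpow (take n \<eta>)) \<in> V k"
        using split_multi_index[of \<eta>] by (intro restr_mpow_in_V) (auto simp: M1_def)
      then show "restr (mpow (take n \<eta>)) \<in> fvs.span (B \<union> H ` C)"
        using B(2) fvs.span_mono[of B "B \<union> H ` C"] by blast
    qed simp
    have 2: "(\<lambda>x. \<Sum>b\<in>C. b d * H b x) \<in> fvs.span (B \<union> H ` C)"
      by (rule in_span_sum_scale[where I = C and g = H and c = "\<lambda>b. b d"]) (auto intro: fvs.span_base)
    have "cscale (1 / J d) ((\<lambda>x. \<Sum>\<eta>\<in>M1. a \<eta> * mpow (drop n \<eta>) d * restr (mpow (take n \<eta>)) x)
        + (\<lambda>x. \<Sum>b\<in>C. b d * H b x)) \<in> fvs.span (B \<union> H ` C)"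
      by (intro fvs.span_scale fvs.span_add 1 2)
    also have "cscale (1 / J d) ((\<lambda>x. \<Sum>\<eta>\<in>M1. a \<eta> * mpow (drop n \<eta>) d * restr (mpow (take n \<eta>)) x)
        + (\<lambda>x. \<Sum>b\<in>C. b d * H b x)) = delta d"
      using J[OF d] by (simp add: fun_eq_iff flip: eq)
    finally show "delta d \<in> fvs.span (B \<union> H ` C)" .
  qed (use B C in auto)
  also have "\<dots> \<le> card B + card (H ` C)" by (rule card_Un_le)
  also have "\<dots> \<le> card B + card C" using card_image_le[OF C(1), of H] by simp
  finally show ?thesis .
qed

text \<open>Otherwise the restrictions of degree below \<open>n\<close> fill all functions on
  \<open>S\<close>, and the Bezoutian inequality for the degrees 0 and \<open>n - 1\<close> is
  strict because of the constants. Summed over all degrees this contradicts the count of products of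
  basis elements with monomials in the \<open>F k\<close>.\<close>

lemma exists_delta_not_in_V:
  assumes fin: "finite S" and card: "card S = 2 ^ n" and n: "n \<ge> 1"
    and J: "\<And>c. c \<in> S \<Longrightarrow> J c \<noteq> 0"
  shows "\<exists>d\<in>S. delta d \<notin> V (n - 1)"
proof (rule ccontr)
  assume "\<not> ?thesis"
  then have all: "delta d \<in> V (n - 1)" if "d \<in> S" for d using that by blast
  have "gens k \<subseteq> gens (Suc k)" for k
    unfolding gens_def by (intro image_mono) (auto simp: multi_indices_def)
  from nested_bases[of gens, OF this] obtain B where
    B: "\<And>k. B k \<subseteq> gens k" "\<And>k. fvs.independent (B k)" "\<And>k. fvs.span (B k) = V k" "\<And>k. B k \<subseteq> B (Suc k)"
    unfolding V_def by blast
  have finB: "finite (B k)" for k using B(1) finite_gens finite_subset by blast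
  have mono: "B k \<subseteq> B l" if "k \<le> l" for k l using lift_Suc_mono_le[of B, OF B(4) that] .
  have restr_span: "f \<in> fvs.span (delta ` S)" if "\<And>x. x \<notin> S \<Longrightarrow> f x = 0" for f
  proof (rule in_span_sum_scale[where I = S and g = delta and c = f])
    show "f x = (\<Sum>d\<in>S. f d * delta d x)" for x
    proof -
      have "(\<Sum>d\<in>S. f d * delta d x) = (\<Sum>d\<in>S. if d = x then f d else 0)"
        by (intro sum.cong) (auto simp: delta_def)
      then show ?thesis using fin that by auto
    qed
  qed (auto intro: fvs.span_base)
  have cardB: "card (B n) = 2 ^ n"
  proof (rule antisym)
    have "B n \<subseteq> fvs.span (delta ` S)"
      using B(1)[of n] by (auto simp: gens_def restr_def intro!: restr_span)
    then have "card (B n) \<le> card (delta ` S)"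
      using fvs.independent_span_bound[of "delta ` S" "B n"] B(2) fin by blast
    also have "\<dots> \<le> card S" using fin by (rule card_image_le)
    finally show "card (B n) \<le> 2 ^ n" using card by simp
    show "2 ^ n \<le> card (B n)"
      using card_S_le_if_delta_in_span[OF fin finB, of n] delta_in_V[OF J] B(3) card by simp
  qed
  define d where "d b = (LEAST k. b \<in> B k)" for b
  have d_le: "d b \<le> k \<longleftrightarrow> b \<in> B k" if "b \<in> B n" for b k
  proof
    assume "d b \<le> k"
    moreover have "b \<in> B (d b)" unfolding d_def using that by (rule LeastI)
    ultimately show "b \<in> B k" using mono by blast
  qed (simp add: d_def Least_le)
  have "\<exists>\<alpha>. \<alpha> \<in> multi_indices n (d b) \<and> b = restr (mpow \<alpha>)" if "b \<in> B n" for b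
    using d_le[OF that, of "d b"] B(1)[of "d b"] by (auto simp: gens_def)
  then obtain \<alpha> where \<alpha>: "\<And>b. b \<in> B n \<Longrightarrow> \<alpha> b \<in> multi_indices n (d b)"
    "\<And>b. b \<in> B n \<Longrightarrow> b = restr (mpow (\<alpha> b))" by metis
  define e where "e b = mpow (\<alpha> b)" for b
  have e: "e b \<in> polys n (d b)" if "b \<in> B n" for b
    unfolding e_def using \<alpha>(1)[OF that] by (intro mpow_in_polys) (auto simp: multi_indices_def)
  have inj: "\<forall>b\<in>B n. co b = 0" if co: "\<And>c. c \<in> S \<Longrightarrow> (\<Sum>b\<in>B n. co b * e b c) = 0" for co
  proof -
    have "(\<Sum>b\<in>B n. cscale (co b) b) = 0"
    proof
      fix x
      have "(\<Sum>b\<in>B n. co b * b x) = 0"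
      proof (cases "x \<in> S")
        case True
        have "b x = e b x" if "b \<in> B n" for b
          using fun_cong[OF \<alpha>(2)[OF that], of x] True by (simp add: restr_def e_def)
        then have "(\<Sum>b\<in>B n. co b * b x) = (\<Sum>b\<in>B n. co b * e b x)"
          by (intro sum.cong) auto
        then show ?thesis using co[OF True] by simp
      next
        case False
        have "b x = 0" if "b \<in> B n" for b
          using fun_cong[OF \<alpha>(2)[OF that], of x] False by (simp add: restr_def)
        then show ?thesis by (intro sum.neutral) simp
      qed
      then show "(\<Sum>b\<in>B n. cscale (co b) b) x = 0 x" by (simp add: sum_fun_apply)
    qed
    then show ?thesis using fvs.independentD[OF B(2) finB subset_refl] by blast
  qed
  \<comment> \<open>The products of an \<open>e b\<close> with a monomial in the \<open>F k\<close>
    are independent polynomials, of degree at most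
    \<open>d b + 2 * sum_list \<beta>\<close>.\<close>
  have count: "card {(b, \<beta>). b \<in> B n \<and> length \<beta> = n \<and> d b + 2 * sum_list \<beta> \<le> D}
      \<le> (D + n) choose n" for D
  proof -
    let ?A = "{(b, \<beta>). b \<in> B n \<and> length \<beta> = n \<and> d b + 2 * sum_list \<beta> \<le> D}"
    have "finite ?A"
      by (rule finite_subset[OF _ finite_cartesian_product[OF finB[of n] finite_multi_indices[of n D]]])
        (auto simp: multi_indices_def)
    have "card ?A \<le> card (mpow ` multi_indices n D)"
    proof (rule card_le_if_independent_family[where u = "\<lambda>p x. e (fst p) x * mpow (snd p) (\<lambda>k. F k x)"])
      fix p assume "p \<in> ?A"
      then have "(\<lambda>x. e (fst p) x * mpow (snd p) (\<lambda>k. F k x)) \<in> polys n (d (fst p) + 2 * sum_list (snd p))"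
        "d (fst p) + 2 * sum_list (snd p) \<le> D"
        using e mpow_F_polys by (auto intro!: polys_mult)
      then show "(\<lambda>x. e (fst p) x * mpow (snd p) (\<lambda>k. F k x)) \<in> fvs.span (mpow ` multi_indices n D)"
        using polysD_mono unfolding polys_def by blast
    next
      fix co assume "\<And>x. (\<Sum>p\<in>?A. co p * (e (fst p) x * mpow (snd p) (\<lambda>k. F k x))) = 0"
      then show "\<forall>p\<in>?A. co p = 0"
        using e J inj \<open>finite ?A\<close>
        by (intro F_powers_independent[of "B n" e]) (auto simp: finB J_def intro: all_polysI)
    qed (use \<open>finite ?A\<close> in auto)
    also have "\<dots> \<le> card (multi_indices n D)" by (rule card_image_le) simp
    finally show ?thesis by (simp add: card_multi_indices)
  qed
  define v where "v k = card (B k)" for k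
  have "n * 2 ^ n \<le> 2 * (\<Sum>b\<in>B n. d b)"
    using degree_sum_lower_bound[OF finB cardB count] .
  \<comment> \<open>Double counting: \<open>b\<close> belongs to \<open>B k\<close> for exactly
    \<open>n - d b\<close> of the values \<open>k < n\<close>.\<close>
  moreover have "(\<Sum>b\<in>B n. d b) + (\<Sum>k<n. v k) = n * 2 ^ n"
  proof -
    have "d b + (\<Sum>k<n. if b \<in> B k then 1 else 0) = n" if "b \<in> B n" for b
    proof -
      have "(\<Sum>k<n. if b \<in> B k then 1 else 0) = card {k \<in> {..<n}. b \<in> B k}"
        by (simp add: sum.If_cases Int_def)
      also have "{k \<in> {..<n}. b \<in> B k} = {d b..<n}" by (auto simp flip: d_le[OF that])
      finally show ?thesis using d_le[OF that, of n] that by simp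
    qed
    then have "(\<Sum>b\<in>B n. d b + (\<Sum>k<n. if b \<in> B k then 1 else 0)) = (\<Sum>b\<in>B n. n)"
      by (intro sum.cong) auto
    moreover have "(\<Sum>b\<in>B n. \<Sum>k<n. if b \<in> B k then 1 else 0) = (\<Sum>k<n. v k)"
    proof -
      have "(\<Sum>b\<in>B n. if b \<in> B k then 1 else 0) = v k" if "k < n" for k
        using mono[of k n] that finB[of n] by (simp add: sum.If_cases v_def Int_absorb1)
      then show ?thesis by (subst sum.swap) (intro sum.cong, auto)
    qed
    ultimately show ?thesis by (simp add: sum.distrib cardB mult.commute)
  qed
  moreover have "n * 2 ^ n < 2 * (\<Sum>k<n. v k)"
  proof -
    \<comment> \<open>Here \<open>k\<close> is paired with \<open>n - 1 - k\<close>. At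
      \<open>k = 0\<close> the inequality is strict, as \<open>v (n - 1)\<close> alone is at least
      \<open>2 ^ n\<close> and the constants make \<open>v 0\<close> positive.\<close>
    have "(\<Sum>k<n. 2 ^ n) < (\<Sum>k<n. v k + v (n - Suc k))"
    proof (rule sum_strict_mono_ex1)
      show "\<forall>k\<in>{..<n}. 2 ^ n \<le> v k + v (n - Suc k)"
        using bezout_dimension_bound[OF fin J _ finB B(3) finB B(3)] card by (auto simp: v_def)
      have "v 0 \<noteq> 0"
      proof
        assume "v 0 = 0"
        then have "B 0 = {}" using finB by (simp add: v_def)
        then have "V 0 = {0}" using B(3)[of 0] by simp
        then have 0: "restr (mpow (replicate n 0)) = 0"
          using restr_mpow_in_V[of "replicate n 0" 0] by (simp add: sum_list_replicate)
        obtain c where "c \<in> S" using card by fastforce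
        then show False using fun_cong[OF 0, of c] by (simp add: restr_def mpow_def)
      qed
      moreover have "2 ^ n \<le> v (n - 1)"
        using card_S_le_if_delta_in_span[OF fin finB, of "n - 1"] all B(3) card by (simp add: v_def)
      ultimately show "\<exists>k\<in>{..<n}. 2 ^ n < v k + v (n - Suc k)"
        using n by (intro bexI[of _ 0]) auto
    qed simp
    also have "\<dots> = 2 * (\<Sum>k<n. v k)"
      using sum.nat_diff_reindex[of v n] by (simp add: sum.distrib)
    finally show ?thesis by simp
  qed
  ultimately show False by linarith
qed

text \<open>Modulo \<open>V (n - 1)\<close> each \<open>J d * delta d\<close> equals the same
  \<open>q\<close>, the restriction of the terms of degree \<open>n\<close> in \<open>x\<close>,
  which are constant in \<open>y\<close>. Expanding \<open>g\<close> in the \<open>delta d\<close>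
  puts \<open>q\<close> times the sum in question into \<open>V (n - 1)\<close>; if the sum were
  nonzero, \<open>q\<close> and with it every \<open>delta d\<close> would lie there.\<close>

theorem euler_jacobi:
  assumes fin: "finite S" and card: "card S = 2 ^ n" and n: "n \<ge> 1"
    and J: "\<And>c. c \<in> S \<Longrightarrow> J c \<noteq> 0"
    and g: "g \<in> polys n (n - 1)"
  shows "(\<Sum>c\<in>S. g c / J c) = 0"
proof (rule ccontr)
  assume nz: "(\<Sum>c\<in>S. g c / J c) \<noteq> 0"
  let ?s = "\<Sum>c\<in>S. g c / J c" and ?V = "V (n - 1)"
  obtain a where a: "\<And>x y. pdet (\<lambda>i. x i + y i)
      = (\<Sum>\<eta>\<in>multi_indices (n + n) n. a \<eta> * (mpow (take n \<eta>) x * mpow (drop n \<eta>) y))"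
    using bezoutian_expansion by blast
  let ?M = "multi_indices (n + n) n"
  define M1 where "M1 = {\<eta> \<in> ?M. sum_list (take n \<eta>) \<le> n - 1}"
  define M2 where "M2 = ?M - M1"
  have M: "finite M1" "finite M2" "?M = M1 \<union> M2" "M1 \<inter> M2 = {}" by (auto simp: M1_def M2_def)
  define q where "q x = (\<Sum>\<eta>\<in>M2. a \<eta> * restr (mpow (take n \<eta>)) x)" for x
  define r where "r d x = (\<Sum>\<eta>\<in>M1. a \<eta> * mpow (drop n \<eta>) d * restr (mpow (take n \<eta>)) x)" for d x
  have r: "r d \<in> ?V" for d
    unfolding V_def
  proof (rule in_span_sum_scale)
    fix \<eta> assume "\<eta> \<in> M1"
    then show "restr (mpow (take n \<eta>)) \<in> fvs.span (gens (n - 1))"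
      unfolding V_def[symmetric] using split_multi_index[of \<eta>]
      by (intro restr_mpow_in_V) (auto simp: M1_def)
  qed (simp add: r_def)
  have delta: "J d * delta d x = r d x + q x" if d: "d \<in> S" for d x
  proof -
    have "(\<Sum>\<eta>\<in>M2. a \<eta> * mpow (drop n \<eta>) d * restr (mpow (take n \<eta>)) x) = q x"
      unfolding q_def
    proof (rule sum.cong)
      fix \<eta> assume \<eta>: "\<eta> \<in> M2"
      then have "\<not> sum_list (take n \<eta>) \<le> n - 1" "\<eta> \<in> ?M" by (auto simp: M1_def M2_def)
      then have "sum_list (drop n \<eta>) = 0" using split_multi_index(3)[of \<eta>] by linarith
      then have "drop n \<eta> ! i = 0" if "i < length (drop n \<eta>)" for i
        using nth_mem[OF that] by (simp only: sum_list_eq_0_iff)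
      then have "mpow (drop n \<eta>) d = 1" unfolding mpow_def by (intro prod.neutral) simp
      then show "a \<eta> * mpow (drop n \<eta>) d * restr (mpow (take n \<eta>)) x = a \<eta> * restr (mpow (take n \<eta>)) x"
        by simp
    qed simp
    then show ?thesis
      using delta_bezout[OF a d, of x] M by (simp add: sum.union_disjoint r_def)
  qed
  have sub: "fvs.subspace ?V" unfolding V_def by (rule fvs.subspace_span)
  have "q \<in> ?V"
  proof -
    have "restr g x - (\<Sum>d\<in>S. g d / J d * r d x) = ?s * q x" for x
    proof -
      have "restr g x = (\<Sum>d\<in>S. g d * delta d x)"
      proof -
        have "(\<Sum>d\<in>S. g d * delta d x) = (\<Sum>d\<in>S. if d = x then g d else 0)"
          by (intro sum.cong) (auto simp: delta_def)
        then show ?thesis using fin by (auto simp: restr_def)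
      qed
      also have "\<dots> = (\<Sum>d\<in>S. g d / J d * (r d x + q x))"
        using J by (intro sum.cong) (auto simp flip: delta)
      finally show ?thesis
        by (simp add: algebra_simps add_divide_distrib sum.distrib sum_distrib_left)
    qed
    then have "q = cscale (1 / ?s) (restr g - (\<Sum>d\<in>S. cscale (g d / J d) (r d)))"
      using nz by (simp add: fun_eq_iff sum_fun_apply)
    also have "\<dots> \<in> ?V"
      using restr_polys_in_V[OF g] r sub
      by (intro fvs.subspace_scale fvs.subspace_diff fvs.subspace_sum) auto
    finally show ?thesis .
  qed
  have "delta d \<in> ?V" if "d \<in> S" for d
  proof -
    have "delta d = cscale (1 / J d) (r d + q)"
      using J[OF that] by (simp add: fun_eq_iff flip: delta[OF that])
    then show ?thesis using sub r \<open>q \<in> ?V\<close> by (simp add: fvs.subspace_scale fvs.subspace_add)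
  qed
  then show False using exists_delta_not_in_V[OF fin card n J] by blast
qed

section \<open>Characteristic determinants at the zeros\<close>

definition cmat :: "complex \<Rightarrow> (nat \<Rightarrow> complex) \<Rightarrow> complex mat" where
  "cmat t z = mat n n (\<lambda>(k, j). (\<Sum>i<n. \<gamma> i j k * z i) - (if k = j then t else 0))"

text \<open>Multiplication by \<open>c + c\<close> minus 1 is twice multiplication by
  \<open>c\<close> minus 1/2.\<close>

lemma J_eq: "J c = 2 ^ n * det (cmat (1/2) c)"
proof -
  have "pmat (\<lambda>i. c i + c i) = 2 \<cdot>\<^sub>m cmat (1/2) c"
    by (rule eq_matI) (auto simp: pmat_def cmat_def algebra_simps sum.distrib sum_distrib_left)
  then show ?thesis unfolding J_def pdet_def by (simp add: det_smult cmat_def)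
qed

text \<open>For \<open>n \<ge> 1\<close> the difference of the determinants at \<open>t\<close> and
  at 1/2 has degree below \<open>n\<close> in \<open>c\<close>, so the Euler-Jacobi formula
  annihilates it after division by \<open>J c\<close>; the remaining quotients are 1 and count the
  points.\<close>

theorem sum_det_quotients:
  assumes fin: "finite S" and card: "card S = 2 ^ n"
  shows "\<And>c. c \<in> S \<Longrightarrow> det (cmat (1/2) c) \<noteq> 0"
    and "(\<Sum>c\<in>S. det (cmat t c) / det (cmat (1/2) c)) = 2 ^ n"
proof -
  have J: "J c \<noteq> 0" if "c \<in> S" for c using nondegenerate[OF fin card that] by (simp add: J_def)
  then show nz: "det (cmat (1/2) c) \<noteq> 0" if "c \<in> S" for c using that by (auto simp: J_eq)
  have sum0: "(\<Sum>c\<in>S. (det (cmat t c) - det (cmat (1/2) c)) / J c) = 0"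
  proof (cases "n = 0")
    \<comment> \<open>For \<open>n = 0\<close> there is no degree below \<open>n\<close>; both
      determinants are empty and equal 1.\<close>
    case True
    then have "det (cmat t c) = 1" for t c using det_dim_zero[of "cmat t c"] True unfolding cmat_def by simp
    then show ?thesis by simp
  next
    case False
    then have n: "n \<ge> 1" by simp
    have "(\<lambda>z. \<Sum>i<n. \<gamma> i j k * z i) \<in> polys n 1" for j k
      by (intro polys_sum polys_scale polys_var) auto
    from polys_det_diff[OF this n, of "\<lambda>k j. j" "\<lambda>k j. k" "\<lambda>k j. if k = j then t else 0" "\<lambda>k j. if k = j then 1/2 else 0"]
    have "(\<lambda>z. det (cmat t z) - det (cmat (1/2) z)) \<in> polys n (n - 1)"
      by (simp add: cmat_def)
    from euler_jacobi[OF fin card n J this] show ?thesis .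
  qed
  then have "(\<Sum>c\<in>S. (det (cmat t c) - det (cmat (1/2) c)) / det (cmat (1/2) c)) = 0"
  proof -
    have "(\<Sum>c\<in>S. (det (cmat t c) - det (cmat (1/2) c)) / J c)
        = 1 / 2 ^ n * (\<Sum>c\<in>S. (det (cmat t c) - det (cmat (1/2) c)) / det (cmat (1/2) c))"
      unfolding sum_distrib_left J_eq by (intro sum.cong) simp_all
    then show ?thesis using sum0 by simp
  qed
  moreover have "(\<Sum>c\<in>S. (det (cmat t c) - det (cmat (1/2) c)) / det (cmat (1/2) c))
      = (\<Sum>c\<in>S. det (cmat t c) / det (cmat (1/2) c) - 1)"
    using nz by (intro sum.cong) (auto simp: diff_divide_distrib)
  ultimately show "(\<Sum>c\<in>S. det (cmat t c) / det (cmat (1/2) c)) = 2 ^ n"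
    using card by (simp add: sum_subtractf)
qed

end

section \<open>Transfer to the complexification\<close>

text \<open>Holding at infinitely many \<open>t\<close>, the identity is one of polynomials: the
  weighted sum of the \<open>p c\<close> is constant, so its derivatives of positive order vanish at
  every \<open>s\<close>.\<close>

lemma higher_pderiv_sum_eq_0:
  fixes p :: "'c \<Rightarrow> complex poly"
  assumes sum: "\<And>t. (\<Sum>c\<in>A. poly (p c) (of_real t) / w c) = a" and k: "k \<ge> 1"
  shows "(\<Sum>c\<in>A. poly ((pderiv ^^ k) (p c)) s / w c) = 0"
proof -
  define q where "q = (\<Sum>c\<in>A. Polynomial.smult (1 / w c) (p c))"
  have "poly (q - [:a:]) (of_real t) = 0" for t
    using sum[of t] by (simp add: q_def poly_sum)
  then have "range complex_of_real \<subseteq> {x. poly (q - [:a:]) x = 0}" by auto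
  moreover have "infinite (range complex_of_real)"
    using finite_imageD[of complex_of_real UNIV] inj_of_real infinite_UNIV_char_0 by blast
  ultimately have "q - [:a:] = 0"
    using poly_roots_finite finite_subset by blast
  then have "q = [:a:]" by simp
  then have "(pderiv ^^ k) q = 0"
  proof -
    obtain m where "k = Suc m" using k by (metis Suc_le_D One_nat_def)
    moreover have "(pderiv ^^ m) 0 = (0 :: complex poly)" by (induction m) auto
    ultimately show ?thesis using \<open>q = [:a:]\<close> by (simp add: funpow_swap1 pderiv_pCons del: funpow.simps(2))
       (simp add: funpow_swap1)
  qed
  moreover have "(pderiv ^^ k) q = (\<Sum>c\<in>A. Polynomial.smult (1 / w c) ((pderiv ^^ k) (p c)))"
    unfolding q_def by (induction k) (simp_all add: pderiv_sum pderiv_smult)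
  ultimately have "poly (\<Sum>c\<in>A. Polynomial.smult (1 / w c) ((pderiv ^^ k) (p c))) s = 0" by simp
  then show ?thesis by (simp add: poly_sum)
qed

lemma poly_chi_mat:
  fixes M :: "complex mat"
  assumes M: "M \<in> carrier_mat n n"
  shows "poly (chi_mat M) t = det (mat n n (\<lambda>(i, j). M $$ (i, j) - (if i = j then t else 0)))"
proof -
  have ev: "comm_ring_hom (\<lambda>p. poly p t)" by unfold_locales auto
  have "poly (chi_mat M) t = det (map_mat (\<lambda>p. poly p t)
      (map_mat (\<lambda>a. [:a:]) M - [:0, 1:] \<cdot>\<^sub>m 1\<^sub>m (dim_row M)))"
    unfolding chi_mat_def by (rule comm_ring_hom.hom_det[OF ev, symmetric])
  also have "map_mat (\<lambda>p. poly p t) (map_mat (\<lambda>a. [:a:]) M - [:0, 1:] \<cdot>\<^sub>m 1\<^sub>m (dim_row M))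
      = mat n n (\<lambda>(i, j). M $$ (i, j) - (if i = j then t else 0))"
    using M by (intro eq_matI) auto
  finally show ?thesis .
qed

lemma map_poly_chi_mat:
  fixes \<iota> :: "'k::field \<Rightarrow> complex"
  assumes "field_hom \<iota>" and M: "M \<in> carrier_mat n n"
  shows "map_poly \<iota> (chi_mat M) = chi_mat (map_mat \<iota> M)"
proof -
  interpret field_hom \<iota> by fact
  interpret mp: map_poly_comm_ring_hom \<iota> ..
  have "map_poly \<iota> (chi_mat M) = det (map_mat (map_poly \<iota>)
      (map_mat (\<lambda>a. [:a:]) M - [:0, 1:] \<cdot>\<^sub>m 1\<^sub>m (dim_row M)))"
    unfolding chi_mat_def by (simp add: mp.hom_det)
  also have "map_mat (map_poly \<iota>) (map_mat (\<lambda>a. [:a:]) M - [:0, 1:] \<cdot>\<^sub>m 1\<^sub>m (dim_row M))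
      = map_mat (\<lambda>a. [:a:]) (map_mat \<iota> M) - [:0, 1:] \<cdot>\<^sub>m 1\<^sub>m (dim_row (map_mat \<iota> M))"
    using M by (intro eq_matI) (auto simp: mp.hom_minus mp.hom_mult map_poly_pCons_hom mp.hom_uminus)
  finally show ?thesis by (simp add: chi_mat_def)
qed

section \<open>Coordinates on the complexification\<close>

context fd_nonassoc_algebra
begin

definition gam :: "nat \<Rightarrow> nat \<Rightarrow> nat \<Rightarrow> complex" where
  "gam i j k = \<iota> (coord scale es (amul (es ! i) (es ! j)) k)"

lemma structure_constants_gam:
  assumes "\<And>x y. amul x y = amul y x"
  shows "structure_constants gam"
  by unfold_locales (simp add: gam_def assms)

text \<open>Entries of a vector beyond its dimension are unspecified; setting them to 0 matches the
  normalisation of \<open>S\<close>.\<close>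

definition coords :: "complex vec \<Rightarrow> nat \<Rightarrow> complex" where
  "coords v i = (if i < length es then v $ i else 0)"

lemma bij_betw_coords:
  assumes "\<And>x y. amul x y = amul y x"
  shows "bij_betw coords (cx_Idm0 \<iota> scale amul es) (structure_constants.S (length es) gam)"
proof -
  interpret structure_constants "length es" gam by (rule structure_constants_gam[OF assms])
  have prd: "cx_mult \<iota> scale amul es u v $ k = prd (coords u) (coords v) k" if "k < length es" for u v k
    using that by (simp add: cx_mult_def prd_def coords_def gam_def)
  show ?thesis
  proof (rule bij_betwI[of _ _ _ "vec (length es)"])
    show "coords \<in> cx_Idm0 \<iota> scale amul es \<rightarrow> S"
    proof
      fix v assume v: "v \<in> cx_Idm0 \<iota> scale amul es"
      have "F k (coords v) = 0" if "k < length es" for k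
        using prd[OF that, of v v] v that by (simp add: F_def cx_Idm0_def coords_def)
      then show "coords v \<in> S" by (simp add: S_def coords_def)
    qed
    show "vec (length es) \<in> S \<rightarrow> cx_Idm0 \<iota> scale amul es"
    proof
      fix x assume x: "x \<in> S"
      then have c: "coords (vec (length es) x) = x" by (auto simp: coords_def S_def fun_eq_iff)
      have "cx_mult \<iota> scale amul es (vec (length es) x) (vec (length es) x) = vec (length es) x"
      proof (rule eq_vecI)
        fix k assume k: "k < dim_vec (vec (length es) x)"
        then show "cx_mult \<iota> scale amul es (vec (length es) x) (vec (length es) x) $ k = vec (length es) x $ k"
          using x by (simp add: prd c S_def F_def)
      qed (simp add: cx_mult_def)
      then show "vec (length es) x \<in> cx_Idm0 \<iota> scale amul es" by (simp add: cx_Idm0_def cx_carrier_def)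
    qed
    show "vec (length es) (coords v) = v" if "v \<in> cx_Idm0 \<iota> scale amul es" for v
      using that by (intro eq_vecI) (auto simp: cx_Idm0_def cx_carrier_def coords_def)
    show "coords (vec (length es) x) = x" if "x \<in> S" for x
      using that by (auto simp: coords_def S_def fun_eq_iff)
  qed
qed

lemma poly_cx_chi:
  assumes "\<And>x y. amul x y = amul y x"
  shows "poly (cx_chi \<iota> scale amul es v) t = det (structure_constants.cmat (length es) gam t (coords v))"
proof -
  interpret structure_constants "length es" gam by (rule structure_constants_gam[OF assms])
  have "cx_mult \<iota> scale amul es v (unit_vec (length es) j) $ k = (\<Sum>i<length es. gam i j k * coords v i)"
    if "k < length es" "j < length es" for j k
  proof -
    have "(\<Sum>j'<length es. gam i j' k * (v $ i * unit_vec (length es) j $ j')) = gam i j k * coords v i"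
      if "i < length es" for i
    proof -
      have "(\<Sum>j'<length es. gam i j' k * (v $ i * unit_vec (length es) j $ j'))
          = (\<Sum>j'<length es. if j' = j then gam i j k * v $ i else 0)"
        using \<open>j < length es\<close> by (intro sum.cong) auto
      then show ?thesis using \<open>j < length es\<close> that by (simp add: coords_def)
    qed
    then show ?thesis using that unfolding cx_mult_def gam_def[symmetric] by simp
  qed
  then show ?thesis
    unfolding cx_chi_def cmat_def
    by (subst poly_chi_mat[of _ "length es"]) (auto intro!: arg_cong[of _ _ det] cong_mat)
qed

lemma inj_tensor_one: "inj (\<lambda>x. tensor \<iota> scale es x 1)"
proof (rule injI)
  fix x y assume eq: "tensor \<iota> scale es x 1 = tensor \<iota> scale es y 1"
  have "coord scale es x i = coord scale es y i" if "i < length es" for i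
  proof -
    have "tensor \<iota> scale es x 1 $ i = tensor \<iota> scale es y 1 $ i" by (simp only: eq)
    then show ?thesis using that by (simp add: tensor_def)
  qed
  then show "x = y" using expand[of x] expand[of y] by simp
qed

lemma tensor_one_Idm0: "c \<in> Idm0 amul \<Longrightarrow> tensor \<iota> scale es c 1 \<in> cx_Idm0 \<iota> scale amul es"
  using tensor_bilinear(1) by (simp add: Idm0_def cx_Idm0_def cx_mult_tensor)

text \<open>The embedding sends \<open>es ! j\<close> to the \<open>j\<close>-th unit vector, so the
  matrices of the two multiplication operators correspond entrywise under
  \<open>\<iota>\<close>.\<close>

lemma map_poly_chi: "map_poly \<iota> (chi scale amul es c) = cx_chi \<iota> scale amul es (tensor \<iota> scale es c 1)"
proof -
  have unit: "unit_vec (length es) j = tensor \<iota> scale es (es ! j) 1" if "j < length es" for j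
    using that by (intro eq_vecI) (auto simp: tensor_def coord_basis)
  have "map_mat \<iota> (mat (length es) (length es) (\<lambda>(i, j). coord scale es (amul c (es ! j)) i))
      = mat (length es) (length es)
          (\<lambda>(i, j). cx_mult \<iota> scale amul es (tensor \<iota> scale es c 1) (unit_vec (length es) j) $ i)"
    by (intro eq_matI) (auto simp: unit cx_mult_tensor, simp add: tensor_def)
  then show ?thesis
    unfolding chi_def cx_chi_def using map_poly_chi_mat[OF emb.field_hom_axioms, of _ "length es"] by simp
qed

end

text \<open>The sums run over the idempotents of the complexification. \<open>Idm0 amul\<close> may
  contain fewer: for \<complex> as a real algebra it yields
  \<open>4 * t ^ 2 + 4 * (1 - t) ^ 2\<close>, which is not constant, so the version over
  \<open>Idm0 amul\<close> supposes that all \<open>2 ^ n\<close> idempotents are there.\<close>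

theorem theorem4p1:
  fixes \<iota> :: "'k::field \<Rightarrow> complex"
    and scale :: "'k \<Rightarrow> 'a::ab_group_add \<Rightarrow> 'a"
    and amul :: "'a \<Rightarrow> 'a \<Rightarrow> 'a"
    and es :: "'a list"
    and n :: nat
  assumes algebra: "fd_nonassoc_algebra \<iota> scale amul es"
    and commutative: "\<And>x y. amul x y = amul y x"
    and dimension: "vector_space.dim scale (UNIV :: 'a set) = n"
    and generic: "generic \<iota> scale amul es"
  shows "(\<forall>t::real.
        (\<Sum>c\<in>cx_Idm0 \<iota> scale amul es.
           poly (cx_chi \<iota> scale amul es c) (of_real t) / poly (cx_chi \<iota> scale amul es c) (1/2))
        = 2 ^ n)
    \<and> (\<forall>k\<in>{1..n}.
        (\<Sum>c\<in>cx_Idm0 \<iota> scale amul es.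
           poly ((pderiv ^^ k) (cx_chi \<iota> scale amul es c)) (1/2)
             / poly (cx_chi \<iota> scale amul es c) (1/2))
        = 0)
    \<and> (card (Idm0 amul) = 2 ^ n \<longrightarrow>
        (\<forall>t::real.
          (\<Sum>c\<in>Idm0 amul.
             poly (map_poly \<iota> (chi scale amul es c)) (of_real t)
               / poly (map_poly \<iota> (chi scale amul es c)) (1/2))
          = 2 ^ n)
      \<and> (\<forall>k\<in>{1..n}.
          (\<Sum>c\<in>Idm0 amul.
             poly ((pderiv ^^ k) (map_poly \<iota> (chi scale amul es c))) (1/2)
               / poly (map_poly \<iota> (chi scale amul es c)) (1/2))
          = 0))"
proof -
  interpret fd_nonassoc_algebra \<iota> scale amul es by (rule algebra)
  interpret structure_constants "length es" gam by (rule structure_constants_gam[OF commutative])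
  let ?I = "cx_Idm0 \<iota> scale amul es" and ?chi = "cx_chi \<iota> scale amul es"
  let ?T = "\<lambda>c. tensor \<iota> scale es c 1"
  have n: "length es = n" using dimension dim_eq_length by simp
  have cardI: "card ?I = 2 ^ n" using generic dimension by (simp add: generic_def)
  have bij: "bij_betw coords ?I S" by (rule bij_betw_coords[OF commutative])
  have card: "card S = 2 ^ length es" using bij_betw_same_card[OF bij] cardI n by simp
  then have fin: "finite S" by (intro card_ge_0_finite) simp
  have sum: "(\<Sum>c\<in>?I. poly (?chi c) t / poly (?chi c) (1/2)) = 2 ^ n" for t
    using sum_det_quotients(2)[OF fin card, of t]
      sum.reindex_bij_betw[OF bij, of "\<lambda>x. det (cmat t x) / det (cmat (1/2) x)"]
    unfolding poly_cx_chi[OF commutative] by (simp only: n)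
  have deriv: "(\<Sum>c\<in>?I. poly ((pderiv ^^ k) (?chi c)) (1/2) / poly (?chi c) (1/2)) = 0"
    if "k \<in> {1..n}" for k
    using that by (intro higher_pderiv_sum_eq_0[OF sum]) simp
  \<comment> \<open>The embedding of idempotents is injective, so equal finite cardinalities make it
    onto.\<close>
  have real: "bij_betw ?T (Idm0 amul) ?I" if "card (Idm0 amul) = 2 ^ n"
  proof -
    have inj: "inj_on ?T (Idm0 amul)" using inj_tensor_one by (rule inj_on_subset) simp
    have "?T ` Idm0 amul \<subseteq> ?I" using tensor_one_Idm0 by blast
    moreover have "card (?T ` Idm0 amul) = card ?I" using card_image[OF inj] that cardI by simp
    moreover have "finite ?I" using cardI by (intro card_ge_0_finite) simp
    ultimately have "?T ` Idm0 amul = ?I" by (intro card_subset_eq)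
    then show ?thesis using inj by (simp add: bij_betw_def)
  qed
  show ?thesis
    unfolding map_poly_chi
    using sum deriv sum.reindex_bij_betw[OF real, of "\<lambda>c. poly (?chi c) _ / poly (?chi c) (1/2)"]
      sum.reindex_bij_betw[OF real, of "\<lambda>c. poly ((pderiv ^^ _) (?chi c)) (1/2) / poly (?chi c) (1/2)"]
    by simp
qed

end
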